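(* Let $s=(s_n)_{n\ge0}$ be a normalized Stieltjes moment sequence which is indet(S), with N-extremal solutions $\mu_t$ and Friedrichs parameter $F(s)$. (a) For $F(s)<t<\infty$ the measure $x^{-1}d\mu_t(x)$ is indet(S), while $x^{-1}d\mu_{F(s)}(x)$ is determinate. (b) For $F(s)<t<\infty$ the measure $x^{-1}d\mu_t(x)$ is the Friedrichs solution for the moment sequence $s^{(-1)}[t]$ given by $$s^{(-1)}[t](n)=\begin{cases} t, & n=0,\\ s_{n-1}, & n\ge1,\end{cases}$$ while $\tau_t:=(t-F(s))\delta_0+x^{-1}d\mu_{F(s)}(x)$ is the Krein solution for the moment sequence $s^{(-1)}[t]$. (c) For $F(s)<t'<t<\infty$ the measure $(t-t')\delta_0+x^{-1}d\mu_{t'}(x)$ is a solution to the moment problem for $s^{(-1)}[t]$ which is not N-extremal.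
   Context: $\mathcal M^*$ denotes the set of positive Borel measures on $\mathbb R$ with infinite support and finite moments of every order. A measure $\mu\in\mathcal M^*$, and its moment sequence $s_n=\int x^n\,d\mu(x)$, $n\ge0$, is determinate if $\mu$ is the only measure in $\mathcal M^*$ with these moments, and indeterminate otherwise. $V=V(s)$ is the set of measures in $\mathcal M^*$ with moment sequence $s$ (the solutions); $s$ is normalized if $s_0=1$. Let $s$ be normalized and indeterminate. Let $p_n$ be the orthonormal polynomials (degree $n$, positive leading coefficient) and $q_n(z)=\int\frac{p_n(z)-p_n(x)}{z-x}d\mu(x)$ ($\mu\in V$) the polynomials of the second kind. Define entire functions $A(z)=z\sum q_n(0)q_n(z)$, $B(z)=-1+z\sum q_n(0)p_n(z)$, $C(z)=1+z\sum p_n(0)q_n(z)$, $D(z)=z\sum p_n(0)p_n(z)$ (sums over $n\ge0$). For $t\in\mathbb R\cup\{\infty\}$ the N-extremal solution $\mu_t\in V$ is determined by $$\int\frac{d\mu_t(x)}{x-z}=-\frac{A(z)+tC(z)}{B(z)+tD(z)},\quad z\in\mathbb C\setminus\mathbb R,$$ with right-hand side $-C(z)/D(z)$ for $t=\infty$. An indeterminate measure $\mu$ is N-extremal iff $\mathbb C[x]$ is dense in $L^2(\mu)$ (M. Riesz). An indeterminate $s$ is Stieltjes if some $\mu\in V$ is supported in $[0,\infty)$; it is det(S) if there is exactly one such $\mu\in V$, and indet(S) if there is more than one. A measure supported in $[0,\infty)$ is called det(S)/indet(S) if its moment sequence is. For $s$ indeterminate and Stieltjes put $\alpha(s)=\lim_{n\to\infty}p_n(0)/q_n(0)=\lim_{x\to-\infty}D(x)/B(x)\le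 0$; $s$ is det(S) iff $\alpha(s)=0$. The Friedrichs parameter is $F(s)=-1/\alpha(s)$ if $\alpha(s)<0$ and $F(s)=\infty$ if $\alpha(s)=0$. The measure $\mu_t$ is supported in $[0,\infty)$ iff $F(s)\le t\le\infty$. The Friedrichs solution is $\mu_F=\mu_{F(s)}$ and the Krein solution is $\mu_K=\mu_\infty$. For non-normalized moment sequences, N-extremal, Friedrichs and Krein solutions are defined by rescaling to total mass 1. $\delta_0$ is the unit point mass at $0$. *)

theory Defs
  imports "HOL-Probability.Probability" "HOL-Computational_Algebra.Polynomial"
begin

section \<open>Measures and moment sequences\<close>

definition measure_support :: "real measure \<Rightarrow> real set" where
  "measure_support \<mu> = {x. \<forall>U. open U \<and> x \<in> U \<longrightarrow> emeasure \<mu> U > 0}"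

definition Mstar :: "real measure set" where
  "Mstar = {\<mu>. sets \<mu> = sets borel \<and> infinite (measure_support \<mu>) \<and>
                (\<forall>n. integrable \<mu> (\<lambda>x. x ^ n))}"

definition moments :: "real measure \<Rightarrow> nat \<Rightarrow> real" where
  "moments \<mu> n = (\<integral>x. x ^ n \<partial>\<mu>)"

definition solutions :: "(nat \<Rightarrow> real) \<Rightarrow> real measure set" where
  "solutions s = {\<mu> \<in> Mstar. moments \<mu> = s}"

definition determinate :: "(nat \<Rightarrow> real) \<Rightarrow> bool" where
  "determinate s \<longleftrightarrow> (\<exists>!\<mu>. \<mu> \<in> solutions s)"

definition indeterminate :: "(nat \<Rightarrow> real) \<Rightarrow> bool" where
  "indeterminate s \<longleftrightarrow> solutions s \<noteq> {} \<and> \<not> determinate s"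

definition determinate_measure :: "real measure \<Rightarrow> bool" where
  "determinate_measure \<mu> \<longleftrightarrow> \<mu> \<in> Mstar \<and> determinate (moments \<mu>)"

definition stieltjes_solutions :: "(nat \<Rightarrow> real) \<Rightarrow> real measure set" where
  "stieltjes_solutions s = {\<mu> \<in> solutions s. measure_support \<mu> \<subseteq> {0..}}"

definition indet_stieltjes :: "(nat \<Rightarrow> real) \<Rightarrow> bool" where
  "indet_stieltjes s \<longleftrightarrow> indeterminate s \<and> stieltjes_solutions s \<noteq> {}"

definition indetS :: "(nat \<Rightarrow> real) \<Rightarrow> bool" where
  "indetS s \<longleftrightarrow> indet_stieltjes s \<and>
     (\<exists>\<mu>\<in>stieltjes_solutions s. \<exists>\<nu>\<in>stieltjes_solutions s. \<mu> \<noteq> \<nu>)"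

definition indetS_measure :: "real measure \<Rightarrow> bool" where
  "indetS_measure \<mu> \<longleftrightarrow> \<mu> \<in> Mstar \<and> measure_support \<mu> \<subseteq> {0..} \<and> indetS (moments \<mu>)"


section \<open>Orthonormal polynomials and polynomials of the second kind\<close>

text \<open>The integral of a polynomial against any solution of the moment problem, written in terms
  of the moments only; see \<open>integral_poly_eq_moment_functional\<close> below.\<close>

definition moment_functional :: "(nat \<Rightarrow> real) \<Rightarrow> 'a::real_normed_field poly \<Rightarrow> 'a" where
  "moment_functional s r = (\<Sum>i\<le>degree r. coeff r i * of_real (s i))"

lemma integral_poly_eq_moment_functional:
  fixes r :: "'a::{real_normed_field,banach,second_countable_topology} poly"
  assumes "\<mu> \<in> solutions s"
  shows "(\<integral>x. poly r (of_real x) \<partial>\<mu>) = moment_functional s r"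
proof -
  have int: "integrable \<mu> (\<lambda>x. x ^ n)" and mom: "(\<integral>x. x ^ n \<partial>\<mu>) = s n" for n
    using assms by (auto simp: solutions_def Mstar_def moments_def)
  have int': "integrable \<mu> (\<lambda>x. of_real x ^ n :: 'a)" for n
    using integrable_of_real[OF int[of n], where ?'a = 'a] by (simp add: of_real_power)
  have mom': "(\<integral>x. (of_real x ^ n :: 'a) \<partial>\<mu>) = of_real (s n)" for n
    using integral_of_real[OF int[of n], where ?'a = 'a] by (simp add: of_real_power mom)
  show ?thesis
    unfolding poly_altdef moment_functional_def
    by (subst Bochner_Integration.integral_sum) (auto simp: int' mom')
qed

definition is_orthonormal_system :: "(nat \<Rightarrow> real) \<Rightarrow> (nat \<Rightarrow> real poly) \<Rightarrow> bool" where
  "is_orthonormal_system s P \<longleftrightarrow>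
     (\<forall>n. degree (P n) = n \<and> lead_coeff (P n) > 0) \<and>
     (\<forall>m n. moment_functional s (P m * P n) = (if m = n then 1 else 0))"

definition orthonormal_poly :: "(nat \<Rightarrow> real) \<Rightarrow> nat \<Rightarrow> real poly" where
  "orthonormal_poly s = (THE P. is_orthonormal_system s P)"

definition op_p :: "(nat \<Rightarrow> real) \<Rightarrow> nat \<Rightarrow> 'a::real_normed_field \<Rightarrow> 'a" where
  "op_p s n z = poly (map_poly of_real (orthonormal_poly s n)) z"

text \<open>The polynomial \<open>synthetic_div p z\<close> takes the value \<open>(p z - p x) / (z - x)\<close> at \<open>x \<noteq> z\<close>.
  Dividing the functions instead would give the wrong value \<open>0\<close> at \<open>x = z\<close>,
  which matters for real \<open>z\<close>.\<close>

lemma poly_synthetic_div_eq_quotient: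
  fixes p :: "'a::field poly"
  assumes "x \<noteq> z"
  shows "poly (synthetic_div p z) x = (poly p z - poly p x) / (z - x)"
proof -
  have "poly p x + z * poly (synthetic_div p z) x
      = poly (pCons (poly p z) (synthetic_div p z)) x"
    using synthetic_div_correct[of p z] by (metis poly_add poly_smult)
  then show ?thesis using assms by (simp add: field_simps)
qed

definition op_q :: "(nat \<Rightarrow> real) \<Rightarrow> nat \<Rightarrow> 'a::real_normed_field \<Rightarrow> 'a" where
  "op_q s n z =
     moment_functional s (synthetic_div (map_poly of_real (orthonormal_poly s n)) z)"


section \<open>N-extremal solutions\<close>

definition nev_A :: "(nat \<Rightarrow> real) \<Rightarrow> complex \<Rightarrow> complex" where
  "nev_A s z = z * (\<Sum>n. op_q s n 0 * op_q s n z)"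

definition nev_B :: "(nat \<Rightarrow> real) \<Rightarrow> complex \<Rightarrow> complex" where
  "nev_B s z = - 1 + z * (\<Sum>n. op_q s n 0 * op_p s n z)"

definition nev_C :: "(nat \<Rightarrow> real) \<Rightarrow> complex \<Rightarrow> complex" where
  "nev_C s z = 1 + z * (\<Sum>n. op_p s n 0 * op_q s n z)"

definition nev_D :: "(nat \<Rightarrow> real) \<Rightarrow> complex \<Rightarrow> complex" where
  "nev_D s z = z * (\<Sum>n. op_p s n 0 * op_p s n z)"

text \<open>The parameter set \<open>\<real> \<union> {\<infinity>}\<close> is represented by the extended reals other than \<open>-\<infinity>\<close>.\<close>

definition nev_quotient :: "(nat \<Rightarrow> real) \<Rightarrow> ereal \<Rightarrow> complex \<Rightarrow> complex" where
  "nev_quotient s t z =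
     (if t = \<infinity> then - (nev_C s z / nev_D s z)
      else - ((nev_A s z + of_real (real_of_ereal t) * nev_C s z) /
              (nev_B s z + of_real (real_of_ereal t) * nev_D s z)))"

definition is_N_extremal_solution :: "(nat \<Rightarrow> real) \<Rightarrow> ereal \<Rightarrow> real measure \<Rightarrow> bool" where
  "is_N_extremal_solution s t \<mu> \<longleftrightarrow>
     s 0 = 1 \<and> indeterminate s \<and> t \<noteq> -\<infinity> \<and> \<mu> \<in> solutions s \<and>
     (\<forall>z. z \<notin> \<real> \<longrightarrow> (\<integral>x. 1 / (of_real x - z) \<partial>\<mu>) = nev_quotient s t z)"

definition N_extremal_solution :: "(nat \<Rightarrow> real) \<Rightarrow> ereal \<Rightarrow> real measure" where
  "N_extremal_solution s t = (THE \<mu>. is_N_extremal_solution s t \<mu>)"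

definition stieltjes_alpha :: "(nat \<Rightarrow> real) \<Rightarrow> real" where
  "stieltjes_alpha s = lim (\<lambda>n. op_p s n 0 / op_q s n 0)"

definition friedrichs_parameter :: "(nat \<Rightarrow> real) \<Rightarrow> ereal" where
  "friedrichs_parameter s =
     (if stieltjes_alpha s = 0 then \<infinity> else ereal (- 1 / stieltjes_alpha s))"


subsection \<open>Arbitrary total mass\<close>

definition normalized_seq :: "(nat \<Rightarrow> real) \<Rightarrow> nat \<Rightarrow> real" where
  "normalized_seq s n = s n / s 0"

definition normalized_measure :: "real measure \<Rightarrow> real measure" where
  "normalized_measure \<mu> = scale_measure (inverse (emeasure \<mu> (space \<mu>))) \<mu>"

definition N_extremal :: "real measure \<Rightarrow> bool" where
  "N_extremal \<mu> \<longleftrightarrow> \<mu> \<in> Mstar \<and>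
     (\<exists>t. is_N_extremal_solution (normalized_seq (moments \<mu>)) t (normalized_measure \<mu>))"

definition is_friedrichs_solution :: "(nat \<Rightarrow> real) \<Rightarrow> real measure \<Rightarrow> bool" where
  "is_friedrichs_solution s \<mu> \<longleftrightarrow> indet_stieltjes s \<and> \<mu> \<in> solutions s \<and>
     is_N_extremal_solution (normalized_seq s) (friedrichs_parameter (normalized_seq s))
       (normalized_measure \<mu>)"

definition is_krein_solution :: "(nat \<Rightarrow> real) \<Rightarrow> real measure \<Rightarrow> bool" where
  "is_krein_solution s \<mu> \<longleftrightarrow> indet_stieltjes s \<and> \<mu> \<in> solutions s \<and>
     is_N_extremal_solution (normalized_seq s) \<infinity> (normalized_measure \<mu>)"


section \<open>Operations on measures and sequences\<close>

definition add_measure :: "'a measure \<Rightarrow> 'a measure \<Rightarrow> 'a measure" where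
  "add_measure M N = measure_of (space M) (sets M) (\<lambda>A. emeasure M A + emeasure N A)"

lemma emeasure_add_measure:
  assumes "sets M = sets N" and "A \<in> sets M"
  shows "emeasure (add_measure M N) A = emeasure M A + emeasure N A"
  unfolding add_measure_def
proof (rule emeasure_measure_of_sigma)
  show "sigma_algebra (space M) (sets M)" ..
  show "positive (sets M) (\<lambda>A. emeasure M A + emeasure N A)"
    by (simp add: positive_def)
  show "countably_additive (sets M) (\<lambda>A. emeasure M A + emeasure N A)"
  proof (rule countably_additiveI)
    fix F :: "nat \<Rightarrow> 'a set"
    assume F: "range F \<subseteq> sets M" "disjoint_family F"
    then show "(\<Sum>i. emeasure M (F i) + emeasure N (F i))
        = emeasure M (\<Union>i. F i) + emeasure N (\<Union>i. F i)"
      using assms(1) by (subst suminf_add[symmetric]) (auto simp: suminf_emeasure)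
  qed
  show "A \<in> sets M" by fact
qed

text \<open>The measure \<open>x\<^sup>-\<^sup>1 d\<mu>(x)\<close> of a measure supported in \<open>[0,\<infinity>)\<close>. The density is \<open>\<infinity>\<close> at
  \<open>x = 0\<close> (and at \<open>x < 0\<close>, which is then a null set).\<close>

definition inv_x_measure :: "real measure \<Rightarrow> real measure" where
  "inv_x_measure \<mu> = density \<mu> (\<lambda>x. inverse (ennreal x))"

definition add_atom0 :: "real \<Rightarrow> real measure \<Rightarrow> real measure" where
  "add_atom0 c \<mu> = add_measure (scale_measure (ennreal c) (return borel 0)) \<mu>"

definition shifted_seq :: "(nat \<Rightarrow> real) \<Rightarrow> real \<Rightarrow> nat \<Rightarrow> real" where
  "shifted_seq s t n = (if n = 0 then t else s (n - 1))"

end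

theory Submission
  imports Defs "HOL-Complex_Analysis.Complex_Analysis"
    "HOL-Computational_Algebra.Fundamental_Theorem_Algebra"
begin

text \<open>
  Let \<open>L\<close> be the moment functional of \<open>s\<close> and \<open>c\<^sub>n = - q\<^sub>n(0) / p\<^sub>n(0)\<close>. On polynomials of degree at most
  \<open>n\<close> with value \<open>1\<close> at \<open>0\<close>, the functional of the shifted sequence with total mass \<open>t\<close> attains its minimal
  square norm \<open>t - c\<^sub>n\<close> at \<open>p\<^sub>n / p\<^sub>n(0)\<close>. The sequence \<open>c\<^sub>n\<close> increases, and it is bounded when \<open>s\<close> is
  indet(S), since two solutions on the half-line have Stieltjes transforms at \<open>- y\<close> which differ by at most
  \<open>1 / (y (1 + y c\<^sub>n))\<close>. Hence \<open>F(s)\<close> is the limit of \<open>c\<^sub>n\<close>, and the shifted sequence is positive definite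
  for every \<open>t \<ge> F(s)\<close>. Its orthogonal polynomials are the partial sums of \<open>B + t D\<close>, so its Gauss
  quadratures have a limit \<open>\<sigma>\<close> for which \<open>x d\<sigma>(x)\<close> is \<open>\<mu>\<^sub>t\<close>. A limit of Gauss quadratures is the
  Friedrichs solution. The maximal mass at \<open>0\<close> for the shifted problem is \<open>t - F(s)\<close>: for \<open>t = F(s)\<close> it
  vanishes, which forces determinacy, and for \<open>t > F(s)\<close> the Krein solution is the one that attains it.
  Solutions of finite parameter have no atom at \<open>0\<close>, so an atom of intermediate mass excludes
  N-extremality.
\<close>

text \<open>\<open>N_extremal_solution\<close> is a definite description through the Nevanlinna
  quotient, so the measure has to be exhibited. This is done from the far end: \<sigma> is built as
  a limit of Gauss quadratures, and x d\<sigma>(x) is then recognised by its transform; uniqueness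
  is Stieltjes inversion. The quotient is accessible as a limit of partial sums because p_n(z) and
  q_n(z) are square summable, which has to be extracted from indeterminacy: two solutions whose
  transforms differ at one non-real z bound the sum of |p_n(z)|^2, Bessel's inequality for 1/(x - z)
  adds q_n(z), and a discrete Gronwall argument carries both bounds to the whole plane. The maximal
  mass enters as a reciprocal: for the normalized shifted sequence, the squares at 0 of the
  orthonormal polynomials up to degree n sum to t/(t - c_n). For t = F(s) these sums are unbounded,
  against square summability at 0.\<close>

abbreviation of_real_poly :: "real poly \<Rightarrow> 'a::real_normed_field poly" where
  "of_real_poly \<equiv> map_poly of_real"

lemma of_real_poly_add: "of_real_poly (p + q) = of_real_poly p + of_real_poly q"
  by (rule poly_eqI) (simp add: coeff_map_poly)

lemma of_real_poly_smult: "of_real_poly (smult c p) = smult (of_real c) (of_real_poly p)"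
  by (rule poly_eqI) (simp add: coeff_map_poly)

lemma of_real_poly_mult: "of_real_poly (p * q) = of_real_poly p * of_real_poly q"
  by (rule poly_eqI) (simp add: coeff_map_poly coeff_mult)

lemma of_real_poly_pCons: "of_real_poly (pCons a p) = pCons (of_real a) (of_real_poly p)"
  by (simp add: map_poly_pCons)

lemma of_real_poly_sum: "of_real_poly (\<Sum>k\<in>A. f k) = (\<Sum>k\<in>A. of_real_poly (f k))"
  by (induction A rule: infinite_finite_induct) (simp_all add: of_real_poly_add)

lemma degree_of_real_poly: "degree (of_real_poly p :: 'a::real_normed_field poly) = degree p"
  by (intro degree_map_poly) auto

lemma poly_of_real_poly_of_real: "poly (of_real_poly p) (of_real x) = of_real (poly p x)"
  by (induction p) (simp_all add: of_real_poly_pCons)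

lemma of_real_poly_real [simp]: "of_real_poly p = (p :: real poly)"
  by (intro map_poly_idI) simp

lemma synthetic_div_add:
  "synthetic_div (p + q) z = synthetic_div p z + synthetic_div q z"
  by (induction p q rule: poly_induct2) simp_all

lemma synthetic_div_smult: "synthetic_div (smult c p) z = smult c (synthetic_div p z)"
  by (induction p) simp_all

lemma synthetic_div_of_real:
  "synthetic_div (of_real_poly f) (of_real x) = of_real_poly (synthetic_div f x)"
  by (induction f) (simp_all add: of_real_poly_pCons poly_of_real_poly_of_real)


section \<open>The moment functional\<close>

lemma moment_functional_eq_sum:
  assumes "degree r \<le> n"
  shows "moment_functional s r = (\<Sum>i\<le>n. coeff r i * of_real (s i))"
  unfolding moment_functional_def using assms
  by (intro sum.mono_neutral_left) (auto simp: coeff_eq_0)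

lemma moment_functional_add:
  "moment_functional s (p + q) = moment_functional s p + moment_functional s q"
proof -
  let ?n = "max (degree p) (degree q)"
  show ?thesis
    using degree_add_le_max[of p q]
    by (simp add: moment_functional_eq_sum[of p ?n] moment_functional_eq_sum[of q ?n]
        moment_functional_eq_sum[of "p + q" ?n] sum.distrib algebra_simps)
qed

lemma moment_functional_smult:
  "moment_functional s (smult c p) = c * moment_functional s p"
  by (simp add: moment_functional_eq_sum[of "smult c p" "degree p"] degree_smult_le
      moment_functional_def sum_distrib_left mult.assoc)

lemma moment_functional_0 [simp]: "moment_functional s 0 = 0"
  by (simp add: moment_functional_def)

lemma moment_functional_minus: "moment_functional s (- p) = - moment_functional s p"
  using moment_functional_smult[of s "-1" p] by simp

lemma moment_functional_diff:
  "moment_functional s (p - q) = moment_functional s p - moment_functional s q"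
  using moment_functional_add[of s p "- q"] by (simp add: moment_functional_minus)

lemma moment_functional_sum:
  "moment_functional s (\<Sum>k\<in>A. f k) = (\<Sum>k\<in>A. moment_functional s (f k))"
  by (induction A rule: infinite_finite_induct) (simp_all add: moment_functional_add)

lemma moment_functional_of_real:
  "moment_functional s (of_real_poly p) = of_real (moment_functional s p)"
  by (simp add: moment_functional_def degree_of_real_poly coeff_map_poly)

lemma moment_functional_pCons:
  "moment_functional s (pCons a p) = a * of_real (s 0) + moment_functional (\<lambda>n. s (Suc n)) p"
proof -
  have "moment_functional s (pCons a p)
      = (\<Sum>i\<le>Suc (degree p). coeff (pCons a p) i * of_real (s i))"
    by (rule moment_functional_eq_sum) (rule degree_pCons_le)
  then show ?thesis
    by (simp add: sum.atMost_Suc_shift moment_functional_def del: sum.atMost_Suc)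
qed

text \<open>\<open>pCons a p\<close> is the polynomial a + x p(x), so only its constant term meets
  the new mass t. Computations for the shifted sequence are reduced to \<open>s\<close> through this
  identity.\<close>

lemma moment_functional_shifted_seq:
  "moment_functional (shifted_seq s t) (pCons a p) = a * of_real t + moment_functional s p"
  by (simp add: moment_functional_pCons shifted_seq_def)

lemma moment_functional_divide:
  "moment_functional (\<lambda>n. s n / c) p = moment_functional s p / of_real c"
  by (simp add: moment_functional_def sum_divide_distrib of_real_divide)

lemma moment_functional_const [simp]: "moment_functional s [:a:] = a * of_real (s 0)"
  by (simp add: moment_functional_def)

lemma moment_functional_synthetic_div_sum:
  "moment_functional s (synthetic_div (\<Sum>k\<in>A. smult (c k) (f k)) z)
     = (\<Sum>k\<in>A. c k * moment_functional s (synthetic_div (f k) z))"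
  by (induction A rule: infinite_finite_induct)
    (simp_all add: synthetic_div_add synthetic_div_smult moment_functional_add moment_functional_smult)

text \<open>The product of x - z with both divided differences can be read as p~ (q - q(z)) and as
  (p - p(z)) q~. With an orthonormal polynomial for p, this symmetry gives the Fourier coefficients
  of its divided difference.\<close>

lemma moment_functional_divided_difference_comm:
  "moment_functional s (synthetic_div p z * q) - poly q z * moment_functional s (synthetic_div p z)
     = moment_functional s (p * synthetic_div q z) - poly p z * moment_functional s (synthetic_div q z)"
proof -
  let ?p = "synthetic_div p z" and ?q = "synthetic_div q z"
  have "p - [:poly p z:] = [:- z, 1:] * ?p" "q - [:poly q z:] = [:- z, 1:] * ?q"
    using synthetic_div_correct'[of z p] synthetic_div_correct'[of z q]
    by (simp_all only: eq_diff_eq[symmetric])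
  then have "?p * (q - [:poly q z:]) = (p - [:poly p z:]) * ?q"
    by (simp only: mult_ac)
  then have "moment_functional s (?p * q - smult (poly q z) ?p)
      = moment_functional s (p * ?q - smult (poly p z) ?q)"
    by (simp add: right_diff_distrib left_diff_distrib)
  then show ?thesis
    by (simp add: moment_functional_diff moment_functional_smult)
qed


section \<open>Orthonormal polynomials\<close>

text \<open>Hankel positivity, stated for polynomials so that it can be verified for a shifted
  sequence before any representing measure is known.\<close>

definition positive_definite :: "(nat \<Rightarrow> real) \<Rightarrow> bool" where
  "positive_definite s \<longleftrightarrow> (\<forall>f :: real poly. f \<noteq> 0 \<longrightarrow> moment_functional s (f * f) > 0)"

text \<open>Gram-Schmidt applied to the monomials; positivity makes each remainder \<open>r\<close>
  normalizable.\<close>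

lemma orthonormal_system_exists:
  assumes "positive_definite s"
  shows "\<exists>P. is_orthonormal_system s P"
proof -
  let ?L = "moment_functional s"
  define step where "step n f = (let r = monom 1 n - (\<Sum>k<n. smult (?L (monom 1 n * f k)) (f k))
     in smult (1 / sqrt (?L (r * r))) r)" for n and f :: "nat \<Rightarrow> real poly"
  \<comment> \<open>Each orthonormal polynomial depends on all earlier ones, hence the recursion by
    \<open>wfrec\<close>. The cut-off is harmless because \<open>step n\<close> reads its argument
    only below n.\<close>
  define P where "P = wfrec less_than (\<lambda>f n. step n f)"
  have P: "P n = step n P" for n
  proof -
    have "P n = step n (cut P less_than n)"
      unfolding P_def by (subst wfrec) simp_all
    also have "\<dots> = step n P"
      unfolding step_def by (simp add: cut_apply cong: sum.cong_simp)
    finally show ?thesis .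
  qed
  have main: "degree (P n) = n \<and> lead_coeff (P n) > 0 \<and> ?L (P n * P n) = 1
     \<and> (\<forall>m<n. ?L (P n * P m) = 0)" for n
  proof (induction n rule: less_induct)
    case (less n)
    define r where "r = monom 1 n - (\<Sum>k<n. smult (?L (monom 1 n * P k)) (P k))"
    have Pn: "P n = smult (1 / sqrt (?L (r * r))) r"
      by (subst P) (simp add: step_def r_def Let_def)
    have "degree (\<Sum>k<n. smult (?L (monom 1 n * P k)) (P k)) < n" if "n > 0"
      using that less by (intro degree_sum_less) (auto intro: le_less_trans[OF degree_smult_le])
    then have cn: "coeff (\<Sum>k<n. smult (?L (monom 1 n * P k)) (P k)) n = 0"
      by (cases "n = 0") (auto simp: coeff_eq_0)
    have "coeff r n = 1" by (simp add: r_def cn)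
    moreover have "degree r \<le> n"
      unfolding r_def using less
      by (intro degree_diff_le degree_sum_le) (auto simp: degree_monom_le intro: order.trans[OF degree_smult_le])
    ultimately have r: "degree r = n" "lead_coeff r = 1" "r \<noteq> 0"
      by (metis coeff_0 le_antisym le_degree zero_neq_one)+
    with assms have pos: "?L (r * r) > 0" by (simp add: positive_definite_def)
    have orth: "?L (r * P m) = 0" if "m < n" for m
    proof -
      have "?L (P k * P m) = (if k = m then 1 else 0)" if "k < n" for k
        using less[OF that] less[OF \<open>m < n\<close>] by (metis linorder_neqE_nat mult.commute)
      then have "(\<Sum>k<n. ?L (monom 1 n * P k) * ?L (P k * P m)) = (\<Sum>k<n. if k = m then ?L (monom 1 n * P m) else 0)"
        by (intro sum.cong) auto
      then show ?thesis
        using that by (simp add: r_def left_diff_distrib sum_distrib_right moment_functional_diff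
            moment_functional_sum moment_functional_smult)
    qed
    show ?case
      using r pos orth by (simp add: Pn moment_functional_smult)
  qed
  have "is_orthonormal_system s P"
    unfolding is_orthonormal_system_def using main
    by (metis linorder_neqE_nat mult.commute)
  then show ?thesis by (rule exI[where x = P])
qed

text \<open>Cancelling leading terms shows that the system spans; orthonormality then identifies the
  coefficients. The field is general because divided differences at complex points are expanded
  later.\<close>

lemma orthonormal_expansion:
  fixes f :: "'a::real_normed_field poly"
  assumes P: "is_orthonormal_system s P" and "degree f < n"
  shows "f = (\<Sum>k<n. smult (moment_functional s (f * of_real_poly (P k))) (of_real_poly (P k)))"
proof -
  have orth: "moment_functional s (of_real_poly (P j) * of_real_poly (P k) :: 'a poly)
      = (if j = k then 1 else 0)" for j k
    using P by (simp flip: of_real_poly_mult add: moment_functional_of_real is_orthonormal_system_def)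
  have "\<exists>c. f = (\<Sum>k<n. smult (c k) (of_real_poly (P k)))"
    using assms(2)
  proof (induction n arbitrary: f)
    case (Suc n)
    let ?P = "of_real_poly (P n) :: 'a poly"
    have dP: "degree ?P = n" "coeff ?P n \<noteq> 0"
      using P unfolding is_orthonormal_system_def
      by (auto simp: degree_of_real_poly coeff_map_poly) (metis order_less_irrefl)
    define g where "g = f - smult (coeff f n / coeff ?P n) ?P"
    show ?case
    proof (cases "g = 0")
      case True
      then have "f = (\<Sum>k<Suc n. smult ((\<lambda>k. if k = n then coeff f n / coeff ?P n else 0) k) (of_real_poly (P k)))"
        by (simp add: g_def)
      then show ?thesis by (intro exI[where x = "\<lambda>k. if k = n then coeff f n / coeff ?P n else 0"])
    next
      case False
      have "degree g \<le> n" "coeff g n = 0"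
        unfolding g_def using Suc.prems dP
        by (auto intro!: degree_diff_le order.trans[OF degree_smult_le])
      with False have "degree g < n"
        by (metis le_neq_implies_less leading_coeff_0_iff)
      from Suc.IH[OF this] obtain c where c: "g = (\<Sum>k<n. smult (c k) (of_real_poly (P k)))" by blast
      have "f = (\<Sum>k<Suc n. smult ((c(n := coeff f n / coeff ?P n)) k) (of_real_poly (P k)))"
        using c by (simp add: g_def diff_eq_eq)
      then show ?thesis by blast
    qed
  qed simp
  then obtain c where c: "f = (\<Sum>k<n. smult (c k) (of_real_poly (P k)))" by blast
  have "moment_functional s (f * of_real_poly (P k)) = c k" if "k < n" for k
  proof -
    have "moment_functional s (f * of_real_poly (P k)) = (\<Sum>j<n. c j * (if j = k then 1 else 0))"
      by (subst c) (simp add: sum_distrib_right moment_functional_sum moment_functional_smult orth)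
    also have "\<dots> = (\<Sum>j<n. if j = k then c j else 0)"
      by (intro sum.cong) auto
    also have "\<dots> = c k" using that by simp
    finally show ?thesis .
  qed
  then show ?thesis by (subst c) simp
qed

text \<open>This justifies the definite description in \<open>orthonormal_poly\<close>.
  Orthogonality to lower degrees makes \<open>Q n\<close> a multiple c of \<open>P n\<close>; the
  norms give c^2 = 1 and the leading coefficients give c > 0.\<close>

lemma orthonormal_system_unique:
  assumes P: "is_orthonormal_system s P" and Q: "is_orthonormal_system s Q"
  shows "P = Q"
proof
  fix n
  let ?L = "moment_functional s"
  have dP: "degree (P k) = k" "lead_coeff (P k) > 0" and dQ: "degree (Q k) = k" "lead_coeff (Q k) > 0" for k
    using P Q unfolding is_orthonormal_system_def by metis+
  have 0: "?L (Q n * P k) = 0" if "k < n" for k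
  proof -
    have "?L (Q n * P k) = ?L (\<Sum>j<n. smult (?L (P k * Q j)) (Q n * Q j))"
      by (subst orthonormal_expansion[OF Q, of "P k" n])
        (use that dP in \<open>simp_all add: sum_distrib_left\<close>)
    also have "\<dots> = (\<Sum>j<n. 0)"
      unfolding moment_functional_sum using Q
      by (intro sum.cong) (auto simp: moment_functional_smult is_orthonormal_system_def)
    finally show ?thesis by simp
  qed
  have eq: "Q n = smult (?L (Q n * P n)) (P n)"
    using orthonormal_expansion[OF P, of "Q n" "Suc n"] dQ(1)[of n] 0 by simp
  define c where "c = ?L (Q n * P n)"
  have eq: "Q n = smult c (P n)" using eq by (simp add: c_def)
  have "1 = c * c"
  proof -
    have "1 = ?L (Q n * Q n)" using Q by (simp add: is_orthonormal_system_def)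
    also have "\<dots> = c * (c * ?L (P n * P n))" unfolding eq by (simp add: moment_functional_smult)
    also have "?L (P n * P n) = 1" using P by (simp add: is_orthonormal_system_def)
    finally show ?thesis by simp
  qed
  moreover have "lead_coeff (Q n) = c * lead_coeff (P n)" using eq by simp
  then have "c > 0" using dP(2)[of n] dQ(2)[of n] by (metis zero_less_mult_pos2)
  ultimately have "c = 1" using power2_eq_1_iff[of c] by (simp add: power2_eq_square)
  with eq show "P n = Q n" by simp
qed

locale normalized_positive_definite =
  fixes s :: "nat \<Rightarrow> real"
  assumes pd: "positive_definite s" and s0: "s 0 = 1"
begin

abbreviation L :: "'a::real_normed_field poly \<Rightarrow> 'a" where "L \<equiv> moment_functional s"

abbreviation P :: "nat \<Rightarrow> real poly" where "P \<equiv> orthonormal_poly s"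

abbreviation p :: "nat \<Rightarrow> 'a::real_normed_field \<Rightarrow> 'a" where "p \<equiv> op_p s"

abbreviation q :: "nat \<Rightarrow> 'a::real_normed_field \<Rightarrow> 'a" where "q \<equiv> op_q s"

lemma orthonormal_system: "is_orthonormal_system s P"
  unfolding orthonormal_poly_def
  using orthonormal_system_exists[OF pd] orthonormal_system_unique[of s] by (metis theI)

lemma degree_P [simp]: "degree (P n) = n"
  using orthonormal_system by (simp add: is_orthonormal_system_def)

lemma degree_of_real_P [simp]: "degree (of_real_poly (P n) :: 'a::real_normed_field poly) = n"
  by (simp add: degree_of_real_poly)

lemma lead_coeff_P: "coeff (P n) n > 0"
  using orthonormal_system by (metis is_orthonormal_system_def)

lemma P_nonzero [simp]: "P n \<noteq> 0"
  using lead_coeff_P[of n] by auto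

lemma orthonormal: "L (P m * P n) = (if m = n then 1 else 0)"
  using orthonormal_system by (simp add: is_orthonormal_system_def)

lemma orthonormal':
  "L (of_real_poly (P m) * of_real_poly (P n) :: 'a::real_normed_field poly) = (if m = n then 1 else 0)"
  by (simp flip: of_real_poly_mult add: moment_functional_of_real orthonormal)

lemma expansion:
  fixes f :: "'a::real_normed_field poly"
  assumes "degree f < n"
  shows "f = (\<Sum>k<n. smult (L (f * of_real_poly (P k))) (of_real_poly (P k)))"
  by (rule orthonormal_expansion[OF orthonormal_system assms])

lemma orthogonal_lower_degree:
  fixes f :: "'a::real_normed_field poly"
  assumes "degree f < n"
  shows "L (f * of_real_poly (P n)) = 0"
proof -
  have "L (f * of_real_poly (P n))
      = (\<Sum>k<n. L (f * of_real_poly (P k)) * L (of_real_poly (P k) * of_real_poly (P n)))"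
    by (subst expansion[OF assms])
      (simp add: sum_distrib_right moment_functional_sum moment_functional_smult)
  also have "\<dots> = (\<Sum>k<n. 0)"
    by (intro sum.cong) (auto simp: orthonormal')
  finally show ?thesis by simp
qed

lemma P_0: "P 0 = [:1:]"
proof -
  obtain a where a: "P 0 = [:a:]" using degree_P[of 0] degree_eq_zeroE by blast
  have "a > 0" using lead_coeff_P[of 0] a by simp
  moreover have "a * a = 1" using orthonormal[of 0 0] a s0 by simp
  ultimately have "a = 1" using power2_eq_1_iff[of a] by (simp add: power2_eq_square)
  with a show ?thesis by simp
qed

lemma p_0 [simp]: "p 0 z = 1"
  by (simp add: op_p_def P_0 of_real_poly_pCons)

lemma q_0 [simp]: "q 0 z = 0"
  by (simp add: op_q_def P_0 of_real_poly_pCons)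

lemma p_of_real: "p n (of_real x) = of_real (p n x)"
  by (simp add: op_p_def poly_of_real_poly_of_real)

lemma q_of_real: "q n (of_real x) = of_real (q n x)"
  by (simp add: op_q_def synthetic_div_of_real moment_functional_of_real)

lemma p_at_0: "p n 0 = of_real (p n (0::real))"
  using p_of_real[of n 0] by simp

lemma q_at_0: "q n 0 = of_real (q n (0::real))"
  using q_of_real[of n 0] by simp

text \<open>The coefficient of p_k in the divided difference of p_n at w. At w = 0 it separates the
  factors q_n(0) and p_n(0), which is what brings out A, B, C and D.\<close>

definition kernel_coeff :: "'a::real_normed_field \<Rightarrow> nat \<Rightarrow> nat \<Rightarrow> 'a" where
  "kernel_coeff w n k = p k w * q n w - p n w * q k w"

lemma synthetic_div_P:
  "synthetic_div (of_real_poly (P n)) w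
     = (\<Sum>k<n. smult (kernel_coeff w n k) (of_real_poly (P k)))"
proof (cases "n = 0")
  case True
  then show ?thesis by (simp add: P_0 of_real_poly_pCons)
next
  case False
  let ?S = "\<lambda>k. synthetic_div (of_real_poly (P k)) w"
  have deg: "degree (?S k) \<le> k - 1" for k
    by (simp add: degree_synthetic_div)
  have "L (?S n * of_real_poly (P k)) = kernel_coeff w n k" if "k < n" for k
  proof -
    have "degree (?S k) < n" using that by (intro le_less_trans[OF deg]) auto
    \<comment> \<open>In the symmetry of divided differences the term containing P_n drops out,
      since the divided difference of P_k has degree below n.\<close>
    then have "L (of_real_poly (P n) * ?S k) = 0"
      using orthogonal_lower_degree[of "?S k" n] by (simp add: mult.commute)
    then show ?thesis
      using moment_functional_divided_difference_comm[of s "of_real_poly (P n)" w "of_real_poly (P k)"]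
      by (simp add: kernel_coeff_def op_p_def op_q_def algebra_simps)
  qed
  then show ?thesis
    using expansion[of "?S n" n] False
    by (simp add: degree_synthetic_div cong: sum.cong_simp)
qed

text \<open>A discrete variation of constants around w, read off from p_n(z) = p_n(w) + (z - w)
  times the divided difference.\<close>

lemma p_variation: "p n z = p n w + (z - w) * (\<Sum>k<n. kernel_coeff w n k * p k z)"
proof -
  have "poly (of_real_poly (P n)) z
      = poly ([:- w, 1:] * synthetic_div (of_real_poly (P n)) w + [:p n w:]) z"
    by (simp only: op_p_def synthetic_div_correct')
  then show ?thesis
    by (simp add: synthetic_div_P poly_sum op_p_def algebra_simps)
qed

text \<open>Divided differences at two points satisfy a resolvent identity, T_z = T_w + (z - w)
  (T_w)_z. Applying the functional gives for q_n a formula with the same kernel as for p_n.\<close>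

lemma q_variation: "q n z = q n w + (z - w) * (\<Sum>k<n. kernel_coeff w n k * q k z)"
proof -
  let ?T = "\<lambda>k. synthetic_div (of_real_poly (P k)) :: 'a \<Rightarrow> 'a poly"
  let ?a = "kernel_coeff w n"
  have S: "of_real_poly (P n) + smult w (?T n w) = pCons (p n w) (?T n w)"
    using synthetic_div_correct[of "of_real_poly (P n)" w] by (simp add: op_p_def)
  have "?T n z + smult w (synthetic_div (?T n w) z) = pCons (poly (?T n w) z) (synthetic_div (?T n w) z)"
  proof -
    have "synthetic_div (of_real_poly (P n) + smult w (?T n w)) z
        = synthetic_div (pCons (p n w) (?T n w)) z"
      by (simp only: S)
    then show ?thesis by (simp add: synthetic_div_add synthetic_div_smult)
  qed
  moreover have "pCons (poly (?T n w) z) (synthetic_div (?T n w) z) = ?T n w + smult z (synthetic_div (?T n w) z)"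
    by (rule synthetic_div_correct[symmetric])
  ultimately have "?T n z = ?T n w + smult (z - w) (synthetic_div (?T n w) z)"
    by (simp add: smult_diff_left algebra_simps)
  then have "q n z = q n w + (z - w) * L (synthetic_div (?T n w) z)"
    by (simp add: op_q_def moment_functional_add moment_functional_smult)
  also have "L (synthetic_div (?T n w) z) = (\<Sum>k<n. ?a k * q k z)"
    by (subst synthetic_div_P) (simp add: moment_functional_synthetic_div_sum op_q_def)
  finally show ?thesis .
qed

definition A_part :: "nat \<Rightarrow> 'a::real_normed_field \<Rightarrow> 'a" where
  "A_part n z = z * (\<Sum>k<n. q k 0 * q k z)"

definition B_part :: "nat \<Rightarrow> 'a::real_normed_field \<Rightarrow> 'a" where
  "B_part n z = - 1 + z * (\<Sum>k<n. q k 0 * p k z)"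

definition C_part :: "nat \<Rightarrow> 'a::real_normed_field \<Rightarrow> 'a" where
  "C_part n z = 1 + z * (\<Sum>k<n. p k 0 * q k z)"

definition D_part :: "nat \<Rightarrow> 'a::real_normed_field \<Rightarrow> 'a" where
  "D_part n z = z * (\<Sum>k<n. p k 0 * p k z)"

lemma p_eq_BD: "p n z = q n 0 * D_part n z - p n 0 * B_part n z"
  by (subst p_variation[of n z 0])
    (simp add: D_part_def B_part_def kernel_coeff_def algebra_simps sum_subtractf sum_distrib_left)

lemma q_eq_AC: "q n z = q n 0 * C_part n z - p n 0 * A_part n z"
  by (subst q_variation[of n z 0])
    (simp add: C_part_def A_part_def kernel_coeff_def algebra_simps sum_subtractf sum_distrib_left)

lemma det_part: "A_part n z * D_part n z - B_part n z * C_part n z = 1"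
proof (induction n)
  case 0
  then show ?case by (simp add: A_part_def B_part_def C_part_def D_part_def)
next
  case (Suc n)
  have S: "A_part (Suc n) z = A_part n z + z * q n 0 * q n z"
     "B_part (Suc n) z = B_part n z + z * q n 0 * p n z"
     "C_part (Suc n) z = C_part n z + z * p n 0 * q n z"
     "D_part (Suc n) z = D_part n z + z * p n 0 * p n z"
    by (simp_all add: A_part_def B_part_def C_part_def D_part_def algebra_simps)
  \<comment> \<open>The increments of A and C are multiples of q_n(z), those of B and D of p_n(z),
    so the quadratic terms cancel. The two combinations that remain are p_n(z) and q_n(z) again, and
    the change is z (q_n p_n - p_n q_n) = 0.\<close>
  have "A_part (Suc n) z * D_part (Suc n) z - B_part (Suc n) z * C_part (Suc n) z
     = (A_part n z * D_part n z - B_part n z * C_part n z)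
       + z * (q n z * (q n 0 * D_part n z - p n 0 * B_part n z)
              - p n z * (q n 0 * C_part n z - p n 0 * A_part n z))"
    unfolding S by (simp add: algebra_simps)
  also have "\<dots> = 1"
    unfolding p_eq_BD[symmetric] q_eq_AC[symmetric] by (simp add: Suc.IH)
  finally show ?case .
qed

end

section \<open>Square summability\<close>

text \<open>A discrete Gronwall inequality. Cauchy-Schwarz bounds the inner sums by sqrt(\<beta>
  U_n), where U_n is the sum of u_k^2 over k < n. Then 1 + U_n grows by a factor of at most 1 +
  \<epsilon>_n, and the exponent in the bound estimates the total of the \<epsilon>_n.\<close>

lemma square_sum_gronwall:
  fixes u b c d :: "nat \<Rightarrow> real"
  assumes nonneg: "\<And>n. 0 \<le> u n" "\<And>n. 0 \<le> b n" "\<And>n. 0 \<le> d n" "0 \<le> M"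
    and u: "\<And>n. u n \<le> c n + M * (\<Sum>k<n. (b k * d n + b n * d k) * u k)"
    and \<beta>: "\<And>n. (\<Sum>k<n. (b k)\<^sup>2) \<le> \<beta>" "\<And>n. (\<Sum>k<n. (d k)\<^sup>2) \<le> \<beta>" "\<And>n. (\<Sum>k<n. (c k)\<^sup>2) \<le> \<beta>"
  shows "(\<Sum>k<n. (u k)\<^sup>2) \<le> exp (2 * \<beta> + 8 * M\<^sup>2 * \<beta>\<^sup>2)"
proof -
  define U where "U n = (\<Sum>k<n. (u k)\<^sup>2)" for n
  \<comment> \<open>The factors 2 and 4 come from (a + b)^2 \<le> 2 a^2 + 2 b^2, used once to
    separate c from the sum and once more for (d + b)^2.\<close>
  define \<epsilon> where "\<epsilon> n = 2 * (c n)\<^sup>2 + 4 * M\<^sup>2 * \<beta> * ((d n)\<^sup>2 + (b n)\<^sup>2)" for n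
  have \<beta>0: "\<beta> \<ge> 0" using \<beta>(1)[of 0] by simp
  have U0: "U n \<ge> 0" for n by (simp add: U_def sum_nonneg)
  have \<epsilon>0: "\<epsilon> n \<ge> 0" for n using \<beta>0 by (simp add: \<epsilon>_def)
  have cs: "(\<Sum>k<n. b' k * u k) \<le> sqrt (\<beta> * U n)" if "\<And>n. (\<Sum>k<n. (b' k)\<^sup>2) \<le> \<beta>" for b' :: "nat \<Rightarrow> real" and n
  proof (rule real_le_rsqrt)
    have "(\<Sum>k<n. b' k * u k)\<^sup>2 \<le> (\<Sum>k<n. (b' k)\<^sup>2) * (\<Sum>k<n. (u k)\<^sup>2)"
      by (rule Cauchy_Schwarz_ineq_sum)
    also have "\<dots> \<le> \<beta> * U n"
      unfolding U_def using that by (intro mult_right_mono) (auto simp: sum_nonneg)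
    finally show "(\<Sum>k<n. b' k * u k)\<^sup>2 \<le> \<beta> * U n" .
  qed
  have step: "(u n)\<^sup>2 \<le> 2 * (c n)\<^sup>2 + (4 * M\<^sup>2 * \<beta> * ((d n)\<^sup>2 + (b n)\<^sup>2)) * U n" for n
  proof -
    let ?S = "sqrt (\<beta> * U n)"
    have "(\<Sum>k<n. (b k * d n + b n * d k) * u k) = d n * (\<Sum>k<n. b k * u k) + b n * (\<Sum>k<n. d k * u k)"
      by (simp add: sum_distrib_left sum.distrib algebra_simps)
    also have "\<dots> \<le> d n * ?S + b n * ?S"
      using cs[of b n] cs[of d n] \<beta> nonneg by (intro add_mono mult_left_mono) auto
    finally have "u n \<le> c n + M * (d n * ?S + b n * ?S)"
      using u[of n] nonneg(4) by (meson add_left_mono mult_left_mono order_trans)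
    then have "(u n)\<^sup>2 \<le> (c n + M * (d n + b n) * ?S)\<^sup>2"
      using nonneg(1)[of n] by (intro power_mono) (simp_all add: algebra_simps)
    also have "\<dots> \<le> 2 * (c n)\<^sup>2 + 2 * (M * (d n + b n) * ?S)\<^sup>2"
      using sum_squares_bound[of "c n" "M * (d n + b n) * ?S"] by (simp add: power2_sum)
    also have "(M * (d n + b n) * ?S)\<^sup>2 = M\<^sup>2 * (d n + b n)\<^sup>2 * (\<beta> * U n)"
      using \<beta>0 U0 by (simp add: power_mult_distrib)
    also have "\<dots> \<le> M\<^sup>2 * (2 * ((d n)\<^sup>2 + (b n)\<^sup>2)) * (\<beta> * U n)"
      using \<beta>0 U0 sum_squares_bound[of "d n" "b n"]
      by (intro mult_right_mono mult_left_mono) (auto simp: power2_sum)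
    finally show ?thesis by (simp add: algebra_simps)
  qed
  have "1 + U n \<le> exp (\<Sum>k<n. \<epsilon> k)" for n
  proof (induction n)
    case (Suc n)
    have "1 + U (Suc n) = 1 + U n + (u n)\<^sup>2" by (simp add: U_def)
    also have "\<dots> \<le> (1 + U n) * (1 + \<epsilon> n)"
    proof -
      have "0 \<le> 2 * (c n)\<^sup>2 * U n" "0 \<le> 4 * M\<^sup>2 * \<beta> * ((d n)\<^sup>2 + (b n)\<^sup>2)" using U0 \<beta>0 by auto
      moreover have "(1 + U n) * (1 + \<epsilon> n) = 1 + U n + 2 * (c n)\<^sup>2 + (4 * M\<^sup>2 * \<beta> * ((d n)\<^sup>2 + (b n)\<^sup>2)) * U n
         + (2 * (c n)\<^sup>2 * U n + 4 * M\<^sup>2 * \<beta> * ((d n)\<^sup>2 + (b n)\<^sup>2))"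
        by (simp add: \<epsilon>_def algebra_simps)
      ultimately show ?thesis using step[of n] by linarith
    qed
    also have "\<dots> \<le> exp (\<Sum>k<n. \<epsilon> k) * exp (\<epsilon> n)"
      using Suc U0[of n] \<epsilon>0[of n] exp_ge_add_one_self[of "\<epsilon> n"]
      by (intro mult_mono) auto
    finally show ?case by (simp add: exp_add)
  qed (simp add: U_def)
  moreover have "(\<Sum>k<n. \<epsilon> k) \<le> 2 * \<beta> + 8 * M\<^sup>2 * \<beta>\<^sup>2"
  proof -
    have "(\<Sum>k<n. \<epsilon> k) = 2 * (\<Sum>k<n. (c k)\<^sup>2) + 4 * M\<^sup>2 * \<beta> * ((\<Sum>k<n. (d k)\<^sup>2) + (\<Sum>k<n. (b k)\<^sup>2))"
      by (simp add: \<epsilon>_def sum.distrib sum_distrib_left distrib_left)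
    also have "\<dots> \<le> 2 * \<beta> + 4 * M\<^sup>2 * \<beta> * (\<beta> + \<beta>)"
      using \<beta> \<beta>0 by (intro add_mono mult_left_mono) auto
    finally show ?thesis by (simp add: power2_eq_square algebra_simps)
  qed
  ultimately have "1 + U n \<le> exp (2 * \<beta> + 8 * M\<^sup>2 * \<beta>\<^sup>2)"
    by (meson exp_le_cancel_iff order_trans)
  then show ?thesis by (simp add: U_def)
qed

lemma summable_of_square_bounds:
  fixes f g :: "nat \<Rightarrow> complex"
  assumes "\<And>n. (\<Sum>k<n. (norm (f k))\<^sup>2) \<le> \<beta>" "\<And>n. (\<Sum>k<n. (norm (g k))\<^sup>2) \<le> \<beta>"
  shows "summable (\<lambda>k. f k * g k)" and "norm (\<Sum>k. f k * g k) \<le> \<beta>"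
proof -
  have sums: "(\<Sum>k<n. norm (f k * g k)) \<le> \<beta>" for n
  proof -
    have "(\<Sum>k<n. norm (f k * g k)) \<le> (\<Sum>k<n. ((norm (f k))\<^sup>2 + (norm (g k))\<^sup>2) / 2)"
    proof (intro sum_mono)
      fix k
      show "norm (f k * g k) \<le> ((norm (f k))\<^sup>2 + (norm (g k))\<^sup>2) / 2"
        using sum_squares_bound[of "norm (f k)" "norm (g k)"] by (simp add: norm_mult)
    qed
    also have "\<dots> = ((\<Sum>k<n. (norm (f k))\<^sup>2) + (\<Sum>k<n. (norm (g k))\<^sup>2)) / 2"
      by (simp add: sum.distrib add_divide_distrib sum_divide_distrib)
    also have "\<dots> \<le> \<beta>" using assms(1)[of n] assms(2)[of n] by simp
    finally show ?thesis .
  qed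
  have sn: "summable (\<lambda>k. norm (f k * g k))"
    by (rule summableI_nonneg_bounded[where x = \<beta>]) (use sums in auto)
  then show "summable (\<lambda>k. f k * g k)" by (rule summable_norm_cancel)
  show "norm (\<Sum>k. f k * g k) \<le> \<beta>"
    by (rule order.trans[OF summable_norm[OF sn]]) (rule suminf_le_const[OF sn sums])
qed

context normalized_positive_definite
begin

definition l2_bounded_by :: "real \<Rightarrow> complex \<Rightarrow> bool" where
  "l2_bounded_by \<beta> z \<longleftrightarrow> (\<forall>n. (\<Sum>k<n. (norm (p k z))\<^sup>2) \<le> \<beta> \<and> (\<Sum>k<n. (norm (q k z))\<^sup>2) \<le> \<beta>)"

text \<open>The radius M is arbitrary, so one point with square-summable values controls every disc.
  \<open>p_variation\<close> and \<open>q_variation\<close> share a kernel dominated by the products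
  that \<open>square_sum_gronwall\<close> expects.\<close>

lemma l2_bounded_locally:
  assumes w: "l2_bounded_by \<beta> w" and M: "0 \<le> M" and z: "norm (z - w) \<le> M"
  shows "l2_bounded_by (exp (2 * \<beta> + 8 * M\<^sup>2 * \<beta>\<^sup>2)) z"
proof -
  have bound: "norm (f n z) \<le> norm (f n w)
       + M * (\<Sum>k<n. (norm (p k w) * norm (q n w) + norm (p n w) * norm (q k w)) * norm (f k z))"
    if f: "\<And>n. f n z = f n w + (z - w) * (\<Sum>k<n. kernel_coeff w n k * f k z)" for f :: "nat \<Rightarrow> complex \<Rightarrow> complex" and n
  proof -
    have 1: "norm (f n z) \<le> norm (f n w) + norm (z - w) * norm (\<Sum>k<n. kernel_coeff w n k * f k z)"
      by (subst f) (metis norm_mult norm_triangle_ineq)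
    have 2: "norm (\<Sum>k<n. kernel_coeff w n k * f k z)
        \<le> (\<Sum>k<n. (norm (p k w) * norm (q n w) + norm (p n w) * norm (q k w)) * norm (f k z))"
      unfolding kernel_coeff_def
      by (intro sum_norm_le) (auto simp: norm_mult intro!: mult_right_mono norm_triangle_le_diff)
    from 1 show ?thesis
      by (rule order.trans) (intro add_left_mono mult_mono z M 2 norm_ge_zero)
  qed
  show ?thesis
    unfolding l2_bounded_by_def
    using w M bound[of p, OF p_variation[of _ z w]] bound[of q, OF q_variation[of _ z w]]
    by (auto simp: l2_bounded_by_def intro!: square_sum_gronwall[where b = "\<lambda>k. norm (p k w)" and d = "\<lambda>k. norm (q k w)"])
qed

end

text \<open>Indeterminacy in its analytic form: p_n and q_n are square summable at a single point.
  \<open>indeterminate_imp_indeterminate_moments\<close> derives it from two distinct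
  solutions.\<close>

locale indeterminate_moments = normalized_positive_definite +
  assumes l2_bounded_somewhere: "\<exists>\<beta> w. l2_bounded_by \<beta> w"
begin

lemma l2_bounded_on_disc: "\<exists>\<beta>. \<forall>z. norm z \<le> M \<longrightarrow> l2_bounded_by \<beta> z"
proof -
  obtain \<beta> w where "l2_bounded_by \<beta> w" using l2_bounded_somewhere by blast
  moreover have "norm (z - w) \<le> \<bar>M\<bar> + norm w" if "norm z \<le> M" for z
    using that norm_triangle_ineq4[of z w] by linarith
  ultimately show ?thesis
    using l2_bounded_locally[of \<beta> w "\<bar>M\<bar> + norm w"] by (meson abs_ge_zero add_nonneg_nonneg norm_ge_zero)
qed

lemma l2_bounded: "\<exists>\<beta>. l2_bounded_by \<beta> 0 \<and> l2_bounded_by \<beta> z"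
  using l2_bounded_on_disc[of "norm z"] by (metis norm_ge_zero norm_zero order_refl)

lemma
  shows A_part_tendsto: "(\<lambda>n. A_part n z) \<longlonglongrightarrow> nev_A s z"
    and B_part_tendsto: "(\<lambda>n. B_part n z) \<longlonglongrightarrow> nev_B s z"
    and C_part_tendsto: "(\<lambda>n. C_part n z) \<longlonglongrightarrow> nev_C s z"
    and D_part_tendsto: "(\<lambda>n. D_part n z) \<longlonglongrightarrow> nev_D s z"
proof -
  obtain \<beta> where "l2_bounded_by \<beta> 0" "l2_bounded_by \<beta> z" using l2_bounded by blast
  then have "summable (\<lambda>k. q k 0 * q k z)" "summable (\<lambda>k. q k 0 * p k z)"
     "summable (\<lambda>k. p k 0 * q k z)" "summable (\<lambda>k. p k 0 * p k z)"
    unfolding l2_bounded_by_def by (auto intro: summable_of_square_bounds(1))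
  from this[THEN summable_LIMSEQ] show "(\<lambda>n. A_part n z) \<longlonglongrightarrow> nev_A s z"
    "(\<lambda>n. B_part n z) \<longlonglongrightarrow> nev_B s z" "(\<lambda>n. C_part n z) \<longlonglongrightarrow> nev_C s z"
    "(\<lambda>n. D_part n z) \<longlonglongrightarrow> nev_D s z"
    unfolding A_part_def B_part_def C_part_def D_part_def nev_A_def nev_B_def nev_C_def nev_D_def
    by (auto intro!: tendsto_intros)
qed

lemma nev_det: "nev_A s z * nev_D s z - nev_B s z * nev_C s z = 1"
proof (rule LIMSEQ_unique)
  show "(\<lambda>n. A_part n z * D_part n z - B_part n z * C_part n z)
      \<longlonglongrightarrow> nev_A s z * nev_D s z - nev_B s z * nev_C s z"
    by (intro tendsto_intros A_part_tendsto B_part_tendsto C_part_tendsto D_part_tendsto)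
qed (simp add: det_part)

text \<open>At 0 the functions A, B, C, D take the values 0, -1, 1, 0; this rate yields the boundary
  value of \<open>nev_quotient\<close> there.\<close>

lemma nev_near_0: "\<exists>K. \<forall>z. norm z \<le> 1 \<longrightarrow> norm (nev_A s z) \<le> K * norm z \<and>
    norm (nev_B s z + 1) \<le> K * norm z \<and> norm (nev_C s z - 1) \<le> K * norm z \<and> norm (nev_D s z) \<le> K * norm z"
proof -
  obtain \<beta> where \<beta>: "\<And>z. norm z \<le> 1 \<Longrightarrow> l2_bounded_by \<beta> z" using l2_bounded_on_disc[of 1] by blast
  have "norm (nev_A s z) \<le> \<beta> * norm z \<and> norm (nev_B s z + 1) \<le> \<beta> * norm z
      \<and> norm (nev_C s z - 1) \<le> \<beta> * norm z \<and> norm (nev_D s z) \<le> \<beta> * norm z" if "norm z \<le> 1" for z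
    using \<beta>[OF that] \<beta>[of 0]
    unfolding l2_bounded_by_def nev_A_def nev_B_def nev_C_def nev_D_def
    by (auto simp: norm_mult mult.commute[of \<beta>] intro!: mult_left_mono summable_of_square_bounds(2))
  then show ?thesis by blast
qed

text \<open>The parameter is the boundary value at 0 along the imaginary axis, -(0 + t)/(-1 + 0) =
  t. A finite boundary value excludes an atom at 0; in the shifted problem it is compared with the
  total mass t.\<close>

lemma nev_quotient_at_0:
  assumes "t \<noteq> \<infinity>" "t \<noteq> -\<infinity>"
  shows "(\<lambda>n. nev_quotient s t (\<i> * of_real (1 / real (Suc n)))) \<longlonglongrightarrow> of_real (real_of_ereal t)"
proof -
  define z where "z n = \<i> * complex_of_real (1 / real (Suc n))" for n
  have nz: "norm (z n) = 1 / real (Suc n)" for n unfolding z_def norm_mult norm_of_real by simp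
  obtain K where K: "\<And>z. norm z \<le> 1 \<Longrightarrow> norm (nev_A s z) \<le> K * norm z"
    "\<And>z. norm z \<le> 1 \<Longrightarrow> norm (nev_B s z + 1) \<le> K * norm z"
    "\<And>z. norm z \<le> 1 \<Longrightarrow> norm (nev_C s z - 1) \<le> K * norm z"
    "\<And>z. norm z \<le> 1 \<Longrightarrow> norm (nev_D s z) \<le> K * norm z"
    using nev_near_0 by blast
  have lim: "(\<lambda>n. f (z n)) \<longlonglongrightarrow> c"
    if f: "\<And>z. norm z \<le> 1 \<Longrightarrow> norm (f z - c) \<le> K * norm z" for f :: "complex \<Rightarrow> complex" and c
  proof -
    have "(\<lambda>n. f (z n) - c) \<longlonglongrightarrow> 0"
    proof (rule Lim_null_comparison[OF always_eventually, rule_format])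
      show "norm (f (z n) - c) \<le> K * (1 / real (Suc n))" for n
        using f[of "z n"] by (simp add: nz)
      show "(\<lambda>n. K * (1 / real (Suc n))) \<longlonglongrightarrow> 0" by real_asymp
    qed
    then show ?thesis by (rule LIM_zero_cancel)
  qed
  have "(\<lambda>n. - ((nev_A s (z n) + of_real (real_of_ereal t) * nev_C s (z n)) /
       (nev_B s (z n) + of_real (real_of_ereal t) * nev_D s (z n))))
     \<longlonglongrightarrow> - ((0 + of_real (real_of_ereal t) * 1) / (- 1 + of_real (real_of_ereal t) * 0))"
    using K by (intro tendsto_intros lim) auto
  then show ?thesis using assms by (simp add: nev_quotient_def z_def)
qed

end

section \<open>Gauss quadrature\<close>

lemma pderiv_of_real_poly: "pderiv (of_real_poly f) = of_real_poly (pderiv f)"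
  by (rule poly_eqI) (simp add: coeff_pderiv coeff_map_poly)

locale stieltjes_positive_definite = normalized_positive_definite +
  assumes pdS: "f \<noteq> 0 \<Longrightarrow> moment_functional s (pCons 0 (f * f)) > (0::real)"
begin

lemma pos: "f \<noteq> 0 \<Longrightarrow> L (f * f) > (0::real)"
  using pd by (simp add: positive_definite_def)

text \<open>Write P_n = (x - z) g and test against the conjugate of g, which has lower degree: 0 =
  L(x |g|^2) - z L(|g|^2), so z is a quotient of two positive numbers.\<close>

lemma root_P_positive:
  assumes root: "poly (of_real_poly (P n)) z = (0::complex)"
  obtains x :: real where "x > 0" "z = of_real x"
proof -
  have n: "n > 0" using root by (cases n) (auto simp: P_0 of_real_poly_pCons)
  define g where "g = synthetic_div (of_real_poly (P n)) z"
  define u v where "u = map_poly Re g" and "v = map_poly Im g"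
  \<comment> \<open>The conjugate polynomial, assembled from real and imaginary parts so that its
    product with g is the real polynomial u^2 + v^2.\<close>
  define cg where "cg = of_real_poly u - smult \<i> (of_real_poly v)"
  have Pn: "of_real_poly (P n) = [:- z, 1:] * g"
    using synthetic_div_correct'[of z "of_real_poly (P n)"] root by (simp add: g_def)
  have g: "g = of_real_poly u + smult \<i> (of_real_poly v)"
    by (rule poly_eqI) (simp add: u_def v_def coeff_map_poly complex_eq)
  have g0: "g \<noteq> 0" using Pn degree_of_real_P[of n, where 'a = complex] n by auto
  have "degree cg \<le> degree g"
    unfolding cg_def u_def v_def
    by (intro degree_diff_le order.trans[OF degree_smult_le]) (simp_all add: degree_of_real_poly map_poly_degree_leq)
  also have "\<dots> < n" using n by (simp add: g_def degree_synthetic_div)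
  finally have "0 = L (cg * of_real_poly (P n))" by (simp add: orthogonal_lower_degree)
  also have "cg * of_real_poly (P n) = [:- z, 1:] * of_real_poly (u * u + v * v)"
  proof -
    have "cg * g = of_real_poly (u * u + v * v)"
      by (subst g) (simp add: cg_def of_real_poly_add of_real_poly_mult algebra_simps smult_add_right)
    then show ?thesis unfolding Pn by (metis mult.assoc mult.commute)
  qed
  also have "L \<dots> = of_real (L (pCons 0 (u * u + v * v))) - z * of_real (L (u * u + v * v))"
    by (simp add: moment_functional_diff moment_functional_minus moment_functional_add moment_functional_smult
        moment_functional_of_real flip: of_real_poly_pCons)
      (simp add: moment_functional_of_real of_real_poly_pCons[of 0, simplified, symmetric])
  finally have z: "z * of_real (L (u * u + v * v)) = of_real (L (pCons 0 (u * u + v * v)))" by simp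
  have uv: "u \<noteq> 0 \<or> v \<noteq> 0" using g0 g by auto
  have nonneg: "0 \<le> L (f * f)" "0 \<le> L (pCons 0 (f * f))" for f :: "real poly"
    using pos[of f] pdS[of f] by (cases "f = 0"; simp)+
  have split: "pCons 0 (u * u + v * v) = pCons 0 (u * u) + pCons 0 (v * v)" by simp
  have "L (u * u + v * v) > 0" "L (pCons 0 (u * u + v * v)) > 0"
    unfolding split moment_functional_add using uv pos[of u] pos[of v] pdS[of u] pdS[of v] nonneg[of u] nonneg[of v]
    by (auto intro: add_pos_nonneg add_nonneg_pos)
  then show ?thesis using z
    by (intro that[of "L (pCons 0 (u * u + v * v)) / L (u * u + v * v)"]) (auto simp: field_simps)
qed

text \<open>For a double root x, the product of P_n with P_n/(X - x)^2 is the square of P_n/(X - x):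
  orthogonality gives it the value 0, positivity a value above 0.\<close>

lemma root_P_simple:
  assumes root: "poly (P n) x = (0::real)"
  shows "poly (synthetic_div (P n) x) x \<noteq> 0"
proof
  define h where "h = synthetic_div (P n) x"
  assume "poly (synthetic_div (P n) x) x = 0"
  then have "h = [:- x, 1:] * synthetic_div h x"
    using synthetic_div_correct'[of x h] by (simp add: h_def)
  moreover have Pn: "P n = [:- x, 1:] * h"
    using synthetic_div_correct'[of x "P n"] root by (simp add: h_def)
  moreover define k where "k = synthetic_div h x"
  ultimately have eq: "k * P n = h * h" by (metis mult.assoc mult.commute)
  have h0: "h \<noteq> 0" using Pn P_nonzero by auto
  have "n > 0" using root by (cases n) (auto simp: P_0)
  then have "degree k < n" by (simp add: k_def h_def degree_synthetic_div)
  then have "L (k * P n) = 0" using orthogonal_lower_degree[of k n] by simp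
  with eq pos[OF h0] show False by simp
qed

text \<open>The count is made over the complex numbers, where a squarefree polynomial has as many
  roots as its degree; \<open>root_P_positive\<close> places all of them on the real line.\<close>

lemma card_roots_P: "card {x. poly (P n) x = (0::real)} = n"
proof -
  let ?Q = "of_real_poly (P n) :: complex poly"
  let ?X = "{x. poly (P n) x = (0::real)}"
  have X: "{z. poly ?Q z = 0} = of_real ` ?X"
  proof (intro equalityI subsetI)
    fix z assume "z \<in> {z. poly ?Q z = 0}"
    then have z: "poly ?Q z = 0" by simp
    from root_P_positive[OF z] obtain x where "z = of_real x" by blast
    with z show "z \<in> of_real ` ?X" by (simp add: poly_of_real_poly_of_real)
  qed (auto simp: poly_of_real_poly_of_real)
  have "rsquarefree ?Q"
    unfolding rsquarefree_roots
  proof (intro allI notI, elim conjE)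
    fix z assume z: "poly ?Q z = 0" "poly (pderiv ?Q) z = 0"
    from root_P_positive[OF z(1)] obtain x where x: "z = of_real x" by blast
    have root: "poly (P n) x = 0" using z(1) x by (simp add: poly_of_real_poly_of_real)
    have "poly (pderiv (P n)) x = 0" using z(2) x by (simp add: pderiv_of_real_poly poly_of_real_poly_of_real)
    moreover have "P n = [:- x, 1:] * synthetic_div (P n) x"
      using synthetic_div_correct'[of x "P n"] root by simp
    then have "pderiv (P n) = pderiv ([:- x, 1:] * synthetic_div (P n) x)" by simp
    then have "poly (pderiv (P n)) x = poly (synthetic_div (P n) x) x"
      by (simp only: pderiv_mult poly_add poly_mult) (simp add: pderiv_pCons)
    ultimately show False using root_P_simple[OF root] by simp
  qed
  from complex_poly_decompose_rsquarefree[OF this]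
  have "?Q = smult (lead_coeff ?Q) (\<Prod>z\<in>{z. poly ?Q z = 0}. [:- z, 1:])" by simp
  then have "degree ?Q = degree (smult (lead_coeff ?Q) (\<Prod>z\<in>{z. poly ?Q z = 0}. [:- z, 1:]))"
    by (rule arg_cong)
  also have "\<dots> = degree (\<Prod>z\<in>{z. poly ?Q z = 0}. [:- z, 1:])"
    using lead_coeff_P[of n] by (simp add: coeff_map_poly)
  also have "\<dots> = card {z. poly ?Q z = 0}"
    by (subst degree_prod_eq_sum_degree) auto
  also have "\<dots> = card ?X"
    unfolding X by (intro card_image) (simp add: inj_on_def)
  finally show ?thesis by simp
qed

text \<open>Interpolation at the n zeros of P_n is exact below degree n, and division by P_n doubles
  this range. The last clause makes the transform of a limit of quadratures computable from p_n and
  q_n.\<close>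

lemma gauss_quadrature:
  assumes n: "n > 0"
  shows "\<exists>X \<Lambda>. finite X \<and> X \<subseteq> {0<..} \<and> (\<forall>x\<in>X. \<Lambda> x > 0) \<and>
    (\<forall>i<2 * n. s i = (\<Sum>x\<in>X. \<Lambda> x * x ^ i)) \<and>
    (\<forall>z::complex. z \<notin> \<real> \<longrightarrow> (\<Sum>x\<in>X. of_real (\<Lambda> x) / (of_real x - z)) = - q n z / p n z)"
proof -
  define X where "X = {x. poly (P n) x = (0::real)}"
  have finX: "finite X" unfolding X_def by (rule poly_roots_finite) simp
  have cardX: "card X = n" by (simp add: X_def card_roots_P)
  have Xpos: "X \<subseteq> {0<..}"
  proof
    fix x assume "x \<in> X"
    then have "poly (of_real_poly (P n)) (of_real x) = (0::complex)" by (simp add: X_def poly_of_real_poly_of_real)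
    from root_P_positive[OF this] show "x \<in> {0<..}" by auto
  qed
  \<comment> \<open>The Lagrange polynomial of the node x: P_n/(X - x), scaled to the value 1 at
    x.\<close>
  define lag where "lag x = smult (1 / poly (synthetic_div (P n) x) x) (synthetic_div (P n) x)" for x
  have degree_lag: "degree (lag x) < n" for x
    unfolding lag_def using n by (intro le_less_trans[OF degree_smult_le]) (simp add: degree_synthetic_div)
  have lag: "poly (lag x) y = (if x = y then 1 else 0)" if "x \<in> X" "y \<in> X" for x y
    using that root_P_simple[of n x] poly_synthetic_div_eq_quotient[of y x "P n"]
    by (auto simp: lag_def X_def)
  have low: "L r = (\<Sum>x\<in>X. L (lag x) * poly r x)" if r: "degree r < n" for r
  proof -
    have "r = (\<Sum>x\<in>X. smult (poly r x) (lag x))"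
    proof (rule poly_eqI_degree[where A = X])
      fix y assume y: "y \<in> X"
      have "(\<Sum>x\<in>X. poly r x * poly (lag x) y) = (\<Sum>x\<in>X. if x = y then poly r x else 0)"
        using y by (intro sum.cong) (auto simp: lag)
      then show "poly r y = poly (\<Sum>x\<in>X. smult (poly r x) (lag x)) y"
        using y finX by (simp add: poly_sum)
    next
      show "degree r < card X" using r cardX by simp
      show "degree (\<Sum>x\<in>X. smult (poly r x) (lag x)) < card X"
        unfolding cardX using n degree_lag by (intro degree_sum_less) (auto intro: le_less_trans[OF degree_smult_le])
    qed
    then have "L r = L (\<Sum>x\<in>X. smult (poly r x) (lag x))" by simp
    then show ?thesis by (simp add: moment_functional_sum moment_functional_smult mult.commute)
  qed
  have high: "L f = (\<Sum>x\<in>X. L (lag x) * poly f x)" if f: "degree f < 2 * n" for f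
  proof -
    have eq: "f = f div P n * P n + f mod P n" by (rule div_mult_mod_eq[symmetric])
    have "degree (f mod P n) < n"
      using degree_mod_less[of "P n" f] n by auto
    moreover have "degree (f div P n) < n"
    proof (cases "f div P n = 0")
      case False
      have "degree (f div P n) + n = degree (f div P n * P n)" using False by (simp add: degree_mult_eq)
      also have "f div P n * P n = f - f mod P n" by (simp add: minus_mod_eq_div_mult)
      also have "degree \<dots> < 2 * n"
        using f \<open>degree (f mod P n) < n\<close> by (intro degree_diff_less) auto
      finally show ?thesis by simp
    qed (use n in simp)
    ultimately have "L f = L (f mod P n)"
      using orthogonal_lower_degree[of "f div P n" n] by (subst eq) (simp only: moment_functional_add, simp)
    also have "\<dots> = (\<Sum>x\<in>X. L (lag x) * poly (f mod P n) x)" by (rule low) fact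
    also have "\<dots> = (\<Sum>x\<in>X. L (lag x) * poly f x)"
    proof (intro sum.cong refl)
      fix x assume "x \<in> X"
      then have "poly f x = poly (f mod P n) x"
        using arg_cong[OF eq, of "\<lambda>f. poly f x"]
        by (simp only: poly_add poly_mult X_def mem_Collect_eq mult_zero_right add_0)
      then show "L (lag x) * poly (f mod P n) x = L (lag x) * poly f x" by simp
    qed
    finally show ?thesis .
  qed
  have lag_pos: "L (lag x) > 0" if "x \<in> X" for x
  proof -
    have "lag x \<noteq> 0" using lag[OF that that] by auto
    \<comment> \<open>The square of \<open>lag x\<close> has the same values at the nodes as
      \<open>lag x\<close> and still has degree below 2 n, so its functional value is the weight
      itself.\<close>
    then have "0 < L (lag x * lag x)" by (rule pos)
    also have "\<dots> = (\<Sum>y\<in>X. L (lag y) * poly (lag x * lag x) y)"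
      using degree_lag[of x] by (intro high) (use degree_mult_le[of "lag x" "lag x"] in linarith)
    also have "\<dots> = (\<Sum>y\<in>X. if y = x then L (lag y) else 0)"
      using that by (intro sum.cong) (auto simp: lag)
    also have "\<dots> = L (lag x)" using that finX by simp
    finally show ?thesis .
  qed
  have mom: "s i = (\<Sum>x\<in>X. L (lag x) * x ^ i)" if "i < 2 * n" for i
  proof -
    have "degree (monom (1::real) i) < 2 * n" using that by (simp add: degree_monom_eq)
    from high[OF this] have "L (monom 1 i) = (\<Sum>x\<in>X. L (lag x) * x ^ i)" by (simp add: poly_monom)
    moreover have "L (monom 1 i) = s i"
    proof -
      have "(\<Sum>j\<le>i. coeff (monom (1::real) i) j * s j) = (\<Sum>j\<le>i. if j = i then s j else 0)"
        by (intro sum.cong) auto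
      then show ?thesis by (simp add: moment_functional_def degree_monom_eq)
    qed
    ultimately show ?thesis by simp
  qed
  have quot: "(\<Sum>x\<in>X. of_real (L (lag x)) / (of_real x - z)) = - q n z / p n z"
    if z: "z \<notin> \<real>" for z :: complex
  proof -
    let ?T = "synthetic_div (of_real_poly (P n)) z"
    have pz: "p n z \<noteq> 0"
      using root_P_positive[of n z] z unfolding op_p_def by (metis Reals_of_real)
    have "q n z = (\<Sum>i\<le>degree ?T. coeff ?T i * of_real (s i))"
      by (simp add: op_q_def moment_functional_def)
    also have "\<dots> = (\<Sum>i\<le>degree ?T. \<Sum>x\<in>X. of_real (L (lag x)) * (coeff ?T i * of_real x ^ i))"
    proof (intro sum.cong refl)
      fix i assume "i \<in> {..degree ?T}"
      then have "i < 2 * n" using n by (simp add: degree_synthetic_div)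
      then show "coeff ?T i * of_real (s i) = (\<Sum>x\<in>X. of_real (L (lag x)) * (coeff ?T i * of_real x ^ i))"
        by (subst mom) (simp_all add: sum_distrib_left mult_ac)
    qed
    also have "\<dots> = (\<Sum>x\<in>X. of_real (L (lag x)) * poly ?T (of_real x))"
      by (subst sum.swap) (simp add: poly_altdef sum_distrib_left)
    \<comment> \<open>P_n vanishes at a node x, so its divided difference there reduces to p_n(z)/(z
      - x).\<close>
    also have "\<dots> = (\<Sum>x\<in>X. of_real (L (lag x)) * (p n z / (z - of_real x)))"
    proof (intro sum.cong refl)
      fix x assume x: "x \<in> X"
      have "of_real x \<noteq> z" using z by auto
      then show "of_real (L (lag x)) * poly ?T (of_real x) = of_real (L (lag x)) * (p n z / (z - of_real x))"
        using x by (simp add: poly_synthetic_div_eq_quotient poly_of_real_poly_of_real X_def op_p_def)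
    qed
    also have "\<dots> = - p n z * (\<Sum>x\<in>X. of_real (L (lag x)) / (of_real x - z))"
      unfolding sum_distrib_left
    proof (intro sum.cong refl)
      fix x
      have "z - of_real x = - (of_real x - z)" by simp
      then show "of_real (L (lag x)) * (p n z / (z - of_real x)) = - p n z * (of_real (L (lag x)) / (of_real x - z))"
        by (simp only: divide_minus_right) simp
    qed
    finally show ?thesis using pz by (simp add: field_simps)
  qed
  show ?thesis
    by (intro exI[of _ X] exI[of _ "\<lambda>x. L (lag x)"] conjI) (use finX Xpos lag_pos mom quot in auto)
qed

end

section \<open>Stieltjes transforms\<close>

definition stieltjes_transform :: "real measure \<Rightarrow> complex \<Rightarrow> complex" where
  "stieltjes_transform \<mu> z = (\<integral>x. 1 / (of_real x - z) \<partial>\<mu>)"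

text \<open>Dominated convergence for the difference quotients, dominated by the Lipschitz constant.
  The conditions are almost everywhere because, for a measure on the half-line, the kernel is
  controlled at x \<ge> 0.\<close>

lemma has_field_derivative_lipschitz_integral:
  fixes f :: "real \<Rightarrow> 'a::{real_normed_field, banach, second_countable_topology} \<Rightarrow> 'a"
  assumes "finite_measure M"
    and int: "\<And>w. w \<in> ball z e \<Longrightarrow> integrable M (\<lambda>x. f x w)"
    and meas: "(\<lambda>x. f' x) \<in> borel_measurable M"
    and e: "e > 0"
    and der: "AE x in M. (f x has_field_derivative f' x) (at z)"
    and lip: "AE x in M. \<forall>w\<in>ball z e. norm (f x w - f x z) \<le> K * norm (w - z)"
  shows "((\<lambda>w. \<integral>x. f x w \<partial>M) has_field_derivative (\<integral>x. f' x \<partial>M)) (at z)"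
proof -
  interpret finite_measure M by fact
  have "((\<lambda>w. ((\<integral>x. f x w \<partial>M) - (\<integral>x. f x z \<partial>M)) / (w - z)) \<longlongrightarrow> (\<integral>x. f' x \<partial>M)) (at z)"
    unfolding tendsto_at_iff_sequentially
  proof (intro allI impI)
    fix X assume X0: "\<forall>i. X i \<in> UNIV - {z}" and X: "X \<longlonglongrightarrow> z"
    from X e obtain N where N: "\<And>n. n \<ge> N \<Longrightarrow> X n \<in> ball z e"
      unfolding lim_sequentially by (metis dist_commute mem_ball)
    have Xat: "filterlim (\<lambda>n. X (n + N)) (at z) sequentially"
      unfolding filterlim_at using X0 LIMSEQ_ignore_initial_segment[OF X] by auto
    have "(\<lambda>n. (\<integral>x. (f x (X (n + N)) - f x z) / (X (n + N) - z) \<partial>M)) \<longlonglongrightarrow> (\<integral>x. f' x \<partial>M)"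
    proof (rule integral_dominated_convergence[where w = "\<lambda>_. K"])
      show "(\<lambda>x. (f x (X (n + N)) - f x z) / (X (n + N) - z)) \<in> borel_measurable M" for n
        using int[OF N[of "n + N"]] int[of z] e by (auto dest!: borel_measurable_integrable)
      show "AE x in M. (\<lambda>n. (f x (X (n + N)) - f x z) / (X (n + N) - z)) \<longlonglongrightarrow> f' x"
        using der
      proof eventually_elim
        case (elim x)
        then show ?case
          using filterlim_compose[OF _ Xat] by (simp add: has_field_derivative_iff)
      qed
      show "AE x in M. norm ((f x (X (n + N)) - f x z) / (X (n + N) - z)) \<le> K" for n
        using lip
      proof eventually_elim
        case (elim x)
        then show ?case
          using N[of "n + N"] X0 by (simp add: norm_divide divide_le_eq)
      qed
    qed (use meas in auto)
    moreover have "(\<integral>x. (f x (X (n + N)) - f x z) / (X (n + N) - z) \<partial>M)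
        = ((\<integral>x. f x (X (n + N)) \<partial>M) - (\<integral>x. f x z \<partial>M)) / (X (n + N) - z)" for n
      using int[OF N[of "n + N"]] int[of z] e by simp
    ultimately show "((\<lambda>w. ((\<integral>x. f x w \<partial>M) - (\<integral>x. f x z \<partial>M)) / (w - z)) \<circ> X) \<longlonglongrightarrow> (\<integral>x. f' x \<partial>M)"
      unfolding comp_def by - (rule LIMSEQ_offset[where k = N], simp only:)
  qed
  then show ?thesis by (simp add: has_field_derivative_iff)
qed

lemma norm_of_real_diff_ge_Im: "\<bar>Im z\<bar> \<le> norm (of_real x - z)"
  using abs_Im_le_cmod[of "of_real x - z"] by simp

lemma Im_nonzero_iff: "z \<notin> \<real> \<longleftrightarrow> Im z \<noteq> 0"
  by (simp add: complex_is_Real_iff)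

lemma norm_cauchy_kernel_le:
  assumes "z \<notin> \<real>"
  shows "norm (1 / (of_real x - z)) \<le> 1 / \<bar>Im z\<bar>"
  using assms norm_of_real_diff_ge_Im[of z x]
  by (auto simp: norm_divide Im_nonzero_iff intro!: divide_left_mono mult_pos_pos)

lemma abs_arctan_le: "\<bar>arctan x\<bar> \<le> pi / 2"
  using arctan_bounded[of x] by auto

section \<open>Inversion of the Stieltjes transform\<close>

context finite_borel_measure
begin

lemma borel_measurable_M: "f \<in> borel_measurable M \<longleftrightarrow> f \<in> borel_measurable borel"
  by (simp add: measurable_cong_sets[OF M_is_borel refl])

lemma integrable_bounded_borel:
  fixes f :: "real \<Rightarrow> 'b::{banach, second_countable_topology}"
  assumes "f \<in> borel_measurable borel" "\<And>x. norm (f x) \<le> K"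
  shows "integrable M f"
  using assms by (intro integrable_const_bound[where B = K]) (auto simp: borel_measurable_M)

lemma integrable_cauchy_kernel:
  fixes z :: complex
  assumes "z \<notin> \<real>"
  shows "integrable M (\<lambda>x. 1 / (of_real x - z))"
proof (rule integrable_bounded_borel)
  show "norm (1 / (complex_of_real x - z)) \<le> 1 / \<bar>Im z\<bar>" for x
    by (rule norm_cauchy_kernel_le[OF assms])
qed measurable

text \<open>A primitive in u of the imaginary part of the transform at u + i y. As y tends to 0 it
  becomes the distribution function, up to a factor, a constant and the values at atoms.\<close>

definition arctan_transform :: "real \<Rightarrow> real \<Rightarrow> real" where
  "arctan_transform y u = (\<integral>x. arctan ((u - x) / y) \<partial>M)"

lemma arctan_transform_deriv:
  assumes y: "y > 0"
  shows "(arctan_transform y has_real_derivative Im (stieltjes_transform M (Complex u y))) (at u)"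
proof -
  have z: "Complex u y \<notin> \<real>" using y by (simp add: Im_nonzero_iff)
  have Im: "Im (stieltjes_transform M (Complex u y)) = (\<integral>x. Im (1 / (of_real x - Complex u y)) \<partial>M)"
    unfolding stieltjes_transform_def by (rule integral_Im[OF integrable_cauchy_kernel[OF z], symmetric])
  have d: "((\<lambda>u. arctan ((u - x) / y)) has_real_derivative Im (1 / (of_real x - Complex v y))) (at v)" for x v
  proof -
    have "((\<lambda>u. arctan ((u - x) / y)) has_real_derivative inverse (1 + ((v - x) / y)\<^sup>2) * (1 / y)) (at v)"
      using y by (auto intro!: derivative_eq_intros)
    moreover have "inverse (1 + ((v - x) / y)\<^sup>2) * (1 / y) = Im (1 / (of_real x - Complex v y))"
    proof -
      have "1 + ((v - x) / y)\<^sup>2 = (y\<^sup>2 + (v - x)\<^sup>2) / y\<^sup>2"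
        using y by (simp add: power_divide field_simps)
      moreover have "Im (1 / (of_real x - Complex v y)) = y / ((x - v)\<^sup>2 + y\<^sup>2)"
        by (simp add: Im_divide)
      moreover have "(x - v)\<^sup>2 = (v - x)\<^sup>2" by (simp add: power2_commute)
      ultimately show ?thesis using y by (simp add: power2_eq_square add.commute)
    qed
    ultimately show ?thesis by simp
  qed
  have "((\<lambda>u. \<integral>x. arctan ((u - x) / y) \<partial>M) has_real_derivative (\<integral>x. Im (1 / (of_real x - Complex u y)) \<partial>M)) (at u)"
  proof (rule has_field_derivative_lipschitz_integral[where e = 1 and K = "1 / y"])
    show "integrable M (\<lambda>x. arctan ((w - x) / y))" for w
    proof (rule integrable_bounded_borel)
      show "(\<lambda>x. arctan ((w - x) / y)) \<in> borel_measurable borel"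
        using y by (intro borel_measurable_continuous_onI continuous_intros) auto
      show "norm (arctan ((w - x) / y)) \<le> pi / 2" for x
        using abs_arctan_le by simp
    qed
    show "(\<lambda>x. Im (1 / (of_real x - Complex u y))) \<in> borel_measurable M"
      unfolding borel_measurable_M by measurable
    show "AE x in M. \<forall>w\<in>ball u 1. norm (arctan ((w - x) / y) - arctan ((u - x) / y)) \<le> 1 / y * norm (w - u)"
    proof (intro AE_I2 ballI)
      fix x w
      show "norm (arctan ((w - x) / y) - arctan ((u - x) / y)) \<le> 1 / y * norm (w - u)"
      proof (rule field_differentiable_bound[of UNIV "\<lambda>u. arctan ((u - x) / y)" "\<lambda>v. Im (1 / (of_real x - Complex v y))"])
        show "norm (Im (1 / (of_real x - Complex v y))) \<le> 1 / y" for v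
          using norm_cauchy_kernel_le[of "Complex v y" x] y abs_Im_le_cmod[of "1 / (of_real x - Complex v y)"]
          by (simp add: Im_nonzero_iff)
      qed (use d in auto)
    qed
  qed (use d finite_measure_axioms in auto)
  then show ?thesis unfolding Im arctan_transform_def[abs_def] .
qed

text \<open>The two ends fix what the derivative leaves open: the constant of integration and the
  total mass.\<close>

lemma arctan_transform_limits:
  assumes y: "y > 0"
  shows "(\<lambda>n. arctan_transform y (real n)) \<longlonglongrightarrow> pi / 2 * measure M UNIV"
    and "(\<lambda>n. arctan_transform y (- real n)) \<longlonglongrightarrow> - pi / 2 * measure M UNIV"
proof -
  have c: "(\<lambda>x. arctan ((w - x) / y)) \<in> borel_measurable M" for w
    unfolding borel_measurable_M using y by (intro borel_measurable_continuous_onI continuous_intros) auto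
  have f: "filterlim (\<lambda>n. (real n - x) / y) at_top sequentially"
    "filterlim (\<lambda>n. (- real n - x) / y) at_bot sequentially" for x
    using y by real_asymp+
  have "(\<lambda>n. (\<integral>x. arctan ((real n - x) / y) \<partial>M)) \<longlonglongrightarrow> (\<integral>x. pi / 2 \<partial>M)"
    by (rule integral_dominated_convergence[where w = "\<lambda>_. pi / 2"])
      (use c abs_arctan_le filterlim_compose[OF tendsto_arctan_at_top f(1)] in auto)
  then show "(\<lambda>n. arctan_transform y (real n)) \<longlonglongrightarrow> pi / 2 * measure M UNIV"
    using sets_eq_imp_space_eq[OF M_is_borel] by (simp add: arctan_transform_def mult.commute)
  have "(\<lambda>n. (\<integral>x. arctan ((- real n - x) / y) \<partial>M)) \<longlonglongrightarrow> (\<integral>x. - (pi / 2) \<partial>M)"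
    by (rule integral_dominated_convergence[where w = "\<lambda>_. pi / 2"])
      (use c abs_arctan_le filterlim_compose[OF tendsto_arctan_at_bot f(2)] in auto)
  then show "(\<lambda>n. arctan_transform y (- real n)) \<longlonglongrightarrow> - pi / 2 * measure M UNIV"
    using sets_eq_imp_space_eq[OF M_is_borel] by (simp add: arctan_transform_def mult.commute)
qed

lemma arctan_transform_to_sgn:
  "(\<lambda>n. arctan_transform (1 / real (Suc n)) u) \<longlonglongrightarrow> pi / 2 * (\<integral>x. sgn (u - x) \<partial>M)"
proof -
  have "(\<lambda>n. (\<integral>x. arctan ((u - x) / (1 / real (Suc n))) \<partial>M)) \<longlonglongrightarrow> (\<integral>x. pi / 2 * sgn (u - x) \<partial>M)"
  proof (rule integral_dominated_convergence[where w = "\<lambda>_. pi / 2"])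
    show "(\<lambda>x. arctan ((u - x) / (1 / real (Suc n)))) \<in> borel_measurable M" for n
      unfolding borel_measurable_M by (intro borel_measurable_continuous_onI continuous_intros) auto
    show "(\<lambda>x. pi / 2 * sgn (u - x)) \<in> borel_measurable M"
      unfolding borel_measurable_M by measurable
    show "AE x in M. (\<lambda>n. arctan ((u - x) / (1 / real (Suc n)))) \<longlonglongrightarrow> pi / 2 * sgn (u - x)"
    proof (intro AE_I2)
      fix x
      consider "x = u" | "u - x > 0" | "u - x < 0" by linarith
      then show "(\<lambda>n. arctan ((u - x) / (1 / real (Suc n)))) \<longlonglongrightarrow> pi / 2 * sgn (u - x)"
      proof cases
        case 2
        then have "filterlim (\<lambda>n. (u - x) / (1 / real (Suc n))) at_top sequentially" by real_asymp
        from filterlim_compose[OF tendsto_arctan_at_top this] show ?thesis using 2 by simp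
      next
        case 3
        then have "filterlim (\<lambda>n. (u - x) / (1 / real (Suc n))) at_bot sequentially" by real_asymp
        from filterlim_compose[OF tendsto_arctan_at_bot this] show ?thesis using 3 by simp
      qed simp
    qed
  qed (use abs_arctan_le in auto)
  then show ?thesis by (simp add: arctan_transform_def)
qed

text \<open>At u itself \<open>sgn\<close> takes the value 0 and would count half of an atom;
  approaching u from the right counts it fully, as \<open>cdf\<close> does.\<close>

lemma sgn_integral_to_cdf:
  "(\<lambda>n. \<integral>x. sgn (u + 1 / real (Suc n) - x) \<partial>M) \<longlonglongrightarrow> 2 * cdf M u - measure M UNIV"
proof -
  have "(\<lambda>n. \<integral>x. sgn (u + 1 / real (Suc n) - x) \<partial>M) \<longlonglongrightarrow> (\<integral>x. 2 * indicator {..u} x - 1 \<partial>M)"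
  proof (rule integral_dominated_convergence[where w = "\<lambda>_. 1"])
    show "AE x in M. (\<lambda>n. sgn (u + 1 / real (Suc n) - x)) \<longlonglongrightarrow> 2 * indicator {..u} x - 1"
    proof (intro AE_I2)
      fix x
      show "(\<lambda>n. sgn (u + 1 / real (Suc n) - x)) \<longlonglongrightarrow> 2 * indicator {..u} x - 1"
      proof (cases "x \<le> u")
        case True
        have "sgn (u + 1 / real (Suc n) - x) = 1" for n
        proof (rule sgn_pos)
          have "0 < 1 / real (Suc n)" by simp
          then show "0 < u + 1 / real (Suc n) - x" using True by linarith
        qed
        then show ?thesis using True by simp
      next
        case False
        have "(\<lambda>n. u + 1 / real (Suc n) - x) \<longlonglongrightarrow> u - x" by real_asymp
        moreover have "u - x < 0" using False by simp
        ultimately have "\<forall>\<^sub>F n in sequentially. u + 1 / real (Suc n) - x < 0"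
          by (rule order_tendstoD(2))
        then have "\<forall>\<^sub>F n in sequentially. sgn (u + 1 / real (Suc n) - x) = - 1"
          by eventually_elim simp
        then show ?thesis using False by (simp add: tendsto_eventually)
      qed
    qed
    show "(\<lambda>x. sgn (u + 1 / real (Suc n) - x)) \<in> borel_measurable M" for n
      unfolding borel_measurable_M by measurable
    show "(\<lambda>x. 2 * indicator {..u} x - 1 :: real) \<in> borel_measurable M"
      unfolding borel_measurable_M by measurable
  qed (auto simp: sgn_if)
  moreover have "(\<integral>x. 2 * indicator {..u} x - 1 \<partial>M) = 2 * cdf M u - measure M UNIV"
  proof -
    have "integrable M (\<lambda>x. 2 * indicator {..u} x :: real)"
      by (rule integrable_bounded_borel[where K = 2]) (auto simp: indicator_def)
    then show ?thesis
      using sets_eq_imp_space_eq[OF M_is_borel] by (simp add: cdf_def M_is_borel)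
  qed
  ultimately show ?thesis by simp
qed

text \<open>On the imaginary axis |z| = |Im z|, so the functions -z/(x - z) are bounded by 1; they
  converge to the indicator of {0}.\<close>

lemma atom_at_0_eq_limit:
  "(\<lambda>n. - (\<i> * of_real (1 / real (Suc n))) * stieltjes_transform M (\<i> * of_real (1 / real (Suc n))))
     \<longlonglongrightarrow> of_real (measure M {0})"
proof -
  define z where "z n = \<i> * of_real (1 / real (Suc n))" for n
  have z: "z n \<notin> \<real>" for n by (simp add: z_def Im_nonzero_iff)
  then have z: "z n \<notin> \<real>" "z n \<noteq> 0" for n by (metis Reals_0)+
  have "(\<lambda>n. (\<integral>x. - z n * (1 / (of_real x - z n)) \<partial>M)) \<longlonglongrightarrow> (\<integral>x. complex_of_real (indicator {0} x) \<partial>M)"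
  proof (rule integral_dominated_convergence[where w = "\<lambda>_. 1"])
    show "(\<lambda>x. - z n * (1 / (of_real x - z n))) \<in> borel_measurable M" for n
      unfolding borel_measurable_M by measurable
    show "(\<lambda>x. complex_of_real (indicator {0} x)) \<in> borel_measurable M"
      unfolding borel_measurable_M by measurable
    show "AE x in M. norm (- z n * (1 / (of_real x - z n))) \<le> 1" for n
    proof (intro AE_I2)
      fix x
      have "norm (z n) = \<bar>1 / real (Suc n)\<bar>" unfolding z_def norm_mult norm_of_real by simp
      moreover have "Im (z n) = 1 / real (Suc n)" unfolding z_def by simp
      ultimately have "norm (z n) = \<bar>Im (z n)\<bar>" by simp
      then show "norm (- z n * (1 / (of_real x - z n))) \<le> 1"
        using norm_of_real_diff_ge_Im[of "z n" x] z[of n] by (simp add: norm_mult norm_divide divide_le_eq_1 split: if_splits)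
    qed
    show "AE x in M. (\<lambda>n. - z n * (1 / (of_real x - z n))) \<longlonglongrightarrow> complex_of_real (indicator {0} x)"
    proof (intro AE_I2)
      fix x :: real
      have "(\<lambda>n. 1 / real (Suc n)) \<longlonglongrightarrow> 0" by real_asymp
      then have "z \<longlonglongrightarrow> \<i> * of_real 0" unfolding z_def by (intro tendsto_intros)
      then have "(\<lambda>n. - z n * (1 / (of_real x - z n))) \<longlonglongrightarrow> 0" if "x \<noteq> 0"
        using that by (auto intro!: tendsto_eq_intros)
      then show "(\<lambda>n. - z n * (1 / (of_real x - z n))) \<longlonglongrightarrow> complex_of_real (indicator {0} x)"
        using z by (cases "x = 0") auto
    qed
  qed auto
  moreover have "(\<integral>x. - z n * (1 / (of_real x - z n)) \<partial>M) = - z n * stieltjes_transform M (z n)" for n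
    unfolding stieltjes_transform_def
    by (rule integral_mult_right_zero)
  moreover have "(\<integral>x. complex_of_real (indicator {0} x) \<partial>M) = of_real (measure M {0})"
    using sets_eq_imp_space_eq[OF M_is_borel]
    by (subst integral_of_real) (auto simp: M_is_borel intro!: integrable_bounded_borel[where K = 1])
  ultimately show ?thesis by (simp add: z_def)
qed

end

text \<open>Equal transforms give equal primitives up to a constant c. The right end gives c = pi/2
  (m - n) for the masses m and n, the left end the opposite sign, so c = 0 and m = n; then y tends
  to 0.\<close>

lemma stieltjes_transform_unique:
  assumes M: "finite_borel_measure M" and N: "finite_borel_measure N"
    and eq: "\<And>z. z \<notin> \<real> \<Longrightarrow> stieltjes_transform M z = stieltjes_transform N z"
  shows "M = N"
proof -
  interpret M: finite_borel_measure M by fact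
  interpret N: finite_borel_measure N by fact
  let ?m = "measure M UNIV" and ?n = "measure N UNIV"
  have at: "M.arctan_transform y u = N.arctan_transform y u \<and> ?m = ?n" if y: "y > 0" for y u
  proof -
    have "((\<lambda>u. M.arctan_transform y u - N.arctan_transform y u) has_real_derivative 0) (at u)" for u
      using DERIV_diff[OF M.arctan_transform_deriv[OF y, of u] N.arctan_transform_deriv[OF y, of u]]
        eq[of "Complex u y"] y by (simp add: Im_nonzero_iff)
    then have "\<exists>c. \<forall>u. M.arctan_transform y u - N.arctan_transform y u = c"
      using has_field_derivative_zero_constant[of UNIV "\<lambda>u. M.arctan_transform y u - N.arctan_transform y u"] by auto
    then obtain c where c: "\<And>u. M.arctan_transform y u - N.arctan_transform y u = c" by blast
    have "c = pi / 2 * ?m - pi / 2 * ?n"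
      using tendsto_diff[OF M.arctan_transform_limits(1)[OF y] N.arctan_transform_limits(1)[OF y]]
      unfolding c by (simp add: LIMSEQ_const_iff)
    moreover have "c = - pi / 2 * ?m - - pi / 2 * ?n"
      using tendsto_diff[OF M.arctan_transform_limits(2)[OF y] N.arctan_transform_limits(2)[OF y]]
      unfolding c by (simp add: LIMSEQ_const_iff)
    ultimately have "c = 0" "pi * (?m - ?n) = 0" by (simp_all add: algebra_simps)
    then show ?thesis using c[of u] by simp
  qed
  have sgn: "(\<integral>x. sgn (u - x) \<partial>M) = (\<integral>x. sgn (u - x) \<partial>N)" for u
  proof -
    have "(\<lambda>n. M.arctan_transform (1 / real (Suc n)) u) = (\<lambda>n. N.arctan_transform (1 / real (Suc n)) u)"
      using at by (intro ext) simp
    then have "pi / 2 * (\<integral>x. sgn (u - x) \<partial>M) = pi / 2 * (\<integral>x. sgn (u - x) \<partial>N)"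
      using M.arctan_transform_to_sgn[of u] N.arctan_transform_to_sgn[of u] by (metis LIMSEQ_unique)
    then show ?thesis by simp
  qed
  have "cdf M u = cdf N u" for u
    using LIMSEQ_unique[OF M.sgn_integral_to_cdf[of u, unfolded sgn] N.sgn_integral_to_cdf[of u]]
      at[of 1] by simp
  then show ?thesis using M N by (intro cdf_unique') auto
qed

section \<open>Measures on the half-line and their transforms on the negative axis\<close>

lemma closed_of_real_nonneg: "closed (complex_of_real ` {0..})"
proof -
  have "complex_of_real ` {0..} = \<real>\<^sub>\<ge>\<^sub>0" by (auto simp: nonneg_Reals_def)
  then show ?thesis by simp
qed

lemma stieltjes_transform_holomorphic:
  assumes M: "finite_borel_measure M" and pos: "AE x in M. x \<ge> 0"
  shows "stieltjes_transform M holomorphic_on - (of_real ` {0..})"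
proof -
  interpret finite_borel_measure M by fact
  have "\<exists>d. (stieltjes_transform M has_field_derivative d) (at z)" if z: "z \<in> - (of_real ` {0..})" for z
  proof -
    have "closed (complex_of_real ` {0..})"
      by (rule closed_of_real_nonneg)
    with z obtain e where e: "e > 0" "ball z e \<subseteq> - (of_real ` {0..})"
      using openE[OF open_Compl[of "complex_of_real ` {0..}"]] by blast
    \<comment> \<open>Halving the radius keeps the smaller disc at distance e/2 from the half-line;
      this is the source of the Lipschitz constant (2/e)^2.\<close>
    have dist: "e / 2 \<le> norm (of_real x - w)" if "x \<ge> 0" "w \<in> ball z (e / 2)" for x w
    proof (rule ccontr)
      assume "\<not> ?thesis"
      then have "dist (of_real x) w < e / 2" by (simp add: dist_norm)
      moreover have "dist w z < e / 2" using that(2) by (simp add: dist_commute)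
      ultimately have "of_real x \<in> ball z e"
        using dist_triangle[of "of_real x" z w] by (simp add: dist_commute)
      moreover have "complex_of_real x \<in> of_real ` {0..}" using that(1) by simp
      ultimately show False using e(2) by blast
    qed
    have "((\<lambda>w. \<integral>x. 1 / (of_real x - w) \<partial>M) has_field_derivative (\<integral>x. 1 / (of_real x - z)\<^sup>2 \<partial>M)) (at z)"
    proof (rule has_field_derivative_lipschitz_integral[where e = "e / 2" and K = "(2 / e)\<^sup>2"])
      show "integrable M (\<lambda>x. 1 / (of_real x - w))" if w: "w \<in> ball z (e / 2)" for w
      proof (rule integrable_const_bound[where B = "2 / e"])
        show "AE x in M. norm (1 / (of_real x - w)) \<le> 2 / e"
          using pos
        proof eventually_elim
          case (elim x)
          have "1 / norm (of_real x - w) \<le> 1 / (e / 2)"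
            using dist[OF elim w] e by (intro frac_le) auto
          then show ?case by (simp add: norm_divide)
        qed
      qed (unfold borel_measurable_M, measurable)
      show "AE x in M. ((\<lambda>w. 1 / (of_real x - w)) has_field_derivative 1 / (of_real x - z)\<^sup>2) (at z)"
        using pos
      proof eventually_elim
        case (elim x)
        then have "of_real x \<noteq> z" using z by auto
        then show ?case by (auto intro!: derivative_eq_intros simp: power2_eq_square)
      qed
      show "AE x in M. \<forall>w\<in>ball z (e / 2). norm (1 / (of_real x - w) - 1 / (of_real x - z)) \<le> (2 / e)\<^sup>2 * norm (w - z)"
        using pos
      proof (eventually_elim, intro ballI)
        fix x :: real and w assume x: "x \<ge> 0" and w: "w \<in> ball z (e / 2)"
        have dw: "e / 2 \<le> norm (of_real x - w)" using dist[OF x w] .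
        have dz: "e / 2 \<le> norm (of_real x - z)" using dist[OF x, of z] e by simp
        have nz: "of_real x - w \<noteq> 0" "of_real x - z \<noteq> 0" using dw dz e by auto
        have "1 / (of_real x - w) - 1 / (of_real x - z) = (w - z) / ((of_real x - w) * (of_real x - z))"
          using nz by (simp add: field_simps)
        then have "norm (1 / (of_real x - w) - 1 / (of_real x - z)) = norm (w - z) / (norm (of_real x - w) * norm (of_real x - z))"
          by (simp add: norm_divide norm_mult)
        also have "\<dots> \<le> norm (w - z) / (e / 2 * (e / 2))"
          using dw dz e by (intro frac_le mult_mono) auto
        also have "\<dots> = (2 / e)\<^sup>2 * norm (w - z)" using e by (simp add: field_simps power2_eq_square)
        finally show "norm (1 / (of_real x - w) - 1 / (of_real x - z)) \<le> (2 / e)\<^sup>2 * norm (w - z)" .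
      qed
      show "(\<lambda>x. 1 / (of_real x - z)\<^sup>2) \<in> borel_measurable M"
        unfolding borel_measurable_M by measurable
    qed (use e finite_measure_axioms in auto)
    then show ?thesis by (auto simp: stieltjes_transform_def[abs_def])
  qed
  then show ?thesis
    unfolding holomorphic_on_def field_differentiable_def
    by (metis has_field_derivative_at_within)
qed

text \<open>The later estimates concern only points -y. The slit plane is starlike, hence connected,
  and the identity theorem carries equality from the negative axis to the non-real points.\<close>

lemma stieltjes_transform_unique_negative:
  assumes M: "finite_borel_measure M" "AE x in M. x \<ge> 0" and N: "finite_borel_measure N" "AE x in N. x \<ge> 0"
    and eq: "\<And>y. y > 0 \<Longrightarrow> stieltjes_transform M (of_real (- y)) = stieltjes_transform N (of_real (- y))"
  shows "M = N"
proof (rule stieltjes_transform_unique[OF M(1) N(1)])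
  fix w :: complex assume w: "w \<notin> \<real>"
  let ?S = "- (complex_of_real ` {0..})"
  let ?U = "complex_of_real ` {..<0}"
  have "stieltjes_transform M w - stieltjes_transform N w = 0"
  proof (rule analytic_continuation[of "\<lambda>z. stieltjes_transform M z - stieltjes_transform N z" ?S ?U "- 1"])
    show "(\<lambda>z. stieltjes_transform M z - stieltjes_transform N z) holomorphic_on ?S"
      by (intro holomorphic_intros stieltjes_transform_holomorphic M N)
    have "closed (complex_of_real ` {0..})"
      by (rule closed_of_real_nonneg)
    then show "open ?S" by blast
    show "connected ?S" by (intro starlike_imp_connected starlike_slotted_complex_plane_right)
    show "?U \<subseteq> ?S" "- 1 \<in> ?S" by (auto simp: complex_eq_iff image_iff)
    show "- 1 islimpt ?U"
      unfolding islimpt_approachable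
    proof (intro allI impI)
      fix e :: real assume e: "e > 0"
      show "\<exists>x'\<in>?U. x' \<noteq> - 1 \<and> dist x' (- 1) < e"
      proof (intro bexI conjI)
        show "of_real (- 1 - e / 2) \<in> ?U" using e by (intro imageI) auto
        show "complex_of_real (- 1 - e / 2) \<noteq> - 1" using e by (simp add: complex_eq_iff)
        have "dist (complex_of_real (- 1 - e / 2)) (- 1) = norm (complex_of_real (- e / 2))"
          by (simp add: dist_norm)
        then show "dist (complex_of_real (- 1 - e / 2)) (- 1) < e" using e by (simp only: norm_of_real)
      qed
    qed
    show "stieltjes_transform M z - stieltjes_transform N z = 0" if "z \<in> ?U" for z
    proof -
      from that obtain r where "z = of_real r" "r < 0" by auto
      then show ?thesis using eq[of "- r"] by simp
    qed
    show "w \<in> ?S" using w by auto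
  qed
  then show "stieltjes_transform M w = stieltjes_transform N w" by simp
qed

section \<open>Solutions of the moment problem\<close>

text \<open>The complement of the support is covered by those members of a countable basis that have
  measure 0.\<close>

lemma AE_in_measure_support:
  assumes "sets \<mu> = sets borel"
  shows "AE x in \<mu>. x \<in> measure_support \<mu>"
proof -
  obtain B :: "real set set" where B: "countable B" "topological_basis B"
    using ex_countable_basis by blast
  have "AE x in \<mu>. \<forall>b\<in>{b \<in> B. emeasure \<mu> b = 0}. x \<notin> b"
  proof (rule AE_ball_countable')
    fix b assume b: "b \<in> {b \<in> B. emeasure \<mu> b = 0}"
    then have "open b" using B(2) by (simp add: topological_basis_open)
    then have "b \<in> null_sets \<mu>" using b assms by (simp add: null_sets_def)
    then show "AE x in \<mu>. x \<notin> b" by (rule AE_not_in)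
  qed (use B in auto)
  then show ?thesis
  proof eventually_elim
    case (elim x)
    show ?case
      unfolding measure_support_def
    proof (intro CollectI allI impI, elim conjE)
      fix U assume U: "open U" "x \<in> U"
      then obtain b where b: "b \<in> B" "x \<in> b" "b \<subseteq> U"
        using topological_basisE[OF B(2)] by metis
      with elim have "emeasure \<mu> b \<noteq> 0" by auto
      moreover have "emeasure \<mu> b \<le> emeasure \<mu> U"
        using b U assms by (intro emeasure_mono) auto
      ultimately show "emeasure \<mu> U > 0"
        by (metis gr_zeroI le_zero_eq)
    qed
  qed
qed

lemma measure_support_subset:
  assumes "sets \<mu> = sets borel" "closed C" "AE x in \<mu>. x \<in> C"
  shows "measure_support \<mu> \<subseteq> C"
proof (rule ccontr)
  assume "\<not> ?thesis"
  then obtain x where x: "x \<in> measure_support \<mu>" "x \<notin> C" by blast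
  have "emeasure \<mu> (- C) = 0"
  proof -
    have "{x \<in> space \<mu>. \<not> x \<in> C} = - C"
      using sets_eq_imp_space_eq[OF assms(1)] by auto
    moreover have "- C \<in> sets \<mu>" using assms by auto
    ultimately show ?thesis using assms(3) AE_iff_measurable[of "- C" \<mu> "\<lambda>x. x \<in> C"] by simp
  qed
  with x assms(2) show False by (auto simp: measure_support_def)
qed

text \<open>Infinite support is split off, so that a limit measure can be treated through its
  moments; \<open>infinite_support_of_positive_definite\<close> recovers it from the
  sequence.\<close>

definition has_moments :: "real measure \<Rightarrow> (nat \<Rightarrow> real) \<Rightarrow> bool" where
  "has_moments \<mu> s \<longleftrightarrow> sets \<mu> = sets borel \<and> (\<forall>n. integrable \<mu> (\<lambda>x. x ^ n)) \<and> (\<forall>n. (\<integral>x. x ^ n \<partial>\<mu>) = s n)"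

lemma solutions_has_moments: "\<mu> \<in> solutions s \<Longrightarrow> has_moments \<mu> s"
  by (auto simp: solutions_def Mstar_def has_moments_def moments_def)

lemma has_moments_finite_borel_measure:
  assumes "has_moments \<mu> s"
  shows "finite_borel_measure \<mu>"
proof -
  have "integrable \<mu> (\<lambda>x. 1 :: real)"
  proof -
    have "integrable \<mu> (\<lambda>x. x ^ 0)" using assms unfolding has_moments_def by blast
    then show ?thesis by simp
  qed
  then have "finite_measure \<mu>"
    by (intro finite_measureI) (simp add: integrable_iff_bounded less_top)
  then show ?thesis
    using assms by (simp add: finite_borel_measure_def finite_borel_measure_axioms_def has_moments_def)
qed

lemma has_moments_mass:
  assumes "has_moments \<mu> s"
  shows "measure \<mu> (space \<mu>) = s 0"
proof -
  have "(\<integral>x. x ^ 0 \<partial>\<mu>) = s 0" using assms unfolding has_moments_def by blast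
  then show ?thesis by simp
qed

lemma
  fixes r :: "'a::{real_normed_field,banach,second_countable_topology} poly"
  assumes "has_moments \<mu> s"
  shows integrable_poly: "integrable \<mu> (\<lambda>x. poly r (of_real x))"
    and integral_poly: "(\<integral>x. poly r (of_real x) \<partial>\<mu>) = moment_functional s r"
proof -
  have int: "integrable \<mu> (\<lambda>x. x ^ n)" and mom: "(\<integral>x. x ^ n \<partial>\<mu>) = s n" for n
    using assms by (auto simp: has_moments_def)
  have int': "integrable \<mu> (\<lambda>x. of_real x ^ n :: 'a)" for n
    using integrable_of_real[OF int[of n], where ?'a = 'a] by (simp add: of_real_power)
  have mom': "(\<integral>x. (of_real x ^ n :: 'a) \<partial>\<mu>) = of_real (s n)" for n
    using integral_of_real[OF int[of n], where ?'a = 'a] by (simp add: of_real_power mom)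
  show "integrable \<mu> (\<lambda>x. poly r (of_real x))"
    unfolding poly_altdef by (auto simp: int')
  show "(\<integral>x. poly r (of_real x) \<partial>\<mu>) = moment_functional s r"
    unfolding poly_altdef moment_functional_def
    by (subst Bochner_Integration.integral_sum) (auto simp: int' mom')
qed

text \<open>A nonnegative integrand with integral 0 vanishes almost everywhere, which would confine
  the support to the finitely many roots of f.\<close>

lemma integral_nonneg_poly_pos:
  assumes \<mu>: "has_moments \<mu> s" "infinite (measure_support \<mu>)"
    and f: "f \<noteq> (0::real poly)" "AE x in \<mu>. poly f x \<ge> 0"
  shows "moment_functional s f > 0"
proof -
  have int: "integrable \<mu> (poly f)" and eq: "(\<integral>x. poly f x \<partial>\<mu>) = moment_functional s f"
    using integrable_poly[OF \<mu>(1), of f] integral_poly[OF \<mu>(1), of f] by simp_all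
  have "moment_functional s f \<noteq> 0"
  proof
    assume "moment_functional s f = 0"
    then have "AE x in \<mu>. poly f x = 0"
      using integral_nonneg_eq_0_iff_AE[OF int f(2)] eq by simp
    then have "measure_support \<mu> \<subseteq> {x. poly f x = 0}"
      using \<mu>(1) poly_roots_finite[OF f(1)] finite_imp_closed
      by (intro measure_support_subset) (auto simp: has_moments_def)
    with poly_roots_finite[OF f(1)] \<mu>(2) show False using finite_subset by blast
  qed
  moreover have "moment_functional s f \<ge> 0"
    using integral_nonneg_AE[OF f(2)] eq by simp
  ultimately show ?thesis by simp
qed

lemma solutions_positive_definite:
  assumes "\<mu> \<in> solutions s"
  shows "positive_definite s"
  unfolding positive_definite_def
  using assms integral_nonneg_poly_pos[OF solutions_has_moments[OF assms]]
  by (auto simp: solutions_def Mstar_def)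

lemma AE_nonneg_of_stieltjes_solution:
  assumes "\<mu> \<in> stieltjes_solutions s"
  shows "AE x in \<mu>. x \<ge> 0"
  using AE_in_measure_support[of \<mu>] assms
  by (auto simp: stieltjes_solutions_def solutions_def Mstar_def elim!: eventually_mono)

lemma stieltjes_solutions_positive_definite:
  assumes "\<mu> \<in> stieltjes_solutions s" "s 0 = 1"
  shows "stieltjes_positive_definite s"
proof
  have \<mu>: "\<mu> \<in> solutions s" "infinite (measure_support \<mu>)"
    using assms by (auto simp: stieltjes_solutions_def solutions_def Mstar_def)
  show "positive_definite s" by (rule solutions_positive_definite) fact
  fix f :: "real poly" assume f: "f \<noteq> 0"
  show "moment_functional s (pCons 0 (f * f)) > 0"
    by (rule integral_nonneg_poly_pos[OF solutions_has_moments[OF \<mu>(1)] \<mu>(2)])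
      (use f AE_nonneg_of_stieltjes_solution[OF assms(1)] in auto)
qed fact

lemma infinite_support_of_positive_definite:
  assumes \<mu>: "has_moments \<mu> s" and pd: "positive_definite s"
  shows "infinite (measure_support \<mu>)"
proof
  assume fin: "finite (measure_support \<mu>)"
  define f where "f = (\<Prod>a\<in>measure_support \<mu>. [:- a, 1 :: real:])"
  have "f \<noteq> 0" using fin by (simp add: f_def)
  then have "0 < moment_functional s (f * f)" using pd by (simp add: positive_definite_def)
  also have "\<dots> = (\<integral>x. poly (f * f) x \<partial>\<mu>)" using integral_poly[OF \<mu>, of "f * f"] by simp
  also have "\<dots> = (\<integral>x. 0 \<partial>\<mu>)"
  proof (rule integral_cong_AE)
    have "AE x in \<mu>. x \<in> measure_support \<mu>"
      using \<mu> by (intro AE_in_measure_support) (simp add: has_moments_def)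
    then show "AE x in \<mu>. poly (f * f) x = 0"
      by eventually_elim (use fin in \<open>auto simp: f_def poly_prod\<close>)
    show "(\<lambda>x. poly (f * f) x) \<in> borel_measurable \<mu>"
      using integrable_poly[OF \<mu>, of "f * f"] by simp
  qed simp
  finally show False by simp
qed

lemma has_moments_solution:
  assumes "has_moments \<mu> s" "positive_definite s"
  shows "\<mu> \<in> solutions s"
  using assms infinite_support_of_positive_definite[OF assms]
  by (auto simp: solutions_def Mstar_def has_moments_def moments_def)

lemma has_moments_stieltjes_solution:
  assumes "has_moments \<mu> s" "positive_definite s" "AE x in \<mu>. x \<ge> 0"
  shows "\<mu> \<in> stieltjes_solutions s"
  using assms has_moments_solution[OF assms(1,2)] measure_support_subset[of \<mu> "{0..}"]
  by (auto simp: stieltjes_solutions_def has_moments_def)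

lemma solutions_eqI:
  assumes "has_moments \<mu> s" "has_moments \<nu> s'"
    and "\<And>z. z \<notin> \<real> \<Longrightarrow> stieltjes_transform \<mu> z = stieltjes_transform \<nu> z"
  shows "\<mu> = \<nu>"
  using assms has_moments_finite_borel_measure stieltjes_transform_unique by blast

text \<open>f(x)/(x - z) is a polynomial plus f(z)/(x - z). For f = P_n the integral is q_n(z) +
  p_n(z) w with w the transform, a Fourier coefficient of the Cauchy kernel.\<close>

lemma integral_poly_times_cauchy_kernel:
  assumes \<mu>: "has_moments \<mu> s" and z: "z \<notin> \<real>"
  shows "integrable \<mu> (\<lambda>x. poly f (of_real x) * (1 / (of_real x - z)))"
    and "(\<integral>x. poly f (of_real x) * (1 / (of_real x - z)) \<partial>\<mu>)
      = moment_functional s (synthetic_div f z) + poly f z * stieltjes_transform \<mu> z"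
proof -
  interpret finite_borel_measure \<mu> using has_moments_finite_borel_measure[OF \<mu>] .
  have eq: "poly f (of_real x) * (1 / (of_real x - z))
      = poly (synthetic_div f z) (of_real x) + poly f z * (1 / (of_real x - z))" for x
  proof -
    have nz: "of_real x \<noteq> z" using z by auto
    then have "poly (synthetic_div f z) (of_real x) = (poly f (of_real x) - poly f z) / (of_real x - z)"
      by (simp add: poly_synthetic_div_eq_quotient) (metis minus_diff_eq minus_divide_divide)
    then show ?thesis by (simp add: diff_divide_distrib)
  qed
  show "integrable \<mu> (\<lambda>x. poly f (of_real x) * (1 / (of_real x - z)))"
    unfolding eq using integrable_poly[OF \<mu>] integrable_cauchy_kernel[OF z]
    by (intro Bochner_Integration.integrable_add integrable_mult_right) auto
  show "(\<integral>x. poly f (of_real x) * (1 / (of_real x - z)) \<partial>\<mu>)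
      = moment_functional s (synthetic_div f z) + poly f z * stieltjes_transform \<mu> z"
    unfolding eq stieltjes_transform_def integral_poly[OF \<mu>, symmetric]
    using integrable_poly[OF \<mu>, of "synthetic_div f z"] integrable_cauchy_kernel[OF z]
    by (subst Bochner_Integration.integral_add) (auto intro: integrable_mult_right simp del: times_divide_eq_right)
qed

section \<open>Square summability from two distinct solutions\<close>

context normalized_positive_definite
begin

definition combination :: "(nat \<Rightarrow> complex) \<Rightarrow> nat \<Rightarrow> complex poly" where
  "combination c n = (\<Sum>k<n. smult (c k) (of_real_poly (P k)))"

lemma poly_combination: "poly (combination c n) z = (\<Sum>k<n. c k * p k z)"
  by (simp add: combination_def poly_sum op_p_def)

text \<open>On the real line conjugation affects only the coefficients, so |F|^2 is again a
  polynomial and its integral is determined by the moments.\<close>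

lemma norm_combination:
  "of_real ((norm (poly (combination c n) (of_real x)))\<^sup>2)
     = poly (combination c n * combination (\<lambda>k. cnj (c k)) n) (of_real x)"
proof -
  have "cnj (poly (combination c n) (of_real x)) = poly (combination (\<lambda>k. cnj (c k)) n) (of_real x)"
    by (simp add: poly_combination p_of_real)
  then show ?thesis by (metis complex_norm_square poly_mult)
qed

lemma
  assumes \<mu>: "has_moments \<mu> s"
  shows integrable_norm_combination: "integrable \<mu> (\<lambda>x. (norm (poly (combination c n) (of_real x)))\<^sup>2)"
    and integral_norm_combination: "(\<integral>x. (norm (poly (combination c n) (of_real x)))\<^sup>2 \<partial>\<mu>) = (\<Sum>k<n. (norm (c k))\<^sup>2)"
proof -
  let ?F = "combination c n * combination (\<lambda>k. cnj (c k)) n"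
  have "integrable \<mu> (\<lambda>x. Re (poly ?F (of_real x)))"
    by (rule integrable_Re) (rule integrable_poly[OF \<mu>])
  then show int: "integrable \<mu> (\<lambda>x. (norm (poly (combination c n) (of_real x)))\<^sup>2)"
    by (simp only: norm_combination[symmetric] Re_complex_of_real)
  have "complex_of_real (\<integral>x. (norm (poly (combination c n) (of_real x)))\<^sup>2 \<partial>\<mu>)
      = (\<integral>x. complex_of_real ((norm (poly (combination c n) (of_real x)))\<^sup>2) \<partial>\<mu>)"
    by (rule integral_of_real[OF int, symmetric])
  also have "\<dots> = L ?F"
    unfolding norm_combination by (rule integral_poly[OF \<mu>])
  also have "\<dots> = (\<Sum>j<n. c j * (\<Sum>k<n. cnj (c k) * L (of_real_poly (P j) * of_real_poly (P k))))"
  proof -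
    have "?F = (\<Sum>j<n. \<Sum>k<n. smult (c j) (smult (cnj (c k)) (of_real_poly (P j) * of_real_poly (P k))))"
      unfolding combination_def sum_product by (intro sum.cong refl) (simp add: mult.commute)
    then show ?thesis
      by (simp only: moment_functional_sum moment_functional_smult sum_distrib_left)
  qed
  also have "\<dots> = (\<Sum>j<n. c j * (\<Sum>k<n. if k = j then cnj (c k) else 0))"
    by (intro sum.cong arg_cong2[where f = "(*)"] refl) (auto simp: orthonormal')
  also have "\<dots> = (\<Sum>j<n. of_real ((norm (c j))\<^sup>2))"
    by (intro sum.cong refl) (simp add: complex_norm_square del: of_real_power)
  finally show "(\<integral>x. (norm (poly (combination c n) (of_real x)))\<^sup>2 \<partial>\<mu>) = (\<Sum>k<n. (norm (c k))\<^sup>2)"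
    by (simp flip: of_real_sum of_real_power add: of_real_eq_iff)
qed

text \<open>If F(z) = 1, the integral of F(x)/(x - z) differs from the transform by a quantity
  depending on the moments alone, so it can replace the transform in the difference. F is then
  chosen with small norm.\<close>

lemma stieltjes_transform_diff_bound:
  assumes \<mu>: "has_moments \<mu> s" and \<nu>: "has_moments \<nu> s" and z: "z \<notin> \<real>"
  shows "norm (stieltjes_transform \<mu> z - stieltjes_transform \<nu> z) * sqrt (\<Sum>k<n. (norm (p k z))\<^sup>2) \<le> 2 / \<bar>Im z\<bar>"
proof (cases "n = 0")
  case False
  define N where "N = (\<Sum>k<n. (norm (p k z))\<^sup>2)"
  have "(norm (p 0 z))\<^sup>2 \<le> N" unfolding N_def using False by (intro member_le_sum) auto
  then have N: "N > 0" by simp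
  \<comment> \<open>The reproducing kernel at z divided by its value there: the polynomial of least
    norm with F(z) = 1, of square norm 1/N.\<close>
  define c where "c k = cnj (p k z) / of_real N" for k
  define F where "F = combination c n"
  have "poly F z = (\<Sum>k<n. of_real ((norm (p k z))\<^sup>2)) / of_real N"
    unfolding F_def poly_combination c_def sum_divide_distrib
    by (intro sum.cong refl) (simp add: complex_norm_square mult.commute del: of_real_power)
  also have "\<dots> = 1" using N by (simp add: N_def flip: of_real_sum of_real_power)
  finally have Fz: "poly F z = 1" .
  have "(\<Sum>k<n. (norm (c k))\<^sup>2) = N / N\<^sup>2"
    using N by (simp add: c_def norm_divide power_divide N_def[symmetric] flip: sum_divide_distrib)
  then have c2: "(\<Sum>k<n. (norm (c k))\<^sup>2) = 1 / N"
    using N by (simp add: power2_eq_square[of N])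
  have bound: "norm (\<integral>x. poly F (of_real x) * (1 / (of_real x - z)) \<partial>\<rho>) \<le> 1 / \<bar>Im z\<bar> * (1 / sqrt N)"
    if \<rho>: "has_moments \<rho> s" for \<rho>
  proof -
    interpret finite_borel_measure \<rho> using has_moments_finite_borel_measure[OF \<rho>] .
    have one: "measure \<rho> (space \<rho>) = 1"
      using has_moments_mass[OF \<rho>] s0 by simp
    \<comment> \<open>The weights sqrt N and 1/sqrt N in the arithmetic-geometric inequality do the
      work of Cauchy-Schwarz: after integration both summands equal 1/sqrt N.\<close>
    have int2: "integrable \<rho> (\<lambda>x. 1 / \<bar>Im z\<bar> * ((sqrt N * (norm (poly F (of_real x)))\<^sup>2 + 1 / sqrt N) / 2))"
      using integrable_norm_combination[OF \<rho>, of c n] unfolding F_def by auto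
    have "norm (\<integral>x. poly F (of_real x) * (1 / (of_real x - z)) \<partial>\<rho>)
        \<le> (\<integral>x. 1 / \<bar>Im z\<bar> * ((sqrt N * (norm (poly F (of_real x)))\<^sup>2 + 1 / sqrt N) / 2) \<partial>\<rho>)"
    proof (rule order.trans[OF integral_norm_bound integral_mono[OF integrable_norm[OF integral_poly_times_cauchy_kernel(1)[OF \<rho> z]] int2]])
      fix x
      let ?a = "norm (poly F (of_real x))"
      have "2 * (sqrt (sqrt N) * ?a) * (1 / sqrt (sqrt N)) \<le> (sqrt (sqrt N) * ?a)\<^sup>2 + (1 / sqrt (sqrt N))\<^sup>2"
        by (rule sum_squares_bound)
      then have "?a \<le> (sqrt N * ?a\<^sup>2 + 1 / sqrt N) / 2"
        using N by (simp add: power_mult_distrib power_divide)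
      moreover have "norm (poly F (of_real x) * (1 / (of_real x - z))) = norm (1 / (of_real x - z)) * ?a"
        by (simp add: norm_mult norm_divide)
      ultimately show "norm (poly F (of_real x) * (1 / (of_real x - z)))
          \<le> 1 / \<bar>Im z\<bar> * ((sqrt N * ?a\<^sup>2 + 1 / sqrt N) / 2)"
        using norm_cauchy_kernel_le[OF z, of x] by (metis mult_mono norm_ge_zero order_trans)
    qed
    also have "\<dots> = 1 / \<bar>Im z\<bar> * ((sqrt N * (\<integral>x. (norm (poly F (of_real x)))\<^sup>2 \<partial>\<rho>) + 1 / sqrt N) / 2)"
      using integrable_norm_combination[OF \<rho>, of c n] one unfolding F_def by simp
    also have "(\<integral>x. (norm (poly F (of_real x)))\<^sup>2 \<partial>\<rho>) = 1 / N"
      unfolding F_def integral_norm_combination[OF \<rho>] by (rule c2)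
    also have "sqrt N * (1 / N) = 1 / sqrt N" using N by (simp add: real_div_sqrt field_simps)
    finally show ?thesis by simp
  qed
  have "stieltjes_transform \<mu> z - stieltjes_transform \<nu> z
      = (\<integral>x. poly F (of_real x) * (1 / (of_real x - z)) \<partial>\<mu>) - (\<integral>x. poly F (of_real x) * (1 / (of_real x - z)) \<partial>\<nu>)"
    unfolding integral_poly_times_cauchy_kernel(2)[OF \<mu> z] integral_poly_times_cauchy_kernel(2)[OF \<nu> z] Fz by simp
  also have "norm \<dots> \<le> 1 / \<bar>Im z\<bar> * (1 / sqrt N) + 1 / \<bar>Im z\<bar> * (1 / sqrt N)"
    by (intro norm_triangle_le_diff add_mono bound \<mu> \<nu>)
  finally show ?thesis
    using N z by (simp add: N_def[symmetric] Im_nonzero_iff field_simps)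
qed simp

text \<open>Bessel's inequality for f(x) = 1/(x - z), obtained by integrating 2 Re(F f) - |F|^2
  \<le> |f|^2 \<le> 1/(Im z)^2 with F the conjugated Fourier sum.\<close>

lemma bessel_cauchy_kernel:
  assumes \<mu>: "has_moments \<mu> s" and z: "z \<notin> \<real>"
  shows "(\<Sum>k<n. (norm (q k z + p k z * stieltjes_transform \<mu> z))\<^sup>2) \<le> 1 / (Im z)\<^sup>2"
proof -
  interpret finite_borel_measure \<mu> using has_moments_finite_borel_measure[OF \<mu>] .
  have one: "measure \<mu> (space \<mu>) = 1"
    using has_moments_mass[OF \<mu>] s0 by simp
  define w where "w = stieltjes_transform \<mu> z"
  define a where "a k = q k z + p k z * w" for k
  \<comment> \<open>Conjugated coefficients turn the integral of F f into the sum of the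
    |a_k|^2.\<close>
  define F where "F = combination (\<lambda>k. cnj (a k)) n"
  define f where "f x = 1 / (complex_of_real x - z)" for x
  have intF: "integrable \<mu> (\<lambda>x. poly F (of_real x) * f x)"
    unfolding f_def by (rule integral_poly_times_cauchy_kernel(1)[OF \<mu> z])
  have "(\<integral>x. poly F (of_real x) * f x \<partial>\<mu>) = L (synthetic_div F z) + poly F z * w"
    unfolding f_def w_def by (rule integral_poly_times_cauchy_kernel(2)[OF \<mu> z])
  also have "\<dots> = (\<Sum>k<n. cnj (a k) * a k)"
  proof -
    have "L (synthetic_div F z) = (\<Sum>k<n. cnj (a k) * q k z)"
      by (simp add: F_def combination_def moment_functional_synthetic_div_sum op_q_def)
    moreover have "poly F z * w = (\<Sum>k<n. cnj (a k) * (p k z * w))"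
      by (simp add: F_def poly_combination sum_distrib_right mult.assoc)
    moreover have "(\<Sum>k<n. cnj (a k) * a k) = (\<Sum>k<n. cnj (a k) * q k z + cnj (a k) * (p k z * w))"
      by (simp only: distrib_left[symmetric] a_def[symmetric])
    ultimately show ?thesis by (simp only: sum.distrib)
  qed
  also have "\<dots> = of_real (\<Sum>k<n. (norm (a k))\<^sup>2)"
    unfolding of_real_sum by (simp add: complex_norm_square mult.commute del: of_real_power)
  finally have IF: "(\<integral>x. poly F (of_real x) * f x \<partial>\<mu>) = of_real (\<Sum>k<n. (norm (a k))\<^sup>2)" .
  have intRe: "integrable \<mu> (\<lambda>x. Re (poly F (of_real x) * f x))" by (rule integrable_Re[OF intF])
  have Re: "(\<integral>x. Re (poly F (of_real x) * f x) \<partial>\<mu>) = (\<Sum>k<n. (norm (a k))\<^sup>2)"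
    by (subst integral_Re[OF intF]) (simp only: IF Re_complex_of_real)
  have int2: "integrable \<mu> (\<lambda>x. (norm (poly F (of_real x)))\<^sup>2)"
    unfolding F_def by (rule integrable_norm_combination[OF \<mu>])
  have I2: "(\<integral>x. (norm (poly F (of_real x)))\<^sup>2 \<partial>\<mu>) = (\<Sum>k<n. (norm (a k))\<^sup>2)"
    unfolding F_def by (subst integral_norm_combination[OF \<mu>]) simp
  have "(\<integral>x. 2 * Re (poly F (of_real x) * f x) - (norm (poly F (of_real x)))\<^sup>2 \<partial>\<mu>) \<le> (\<integral>x. 1 / (Im z)\<^sup>2 \<partial>\<mu>)"
  proof (rule integral_mono)
    fix x
    let ?F = "poly F (of_real x)"
    have "2 * Re (?F * f x) \<le> 2 * norm ?F * norm (f x)"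
      using complex_Re_le_cmod[of "?F * f x"] by (simp add: norm_mult)
    also have "\<dots> \<le> (norm ?F)\<^sup>2 + (norm (f x))\<^sup>2" by (rule sum_squares_bound)
    also have "(norm (f x))\<^sup>2 \<le> (1 / \<bar>Im z\<bar>)\<^sup>2"
      unfolding f_def by (intro power_mono norm_cauchy_kernel_le z) simp
    finally show "2 * Re (?F * f x) - (norm ?F)\<^sup>2 \<le> 1 / (Im z)\<^sup>2"
      by (simp add: power_divide)
    show "integrable \<mu> (\<lambda>x. 2 * Re (poly F (of_real x) * f x) - (norm (poly F (of_real x)))\<^sup>2)"
      by (intro Bochner_Integration.integrable_diff integrable_mult_right intRe int2)
  qed auto
  also have "\<dots> = 1 / (Im z)\<^sup>2" using one by simp
  also have "(\<integral>x. 2 * Re (poly F (of_real x) * f x) - (norm (poly F (of_real x)))\<^sup>2 \<partial>\<mu>) = (\<Sum>k<n. (norm (a k))\<^sup>2)"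
    using intRe int2 by (subst Bochner_Integration.integral_diff) (auto simp only: integral_mult_right_zero Re I2 intro!: integrable_mult_right)
  finally show ?thesis by (simp add: a_def w_def)
qed

end

text \<open>By Stieltjes inversion two solutions differ at some non-real z, where the difference
  bound caps the sum of |p_k(z)|^2. Then q_k(z) is controlled as a Fourier coefficient minus p_k(z)
  w.\<close>

lemma indeterminate_imp_indeterminate_moments:
  assumes "indeterminate s" "s 0 = 1"
  shows "indeterminate_moments s"
proof -
  obtain \<mu> \<nu> where sol: "\<mu> \<in> solutions s" "\<nu> \<in> solutions s" "\<mu> \<noteq> \<nu>"
    using assms unfolding indeterminate_def determinate_def by blast
  then have \<mu>: "has_moments \<mu> s" and \<nu>: "has_moments \<nu> s" by (auto intro: solutions_has_moments)
  interpret normalized_positive_definite s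
    using solutions_positive_definite[OF sol(1)] assms(2) by unfold_locales
  obtain z where z: "z \<notin> \<real>" "stieltjes_transform \<mu> z \<noteq> stieltjes_transform \<nu> z"
    using solutions_eqI[OF \<mu> \<nu>] sol(3) by blast
  define d where "d = norm (stieltjes_transform \<mu> z - stieltjes_transform \<nu> z)"
  have d: "d > 0" using z by (simp add: d_def)
  define \<beta> where "\<beta> = (2 / \<bar>Im z\<bar> / d)\<^sup>2"
  have p: "(\<Sum>k<n. (norm (p k z))\<^sup>2) \<le> \<beta>" for n
  proof -
    have "sqrt (\<Sum>k<n. (norm (p k z))\<^sup>2) \<le> 2 / \<bar>Im z\<bar> / d"
      unfolding pos_le_divide_eq[OF d]
      using stieltjes_transform_diff_bound[OF \<mu> \<nu> z(1), of n] by (simp add: d_def mult.commute)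
    then have "(sqrt (\<Sum>k<n. (norm (p k z))\<^sup>2))\<^sup>2 \<le> \<beta>"
      unfolding \<beta>_def by (intro power_mono) (auto simp: sum_nonneg)
    then show ?thesis by (simp add: sum_nonneg)
  qed
  define w where "w = stieltjes_transform \<mu> z"
  have q: "(\<Sum>k<n. (norm (q k z))\<^sup>2) \<le> 2 * (1 / (Im z)\<^sup>2) + 2 * (norm w)\<^sup>2 * \<beta>" for n
  proof -
    have "(norm (q k z))\<^sup>2 \<le> 2 * (norm (q k z + p k z * w))\<^sup>2 + 2 * (norm w)\<^sup>2 * (norm (p k z))\<^sup>2" for k
    proof -
      let ?a = "q k z + p k z * w" and ?b = "p k z * w"
      have "norm (q k z) \<le> norm ?a + norm ?b"
        using norm_triangle_ineq4[of ?a ?b] by simp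
      then have "(norm (q k z))\<^sup>2 \<le> (norm ?a + norm ?b)\<^sup>2" by (intro power_mono) auto
      also have "\<dots> \<le> 2 * (norm ?a)\<^sup>2 + 2 * (norm ?b)\<^sup>2"
        using sum_squares_bound[of "norm ?a" "norm ?b"] by (simp add: power2_sum)
      finally show ?thesis by (simp add: norm_mult power_mult_distrib mult_ac)
    qed
    then have "(\<Sum>k<n. (norm (q k z))\<^sup>2)
        \<le> (\<Sum>k<n. 2 * (norm (q k z + p k z * w))\<^sup>2 + 2 * (norm w)\<^sup>2 * (norm (p k z))\<^sup>2)"
      by (intro sum_mono) auto
    also have "\<dots> = 2 * (\<Sum>k<n. (norm (q k z + p k z * w))\<^sup>2) + 2 * (norm w)\<^sup>2 * (\<Sum>k<n. (norm (p k z))\<^sup>2)"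
      by (simp add: sum.distrib sum_distrib_left)
    also have "\<dots> \<le> 2 * (1 / (Im z)\<^sup>2) + 2 * (norm w)\<^sup>2 * \<beta>"
      using bessel_cauchy_kernel[OF \<mu> z(1), of n] p[of n]
      by (intro add_mono mult_left_mono) (auto simp: w_def)
    finally show ?thesis .
  qed
  have "l2_bounded_by (max \<beta> (2 * (1 / (Im z)\<^sup>2) + 2 * (norm w)\<^sup>2 * \<beta>)) z"
    unfolding l2_bounded_by_def using p q by (meson max.coboundedI1 max.coboundedI2)
  then show ?thesis by unfold_locales blast
qed

section \<open>The limit of the Gauss quadratures\<close>

definition clamp_to :: "real \<Rightarrow> real \<Rightarrow> real" where
  "clamp_to T y = max (- T) (min T y)"

text \<open>For y = x^k the truncation error is controlled by the moment of order 2 k, uniformly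
  over the measures that share it.\<close>

lemma clamp_to_error:
  assumes "T > 0"
  shows "\<bar>y - clamp_to T y\<bar> \<le> y\<^sup>2 / T"
proof (cases "\<bar>y\<bar> \<le> T")
  case True
  then have "clamp_to T y = y" by (auto simp: clamp_to_def)
  then show ?thesis using assms by simp
next
  case False
  then have "\<bar>y - clamp_to T y\<bar> \<le> \<bar>y\<bar>" using assms by (auto simp: clamp_to_def)
  also have "\<bar>y\<bar> * T \<le> \<bar>y\<bar> * \<bar>y\<bar>" using False by (intro mult_left_mono) auto
  then have "\<bar>y\<bar> \<le> y\<^sup>2 / T" using assms by (simp add: pos_le_divide_eq power2_eq_square)
  finally show ?thesis .
qed

lemma abs_clamp_to_le: "T > 0 \<Longrightarrow> \<bar>clamp_to T y\<bar> \<le> T"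
  by (auto simp: clamp_to_def)

text \<open>Convergence of the moments in a weak limit: a bound on the moment of order \<open>2 k\<close> makes the
  functions \<open>x ^ k\<close> uniformly integrable.\<close>

lemma weak_limit_moments:
  assumes M: "\<And>n. real_distribution (M n)" and \<gamma>: "real_distribution \<gamma>" and wc: "weak_conv_m M \<gamma>"
    and int: "\<And>n k. integrable (M n) (\<lambda>x. x ^ k)"
    and mom: "\<And>n k. k \<le> n \<Longrightarrow> (\<integral>x. x ^ k \<partial>M n) = s k \<and> (\<integral>x. x ^ (2 * k) \<partial>M n) = s (2 * k)"
  shows "has_moments \<gamma> s"
proof -
  interpret \<gamma>: real_distribution \<gamma> by fact
  have conv: "(\<lambda>n. \<integral>x. f x \<partial>M n) \<longlonglongrightarrow> (\<integral>x. f x \<partial>\<gamma>)"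
    if "continuous_on UNIV f" "\<And>x. \<bar>f x\<bar> \<le> B" for f :: "real \<Rightarrow> real" and B
    using weak_conv_imp_integral_bdd_continuous_conv[OF M \<gamma> wc, of f B] that
    by (simp add: continuous_on_eq_continuous_at)
  have bdd: "integrable (M n) f \<and> integrable \<gamma> f"
    if f: "continuous_on UNIV f" "\<And>x. \<bar>f x\<bar> \<le> B" for f :: "real \<Rightarrow> real" and B n
  proof -
    interpret Mn: real_distribution "M n" by (rule M)
    have fm: "f \<in> borel_measurable borel" using f(1) by (rule borel_measurable_continuous_onI)
    have "integrable (M n) f"
      by (rule finite_borel_measure.integrable_bounded_borel[OF Mn.finite_borel_measure_M fm, of B]) (use f in auto)
    moreover have "integrable \<gamma> f"
      by (rule finite_borel_measure.integrable_bounded_borel[OF \<gamma>.finite_borel_measure_M fm, of B]) (use f in auto)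
    ultimately show ?thesis by blast
  qed
  have even: "integrable \<gamma> (\<lambda>x. x ^ (2 * k)) \<and> (\<integral>x. x ^ (2 * k) \<partial>\<gamma>) \<le> s (2 * k)" for k
  proof -
    \<comment> \<open>Bounded continuous functions increasing to x^(2 k): weak convergence bounds
      their integrals by the moment, and monotone convergence passes the bound on.\<close>
    define \<psi> where "\<psi> i x = min (real i) (x ^ (2 * k))" for i and x :: real
    have c: "continuous_on UNIV (\<psi> i)" and b: "\<bar>\<psi> i x\<bar> \<le> real i" for i x
      unfolding \<psi>_def by (intro continuous_intros) (auto simp: power_mult)
    have le: "(\<integral>x. \<psi> i x \<partial>\<gamma>) \<le> s (2 * k)" for i
    proof (rule LIMSEQ_le_const2[OF conv[OF c b]], intro exI allI impI)
      fix n assume n: "k \<le> n"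
      have "(\<integral>x. \<psi> i x \<partial>M n) \<le> (\<integral>x. x ^ (2 * k) \<partial>M n)"
        using bdd[OF c b] int by (intro integral_mono) (auto simp: \<psi>_def)
      then show "(\<integral>x. \<psi> i x \<partial>M n) \<le> s (2 * k)" using mom[OF n] by simp
    qed
    have mono: "mono (\<lambda>i. \<psi> i x)" for x by (auto simp: \<psi>_def mono_def)
    have "incseq (\<lambda>i. \<integral>x. \<psi> i x \<partial>\<gamma>)"
      unfolding incseq_def using bdd[OF c b] mono
      by (auto intro!: integral_mono simp: mono_def)
    then obtain l where l: "(\<lambda>i. \<integral>x. \<psi> i x \<partial>\<gamma>) \<longlonglongrightarrow> l"
      using incseq_convergent[of "\<lambda>i. \<integral>x. \<psi> i x \<partial>\<gamma>" "s (2 * k)"] le by blast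
    have lim: "(\<lambda>i. \<psi> i x) \<longlonglongrightarrow> x ^ (2 * k)" for x
    proof (rule tendsto_eventually)
      obtain N where "x ^ (2 * k) \<le> real N" using real_arch_simple by blast
      then show "\<forall>\<^sub>F i in sequentially. \<psi> i x = x ^ (2 * k)"
        by (intro eventually_sequentiallyI[of N]) (auto simp: \<psi>_def)
    qed
    have I: "integrable \<gamma> (\<lambda>x. x ^ (2 * k))" "(\<integral>x. x ^ (2 * k) \<partial>\<gamma>) = l"
      using integrable_monotone_convergence[of \<gamma> \<psi> "\<lambda>x. x ^ (2 * k)" l]
        integral_monotone_convergence[of \<gamma> \<psi> "\<lambda>x. x ^ (2 * k)" l] bdd[OF c b] mono lim l by auto
    moreover have "l \<le> s (2 * k)" using LIMSEQ_le_const2[OF l] le by blast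
    ultimately show ?thesis by simp
  qed
  have intk: "integrable \<gamma> (\<lambda>x. x ^ k)" for k
  proof (rule Bochner_Integration.integrable_bound)
    show "integrable \<gamma> (\<lambda>x. 1 + x ^ (2 * k))" using even[of k] by auto
    show "AE x in \<gamma>. norm (x ^ k) \<le> norm (1 + x ^ (2 * k))"
    proof (intro AE_I2)
      fix x :: real
      have "2 * \<bar>x ^ k\<bar> * 1 \<le> \<bar>x ^ k\<bar>\<^sup>2 + 1\<^sup>2" by (rule sum_squares_bound)
      moreover have "\<bar>x ^ k\<bar>\<^sup>2 = x ^ (2 * k)" by (simp add: power_mult[symmetric] mult.commute)
      moreover have "0 \<le> x ^ (2 * k)" by (simp add: power_mult)
      ultimately show "norm (x ^ k) \<le> norm (1 + x ^ (2 * k))" by (simp only: real_norm_def power_one mult_1_right)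
    qed
  qed measurable
  have "(\<integral>x. x ^ k \<partial>\<gamma>) = s k" for k
  proof -
    \<comment> \<open>One estimate serves both the approximating measures and the limit; for the
      limit, the moment of order 2 k is so far known only as an inequality.\<close>
    have approx: "\<bar>(\<integral>x. x ^ k \<partial>\<rho>) - (\<integral>x. clamp_to T (x ^ k) \<partial>\<rho>)\<bar> \<le> s (2 * k) / T"
      if T: "T > 0" and \<rho>: "integrable \<rho> (\<lambda>x. x ^ k)" "integrable \<rho> (\<lambda>x. x ^ (2 * k))"
        "integrable \<rho> (\<lambda>x. clamp_to T (x ^ k))" "(\<integral>x. x ^ (2 * k) \<partial>\<rho>) \<le> s (2 * k)" for T \<rho>
    proof -
      have "\<bar>(\<integral>x. x ^ k \<partial>\<rho>) - (\<integral>x. clamp_to T (x ^ k) \<partial>\<rho>)\<bar> = \<bar>\<integral>x. x ^ k - clamp_to T (x ^ k) \<partial>\<rho>\<bar>"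
        using \<rho> by simp
      also have "\<dots> \<le> (\<integral>x. \<bar>x ^ k - clamp_to T (x ^ k)\<bar> \<partial>\<rho>)" by (rule integral_abs_bound)
      also have "\<dots> \<le> (\<integral>x. x ^ (2 * k) / T \<partial>\<rho>)"
      proof (rule integral_mono)
        show "\<bar>x ^ k - clamp_to T (x ^ k)\<bar> \<le> x ^ (2 * k) / T" for x
          using clamp_to_error[OF T, of "x ^ k"] by (simp add: power_mult[symmetric] mult.commute)
      qed (use \<rho> in auto)
      also have "\<dots> \<le> s (2 * k) / T" using \<rho>(4) T by (simp add: divide_right_mono)
      finally show ?thesis .
    qed
    have "\<bar>(\<integral>x. x ^ k \<partial>\<gamma>) - s k\<bar> \<le> 2 * s (2 * k) / T" if T: "T > 0" for T
    proof -
      have c: "continuous_on UNIV (\<lambda>x. clamp_to T (x ^ k))"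
        unfolding clamp_to_def by (intro continuous_intros)
      have b: "\<bar>clamp_to T (x ^ k)\<bar> \<le> T" for x
        using T by (rule abs_clamp_to_le)
      have "(\<lambda>n. \<bar>s k - (\<integral>x. clamp_to T (x ^ k) \<partial>M n)\<bar>) \<longlonglongrightarrow> \<bar>s k - (\<integral>x. clamp_to T (x ^ k) \<partial>\<gamma>)\<bar>"
        by (intro tendsto_intros conv[OF c b])
      moreover have "\<bar>s k - (\<integral>x. clamp_to T (x ^ k) \<partial>M n)\<bar> \<le> s (2 * k) / T" if n: "k \<le> n" for n
        using approx[OF T, of "M n"] mom[OF n] int bdd[OF c b] by simp
      ultimately have "\<bar>s k - (\<integral>x. clamp_to T (x ^ k) \<partial>\<gamma>)\<bar> \<le> s (2 * k) / T"
        by (intro LIMSEQ_le_const2) auto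
      moreover have "\<bar>(\<integral>x. x ^ k \<partial>\<gamma>) - (\<integral>x. clamp_to T (x ^ k) \<partial>\<gamma>)\<bar> \<le> s (2 * k) / T"
        using approx[OF T, of \<gamma>] intk even bdd[OF c b] by simp
      ultimately show ?thesis by simp
    qed
    then have "\<bar>(\<integral>x. x ^ k \<partial>\<gamma>) - s k\<bar> \<le> 0"
      by (intro tendsto_le[OF trivial_limit_sequentially, of "\<lambda>n. 2 * s (2 * k) / real (Suc n)" 0 "\<lambda>_. \<bar>(\<integral>x. x ^ k \<partial>\<gamma>) - s k\<bar>"])
        (real_asymp, auto)
    then show ?thesis by simp
  qed
  then show ?thesis using intk \<gamma>.events_eq_borel by (simp add: has_moments_def)
qed

text \<open>The point measure lives on the power set of X; its image under the identity lives on the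
  Borel sets, as weak convergence demands.\<close>

definition discrete_measure :: "real set \<Rightarrow> (real \<Rightarrow> real) \<Rightarrow> real measure" where
  "discrete_measure X \<Lambda> = distr (point_measure X (\<lambda>x. ennreal (\<Lambda> x))) borel (\<lambda>x. x)"

lemma
  fixes f :: "real \<Rightarrow> 'a::{banach, second_countable_topology}"
  assumes "finite X" "\<forall>x\<in>X. \<Lambda> x > 0" "f \<in> borel_measurable borel"
  shows integrable_discrete_measure: "integrable (discrete_measure X \<Lambda>) f"
    and integral_discrete_measure: "(\<integral>x. f x \<partial>discrete_measure X \<Lambda>) = (\<Sum>x\<in>X. \<Lambda> x *\<^sub>R f x)"
proof -
  have id: "(\<lambda>x. x) \<in> measurable (point_measure X (\<lambda>x. ennreal (\<Lambda> x))) borel" by simp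
  show "integrable (discrete_measure X \<Lambda>) f"
    unfolding discrete_measure_def integrable_distr_eq[OF id assms(3)]
    using assms by (intro integrable_point_measure_finite)
  show "(\<integral>x. f x \<partial>discrete_measure X \<Lambda>) = (\<Sum>x\<in>X. \<Lambda> x *\<^sub>R f x)"
    unfolding discrete_measure_def integral_distr[OF id assms(3)]
    using assms by (intro lebesgue_integral_point_measure_finite) (auto intro: less_imp_le)
qed

lemma real_distribution_discrete_measure:
  assumes "finite X" "\<forall>x\<in>X. \<Lambda> x > 0" "(\<Sum>x\<in>X. \<Lambda> x) = 1"
  shows "real_distribution (discrete_measure X \<Lambda>)"
proof -
  have "prob_space (point_measure X (\<lambda>x. ennreal (\<Lambda> x)))"
  proof
    have "(\<Sum>x\<in>X. ennreal (\<Lambda> x)) = 1"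
      using assms by (subst sum_ennreal) (auto intro: less_imp_le)
    then show "emeasure (point_measure X (\<lambda>x. ennreal (\<Lambda> x))) (space (point_measure X (\<lambda>x. ennreal (\<Lambda> x)))) = 1"
      using assms by (simp add: emeasure_point_measure_finite space_point_measure)
  qed
  then show ?thesis
    unfolding discrete_measure_def by (intro prob_space.real_distribution_distr) simp_all
qed

text \<open>Chebyshev's inequality, on a half-open interval as in the definition of
  \<open>tight\<close>.\<close>

lemma measure_le_second_moment:
  assumes "real_distribution M" "integrable M (\<lambda>x. x\<^sup>2)" "K > 0"
  shows "1 - (\<integral>x. x\<^sup>2 \<partial>M) / K\<^sup>2 \<le> measure M {- K<..K}"
proof -
  interpret real_distribution M by fact
  have "(\<integral>x. 1 - x\<^sup>2 / K\<^sup>2 \<partial>M) \<le> (\<integral>x. indicator {- K<..K} x \<partial>M)"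
  proof (rule integral_mono)
    fix x
    show "1 - x\<^sup>2 / K\<^sup>2 \<le> indicator {- K<..K} x"
    proof (cases "x \<in> {- K<..K}")
      case False
      then have "K\<^sup>2 \<le> x\<^sup>2" using assms(3) by (intro abs_le_square_iff[THEN iffD1]) auto
      then show ?thesis using False assms(3) by simp
    qed simp
  qed (use assms in \<open>auto simp: less_top[symmetric]\<close>)
  then show ?thesis using assms(2) by (simp add: prob_space[simplified])
qed

text \<open>Helly selection for the quadratures, which are tight because they share the second
  moment. The clause on transforms records which quotients of q_n and p_n produced the
  measure.\<close>

lemma (in stieltjes_positive_definite) gauss_limit:
  "\<exists>\<gamma> r. has_moments \<gamma> s \<and> (AE x in \<gamma>. x \<ge> 0) \<and> strict_mono r \<and>
     (\<forall>z. z \<notin> \<real> \<longrightarrow> (\<lambda>k. - q (r k) z / p (r k) z) \<longlonglongrightarrow> stieltjes_transform \<gamma> z)"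
proof -
  \<comment> \<open>The order n + 2 makes the moment of order 2 exact already for n = 0, and the
    moments of order 2 k for all k \<le> n.\<close>
  define Q where "Q n X \<Lambda> \<longleftrightarrow> finite X \<and> X \<subseteq> {0<..} \<and> (\<forall>x\<in>X. \<Lambda> x > 0) \<and>
    (\<forall>i<2 * (n + 2). s i = (\<Sum>x\<in>X. \<Lambda> x * x ^ i)) \<and>
    (\<forall>z::complex. z \<notin> \<real> \<longrightarrow> (\<Sum>x\<in>X. of_real (\<Lambda> x) / (of_real x - z)) = - q (n + 2) z / p (n + 2) z)"
    for n X \<Lambda>
  have "\<forall>n. \<exists>X \<Lambda>. Q n X \<Lambda>"
    unfolding Q_def by (intro allI gauss_quadrature) simp
  from choice[OF this] obtain X where "\<forall>n. \<exists>\<Lambda>. Q n (X n) \<Lambda>" ..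
  from choice[OF this] obtain \<Lambda> where Q: "\<forall>n. Q n (X n) (\<Lambda> n)" ..
  have X: "finite (X n)" "X n \<subseteq> {0<..}" "\<forall>x\<in>X n. \<Lambda> n x > 0"
    and mom: "\<And>i. i < 2 * (n + 2) \<Longrightarrow> s i = (\<Sum>x\<in>X n. \<Lambda> n x * x ^ i)"
    and tr: "\<And>z::complex. z \<notin> \<real> \<Longrightarrow> (\<Sum>x\<in>X n. of_real (\<Lambda> n x) / (of_real x - z)) = - q (n + 2) z / p (n + 2) z" for n
    using Q[rule_format, of n] unfolding Q_def by blast+
  define M where "M n = discrete_measure (X n) (\<Lambda> n)" for n
  have rd: "real_distribution (M n)" for n
    unfolding M_def using X[of n] mom[of 0 n] s0 by (intro real_distribution_discrete_measure) auto
  have int: "integrable (M n) f" if "f \<in> borel_measurable borel" for n and f :: "real \<Rightarrow> real"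
    unfolding M_def by (rule integrable_discrete_measure) (use X that in auto)
  have Mmom: "(\<integral>x. x ^ i \<partial>M n) = s i" if "i < 2 * (n + 2)" for i n
    unfolding M_def using X[of n] mom[OF that] by (subst integral_discrete_measure) auto
  have "tight M"
    unfolding tight_def
  proof (intro conjI allI impI rd)
    fix \<epsilon> :: real assume \<epsilon>: "\<epsilon> > 0"
    have "0 \<le> (\<integral>x. x ^ 2 \<partial>M 0)" by (rule Bochner_Integration.integral_nonneg) simp
    then have s2: "s 2 \<ge> 0" using Mmom[of 2 0] by simp
    define K where "K = sqrt (s 2 / \<epsilon> + 1)"
    have pos: "s 2 / \<epsilon> + 1 > 0" using s2 \<epsilon> by (simp add: add_nonneg_pos)
    then have K: "K > 0" "K\<^sup>2 = s 2 / \<epsilon> + 1" by (auto simp: K_def)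
    have "s 2 < \<epsilon> * K\<^sup>2" using \<epsilon> by (simp add: K(2) field_simps)
    then have 1: "s 2 / K\<^sup>2 < \<epsilon>" using K(1) by (simp add: pos_divide_less_eq)
    have 2: "1 - s 2 / K\<^sup>2 \<le> measure (M n) {- K<..K}" for n
      using measure_le_second_moment[OF rd[of n] int K(1)] Mmom[of 2 n] by simp
    have "1 - \<epsilon> < measure (M n) {- K<..K}" for n
      using 1 2[of n] by linarith
    then show "\<exists>a b. a < b \<and> (\<forall>n. 1 - \<epsilon> < measure (M n) {a<..b})" using K(1) by (intro exI[of _ "- K"] exI[of _ K]) auto
  qed
  from tight_imp_convergent_subsubsequence[OF this, of id] obtain r \<gamma> where
    r: "strict_mono r" and \<gamma>: "real_distribution \<gamma>" and wc: "weak_conv_m (M \<circ> r) \<gamma>"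
    by (auto simp: strict_mono_def)
  have rd': "real_distribution ((M \<circ> r) n)" for n by (simp add: rd)
  have \<gamma>m: "has_moments \<gamma> s"
  proof (rule weak_limit_moments[OF rd' \<gamma> wc])
    fix n k :: nat assume "k \<le> n"
    then have "k \<le> r n" using seq_suble[OF r, of n] by simp
    then show "(\<integral>x. x ^ k \<partial>(M \<circ> r) n) = s k \<and> (\<integral>x. x ^ (2 * k) \<partial>(M \<circ> r) n) = s (2 * k)"
      by (auto intro!: Mmom)
  qed (auto intro!: int)
  have nonneg: "AE x in \<gamma>. x \<ge> 0"
  proof -
    interpret \<gamma>: real_distribution \<gamma> by fact
    \<comment> \<open>A bounded continuous test function, positive exactly on the negative axis,
      where the quadratures have no nodes.\<close>
    define f where "f x = max 0 (min 1 (- x))" for x :: real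
    have fc: "continuous_on UNIV f" unfolding f_def by (intro continuous_intros)
    then have fm: "f \<in> borel_measurable borel" by (rule borel_measurable_continuous_onI)
    have fb: "norm (f x) \<le> 1" for x by (simp add: f_def)
    have "(\<lambda>n. integral\<^sup>L ((M \<circ> r) n) f) \<longlonglongrightarrow> integral\<^sup>L \<gamma> f"
      by (rule weak_conv_imp_integral_bdd_continuous_conv[OF rd' \<gamma> wc _ fb])
        (use fc in \<open>simp add: continuous_on_eq_continuous_at\<close>)
    moreover have "integral\<^sup>L ((M \<circ> r) n) f = 0" for n
    proof -
      have "f x = 0" if "x \<in> X (r n)" for x using X(2)[of "r n"] that by (auto simp: f_def)
      then show ?thesis
        unfolding M_def comp_def using X[of "r n"] fm by (subst integral_discrete_measure) auto
    qed
    ultimately have "integral\<^sup>L \<gamma> f = 0" by (simp add: LIMSEQ_const_iff)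
    moreover have "integrable \<gamma> f"
      by (rule finite_borel_measure.integrable_bounded_borel[OF \<gamma>.finite_borel_measure_M fm fb])
    ultimately have "AE x in \<gamma>. f x = 0"
      by (subst (asm) integral_nonneg_eq_0_iff_AE) (auto simp: f_def)
    then show ?thesis by eventually_elim (auto simp: f_def max_def min_def split: if_splits)
  qed
  have lim: "(\<lambda>k. - q (r k + 2) z / p (r k + 2) z) \<longlonglongrightarrow> stieltjes_transform \<gamma> z" if z: "z \<notin> \<real>" for z
  proof -
    let ?f = "\<lambda>x. 1 / (complex_of_real x - z)"
    have nz: "complex_of_real x - z \<noteq> 0" for x using z by auto
    have fc: "continuous_on UNIV ?f" using nz by (intro continuous_intros) auto
    then have fm: "?f \<in> borel_measurable borel" by (rule borel_measurable_continuous_onI)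
    have "(\<lambda>n. integral\<^sup>L ((M \<circ> r) n) ?f) \<longlonglongrightarrow> integral\<^sup>L \<gamma> ?f"
      by (rule weak_conv_imp_integral_bdd_continuous_conv[OF rd' \<gamma> wc _ norm_cauchy_kernel_le[OF z]])
        (use fc in \<open>simp add: continuous_on_eq_continuous_at\<close>)
    moreover have "integral\<^sup>L ((M \<circ> r) n) ?f = - q (r n + 2) z / p (r n + 2) z" for n
      unfolding tr[OF z, symmetric] M_def comp_def using X[of "r n"] fm
      by (subst integral_discrete_measure) (auto simp: scaleR_conv_of_real)
    ultimately show ?thesis by (simp add: stieltjes_transform_def)
  qed
  show ?thesis
  proof (intro exI[of _ \<gamma>] exI[of _ "\<lambda>k. r k + 2"] conjI allI impI)
    show "strict_mono (\<lambda>k. r k + 2)" using r by (simp add: strict_mono_def)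
  qed (use \<gamma>m nonneg lim in auto)
qed

section \<open>The Friedrichs parameter\<close>

context normalized_positive_definite
begin

lemma p_real: "p n x = poly (P n) (x::real)"
  by (simp add: op_p_def)

text \<open>The reproducing kernel at 0 for degrees below n. Its value at 0 equals its square norm,
  and this number governs the mass that a solution can have at 0.\<close>

definition kernel :: "nat \<Rightarrow> real poly" where
  "kernel n = (\<Sum>k<n. smult (p k 0) (P k))"

lemma poly_kernel: "poly (kernel n) x = (\<Sum>k<n. p k 0 * p k x)"
  by (simp add: kernel_def poly_sum p_real)

lemma degree_kernel: "n > 0 \<Longrightarrow> degree (kernel n) < n"
  unfolding kernel_def by (intro degree_sum_less) (auto intro: le_less_trans[OF degree_smult_le])

lemma D_part_kernel: "D_part n x = x * poly (kernel n) x"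
  by (simp add: D_part_def poly_kernel)

lemma kernel_reproducing:
  assumes "degree f < n"
  shows "L (kernel n * f) = poly f 0"
proof -
  have "L (kernel n * f) = (\<Sum>k<n. p k 0 * L (P k * f))"
    by (simp add: kernel_def sum_distrib_right moment_functional_sum moment_functional_smult)
  also have "\<dots> = poly (\<Sum>k<n. smult (L (f * P k)) (P k)) 0"
    by (simp add: poly_sum p_real mult.commute)
  also have "(\<Sum>k<n. smult (L (f * P k)) (P k)) = f"
    using expansion[OF assms] by simp
  finally show ?thesis .
qed

lemma kernel_norm: "n > 0 \<Longrightarrow> L (kernel n * kernel n) = (\<Sum>k<n. (p k 0)\<^sup>2)"
  using kernel_reproducing[OF degree_kernel] by (simp add: poly_kernel power2_eq_square)

lemma evaluation_bound:
  fixes f :: "real poly"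
  assumes "degree f < n"
  shows "(poly f 0)\<^sup>2 \<le> L (f * f) * (\<Sum>k<n. (p k 0)\<^sup>2)"
proof -
  define a where "a k = L (f * P k)" for k
  have f: "f = (\<Sum>k<n. smult (a k) (P k))" using expansion[OF assms] by (simp add: a_def)
  have "L (f * f) = (\<Sum>k<n. a k * L (f * P k))"
    by (subst (2) f) (simp add: sum_distrib_left moment_functional_sum moment_functional_smult)
  also have "\<dots> = (\<Sum>k<n. (a k)\<^sup>2)" by (simp add: a_def power2_eq_square)
  finally have 1: "L (f * f) = (\<Sum>k<n. (a k)\<^sup>2)" .
  have "poly f 0 = (\<Sum>k<n. a k * p k 0)" by (subst f) (simp add: poly_sum p_real)
  then show ?thesis unfolding 1 using Cauchy_Schwarz_ineq_sum[of a "\<lambda>k. p k 0" "{..<n}"] by simp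
qed

end

text \<open>The Leibniz rule for divided differences.\<close>

lemma synthetic_div_mult:
  "synthetic_div (f * g) z = f * synthetic_div g z + smult (poly g z) (synthetic_div f (z::'a::field))"
proof -
  have f: "f = [:- z, 1:] * synthetic_div f z + [:poly f z:]" and g: "g = [:- z, 1:] * synthetic_div g z + [:poly g z:]"
    by (simp_all only: synthetic_div_correct')
  have "f * g = f * ([:- z, 1:] * synthetic_div g z + [:poly g z:])"
    by (simp only: g[symmetric])
  also have "\<dots> = f * ([:- z, 1:] * synthetic_div g z) + smult (poly g z) f"
    unfolding distrib_left by (simp only: mult.commute[of f "[:poly g z:]"]) simp
  also have "\<dots> = f * ([:- z, 1:] * synthetic_div g z) + smult (poly g z) ([:- z, 1:] * synthetic_div f z + [:poly f z:])"
    by (simp only: f[symmetric])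
  also have "\<dots> = [:- z, 1:] * (f * synthetic_div g z + smult (poly g z) (synthetic_div f z)) + [:poly g z * poly f z:]"
    by (simp only: distrib_left smult_add_right mult_smult_right mult.left_commute[of f] smult_pCons smult_0_right add.assoc)
  finally have "f * g + smult z (f * synthetic_div g z + smult (poly g z) (synthetic_div f z))
      = pCons (poly g z * poly f z) (f * synthetic_div g z + smult (poly g z) (synthetic_div f z))"
    by simp
  from synthetic_div_unique[OF this] show ?thesis by simp
qed

section \<open>The numbers c_n and their extremal property\<close>

context stieltjes_positive_definite
begin

lemma p_nonpos_nonzero:
  assumes "x \<le> 0"
  shows "p n (x::real) \<noteq> 0"
proof
  assume "p n x = 0"
  then have "poly (of_real_poly (P n)) (of_real x) = (0::complex)"
    by (simp add: p_real poly_of_real_poly_of_real)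
  from root_P_positive[OF this] assms show False by auto
qed

lemma p_same_sign:
  assumes "y > 0"
  shows "p n 0 * p n (- y :: real) > 0"
proof (rule ccontr)
  assume "\<not> ?thesis"
  moreover have "p n 0 * p n (- y) \<noteq> 0"
    using p_nonpos_nonzero[of 0 n] p_nonpos_nonzero[of "- y" n] assms by simp
  ultimately have "p n 0 * p n (- y) < 0" by linarith
  then have "poly (P n) (- y) * poly (P n) 0 < 0" by (simp add: p_real mult.commute)
  then obtain x where "x < 0" "poly (P n) x = 0"
    using poly_IVT[of "- y" 0 "P n"] assms by auto
  then show False using p_nonpos_nonzero[of x n] by (simp add: p_real)
qed

definition c :: "nat \<Rightarrow> real" where
  "c n = - q n 0 / p n 0"

text \<open>1 + x r_n(x) is P_n/p_n(0); for n > 0, r_n is the optimal polynomial in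
  \<open>c_max\<close>.\<close>

definition r :: "nat \<Rightarrow> real poly" where
  "r n = smult (1 / p n 0) (synthetic_div (P n) 0)"

lemma q_0_eq: "q n 0 = - c n * p n (0::real)"
  using p_nonpos_nonzero[of 0 n] by (simp add: c_def)

lemma c_0: "c 0 = 0"
  by (simp add: c_def)

lemma L_r: "L (r n) = - c n"
  by (simp add: r_def moment_functional_smult c_def op_q_def)

lemma pCons_r: "pCons 1 (r n) = smult (1 / p n 0) (P n)"
proof -
  have "P n = pCons (p n 0) (synthetic_div (P n) 0)"
    using synthetic_div_correct[of "P n" 0] by (simp add: p_real)
  then have "smult (1 / p n 0) (P n) = smult (1 / p n 0) (pCons (p n 0) (synthetic_div (P n) 0))"
    by (rule arg_cong)
  then show ?thesis using p_nonpos_nonzero[of 0 n] by (simp add: r_def)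
qed

lemma r_inj: "m \<noteq> n \<Longrightarrow> r m \<noteq> r n"
proof
  assume "m \<noteq> n" "r m = r n"
  then have "degree (smult (1 / p m 0) (P m)) = degree (smult (1 / p n 0) (P n))"
    using pCons_r[of m] pCons_r[of n] by simp
  then show False using \<open>m \<noteq> n\<close> p_nonpos_nonzero[of 0 m] p_nonpos_nonzero[of 0 n] by simp
qed

lemma degree_r: "degree (r n) \<le> n - 1"
  unfolding r_def by (intro order.trans[OF degree_smult_le]) (simp add: degree_synthetic_div)

lemma r_reproducing:
  assumes "degree f < n"
  shows "L (pCons 0 (r n * f)) = - L f"
proof -
  have "pCons 0 (r n * f) = pCons 1 (r n) * f - f" by simp
  also have "L \<dots> = 1 / p n 0 * L (f * P n) - L f"
    unfolding pCons_r by (simp add: moment_functional_diff moment_functional_smult mult.commute)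
  also have "L (f * P n) = 0" using orthogonal_lower_degree[OF assms] by simp
  finally show ?thesis by simp
qed

lemma L_x_r: "L (pCons 0 (r n * r n)) = c n"
proof (cases "n = 0")
  case True
  then show ?thesis by (simp add: r_def P_0 c_0)
next
  case False
  then have "degree (r n) < n" using degree_r[of n] by simp
  then show ?thesis by (simp add: r_reproducing L_r)
qed

text \<open>Completing the square: L(x (f - r_n)^2) = L(x f^2) + 2 L(f) + c_n. For n > 0, c_n is
  thus a maximum over the degrees below n, attained only at r_n, which forces strict growth.\<close>

lemma c_max:
  assumes "degree f < n"
  shows "- 2 * L f - L (pCons 0 (f * f)) \<le> c n" "f \<noteq> r n \<Longrightarrow> - 2 * L f - L (pCons 0 (f * f)) < c n"
proof -
  have "pCons 0 ((f - r n) * (f - r n))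
      = pCons 0 (f * f) - smult 2 (pCons 0 (r n * f)) + pCons 0 (r n * r n)"
    by (rule poly_eq_poly_eq_iff[THEN iffD1]) (simp add: fun_eq_iff algebra_simps)
  then have "L (pCons 0 ((f - r n) * (f - r n))) = L (pCons 0 (f * f)) + 2 * L f + c n"
    by (simp only: moment_functional_diff moment_functional_add moment_functional_smult r_reproducing[OF assms] L_x_r)
  moreover have "L (pCons 0 ((f - r n) * (f - r n))) \<ge> 0" "f \<noteq> r n \<Longrightarrow> L (pCons 0 ((f - r n) * (f - r n))) > 0"
    using pdS[of "f - r n"] by (cases "f = r n"; auto)+
  ultimately show "- 2 * L f - L (pCons 0 (f * f)) \<le> c n" "f \<noteq> r n \<Longrightarrow> - 2 * L f - L (pCons 0 (f * f)) < c n"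
    by linarith+
qed

lemma c_less: "m < n \<Longrightarrow> c m < c n"
  using c_max(2)[of "r m" n] degree_r[of m] r_inj[of m n] by (simp add: L_r L_x_r)

lemma c_le: "m \<le> n \<Longrightarrow> c m \<le> c n"
  using c_less[of m n] by (cases "m = n") auto

lemma c_nonneg: "c n \<ge> 0"
  using c_le[of 0 n] by (simp add: c_0)

lemma c_pos: "n > 0 \<Longrightarrow> c n > 0"
  using c_less[of 0 n] by (simp add: c_0)

lemma shifted_square:
  "moment_functional (shifted_seq s t) (pCons a g * pCons a g) = a\<^sup>2 * t + 2 * a * L g + L (pCons 0 (g * g))"
proof -
  have "pCons a g * pCons a g = pCons (a\<^sup>2) (smult (2 * a) g + pCons 0 (g * g))"
    by (rule poly_eq_poly_eq_iff[THEN iffD1]) (simp add: fun_eq_iff power2_eq_square algebra_simps)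
  then show ?thesis
    by (simp only: moment_functional_shifted_seq moment_functional_add moment_functional_smult) simp
qed

text \<open>Homogeneity reduces a \<noteq> 0 to a = 1, where this is \<open>c_max\<close> with the
  sign reversed; for a = 0 the right-hand side is L(x g^2).\<close>

lemma shifted_square_ge:
  assumes "degree g < n"
  shows "a\<^sup>2 * (t - c n) \<le> moment_functional (shifted_seq s t) (pCons a g * pCons a g)"
proof (cases "a = 0")
  case True
  have "0 \<le> L (pCons 0 (g * g))" using pdS[of g] by (cases "g = 0") auto
  then show ?thesis unfolding shifted_square using True by simp
next
  case False
  define h where "h = smult (1 / a) g"
  have g: "g = smult a h" using False by (simp add: h_def)
  have "degree h < n" using assms False by (simp add: h_def)
  from c_max(1)[OF this] have "a\<^sup>2 * (t - c n) \<le> a\<^sup>2 * (t + 2 * L h + L (pCons 0 (h * h)))"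
    by (intro mult_left_mono) auto
  also have "\<dots> = a\<^sup>2 * t + 2 * a * L g + L (pCons 0 (g * g))"
  proof -
    have "pCons 0 (g * g) = smult (a * a) (pCons 0 (h * h))" unfolding g by simp
    then show ?thesis
      by (simp only: g moment_functional_smult) (simp add: power2_eq_square algebra_simps)
  qed
  finally show ?thesis by (simp only: shifted_square)
qed

lemma shifted_min:
  assumes "n > 0"
  shows "moment_functional (shifted_seq s t) (smult (1 / p n 0) (P n) * smult (1 / p n 0) (P n)) = t - c n"
  unfolding pCons_r[symmetric] shifted_square by (simp add: L_r L_x_r)

text \<open>Strict growth of c makes the bounds c_n \<le> t strict, so that t may equal the limit of
  c_n. Positivity on x f^2 is inherited, because the shifted functional of x f^2 is L(f^2).\<close>

lemma shifted_positive_definite: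
  assumes t: "\<And>n. c n \<le> t"
  shows "stieltjes_positive_definite (normalized_seq (shifted_seq s t))" "t > 0"
proof -
  show t0: "t > 0" using t[of 1] c_pos[of 1] by simp
  have lt: "c n < t" for n using t[of "Suc n"] c_less[of n "Suc n"] by simp
  have pd': "moment_functional (shifted_seq s t) (f * f) > 0" if "f \<noteq> 0" for f :: "real poly"
  proof -
    obtain a g where f: "f = pCons a g" by (cases f)
    have sq: "moment_functional (shifted_seq s t) (f * f) = a\<^sup>2 * t + 2 * a * L g + L (pCons 0 (g * g))"
      unfolding f by (rule shifted_square)
    show ?thesis
    proof (cases "a = 0")
      case True
      then have "g \<noteq> 0" using that f by auto
      then show ?thesis unfolding sq using True pdS by simp
    next
      case False
      then have "0 < a\<^sup>2 * (t - c (Suc (degree g)))" using lt by simp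
      then show ?thesis unfolding f using shifted_square_ge[of g "Suc (degree g)" a t] by simp
    qed
  qed
  have eq: "normalized_seq (shifted_seq s t) = (\<lambda>n. shifted_seq s t n / t)"
    by (simp add: normalized_seq_def[abs_def] shifted_seq_def)
  show "stieltjes_positive_definite (normalized_seq (shifted_seq s t))"
    unfolding eq
  proof
    show "positive_definite (\<lambda>n. shifted_seq s t n / t)"
      unfolding positive_definite_def using pd' t0 by (simp add: moment_functional_divide)
    show "shifted_seq s t 0 / t = 1" using t0 by (simp add: shifted_seq_def)
    show "0 < moment_functional (\<lambda>n. shifted_seq s t n / t) (pCons 0 (f * f))" if "f \<noteq> 0" for f :: "real poly"
      using pos[OF that] t0 by (simp add: moment_functional_divide moment_functional_shifted_seq)
  qed
qed

section \<open>Two-sided bounds for Stieltjes transforms at negative points\<close>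

lemma integral_poly_times_real_kernel:
  assumes \<mu>: "has_moments \<mu> s" "AE x in \<mu>. x \<ge> 0" and y: "y > 0"
  shows "integrable \<mu> (\<lambda>x. 1 / (x + y))"
    and "(\<integral>x. poly f x * (1 / (x + y)) \<partial>\<mu>)
      = L (synthetic_div f (- y)) + poly f (- y) * (\<integral>x. 1 / (x + y) \<partial>\<mu>)"
proof -
  interpret finite_borel_measure \<mu> using has_moments_finite_borel_measure[OF \<mu>(1)] .
  show int: "integrable \<mu> (\<lambda>x. 1 / (x + y))"
  proof (rule integrable_const_bound[where B = "1 / y"])
    show "AE x in \<mu>. norm (1 / (x + y)) \<le> 1 / y"
      using \<mu>(2) by eventually_elim (use y in \<open>simp add: frac_le\<close>)
  qed (unfold borel_measurable_M, measurable)
  have ip: "integrable \<mu> (\<lambda>x. poly (synthetic_div f (- y)) x)"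
    using integrable_poly[OF \<mu>(1), of "synthetic_div f (- y)"] by simp
  have "(\<integral>x. poly f x * (1 / (x + y)) \<partial>\<mu>)
      = (\<integral>x. poly (synthetic_div f (- y)) x + poly f (- y) * (1 / (x + y)) \<partial>\<mu>)"
  proof (rule integral_cong_AE)
    show "AE x in \<mu>. poly f x * (1 / (x + y)) = poly (synthetic_div f (- y)) x + poly f (- y) * (1 / (x + y))"
      using \<mu>(2)
    proof eventually_elim
      case (elim x)
      then have "x \<noteq> - y" "x + y \<noteq> 0" using y by auto
      then have "poly (synthetic_div f (- y)) x * (x + y) = poly f x - poly f (- y)"
        by (simp add: poly_synthetic_div_eq_quotient field_simps)
      then show ?case using \<open>x + y \<noteq> 0\<close> by (simp add: field_simps)
    qed
    have "poly f \<in> borel_measurable borel" for f :: "real poly"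
      by (intro borel_measurable_continuous_onI continuous_intros)
    then show "(\<lambda>x. poly f x * (1 / (x + y))) \<in> borel_measurable \<mu>"
      "(\<lambda>x. poly (synthetic_div f (- y)) x + poly f (- y) * (1 / (x + y))) \<in> borel_measurable \<mu>"
      unfolding borel_measurable_M by (auto intro!: borel_measurable_add borel_measurable_times)
  qed
  also have "\<dots> = L (synthetic_div f (- y)) + poly f (- y) * (\<integral>x. 1 / (x + y) \<partial>\<mu>)"
    using ip int integral_poly[OF \<mu>(1), of "synthetic_div f (- y)"]
    by (subst Bochner_Integration.integral_add) (auto intro: integrable_mult_right simp del: times_divide_eq_right)
  finally show "(\<integral>x. poly f x * (1 / (x + y)) \<partial>\<mu>)
      = L (synthetic_div f (- y)) + poly f (- y) * (\<integral>x. 1 / (x + y) \<partial>\<mu>)" .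
qed

text \<open>Each polynomial that is nonnegative on the half-line yields a linear inequality for the
  transform at -y; P_n^2 and x K_n^2, with K_n the kernel at 0, yield the two bounds that
  follow.\<close>

lemma nonneg_poly_kernel_bound:
  assumes \<mu>: "has_moments \<mu> s" "AE x in \<mu>. x \<ge> 0" and y: "y > 0" and f: "\<And>x. x \<ge> 0 \<Longrightarrow> poly f x \<ge> 0"
  shows "0 \<le> L (synthetic_div f (- y)) + poly f (- y) * (\<integral>x. 1 / (x + y) \<partial>\<mu>)"
  unfolding integral_poly_times_real_kernel(2)[OF \<mu> y, symmetric]
proof (rule integral_nonneg_AE)
  show "AE x in \<mu>. 0 \<le> poly f x * (1 / (x + y))"
    using \<mu>(2) by eventually_elim (use y f in auto)
qed

lemma kernel_negative_ge:
  assumes "y > 0" "n > 0"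
  shows "poly (kernel n) (- y) \<ge> 1"
proof -
  have "p 0 0 * p 0 (- y) \<le> (\<Sum>k<n. p k 0 * p k (- y))"
    using assms p_same_sign[OF assms(1)] by (intro member_le_sum) (auto intro: less_imp_le)
  then show ?thesis by (simp add: poly_kernel)
qed

text \<open>Tested with P_n^2. By the Leibniz rule its divided difference contributes p_n(-y)
  q_n(-y), the other term being orthogonal to P_n.\<close>

lemma stieltjes_lower_bound:
  assumes \<mu>: "has_moments \<mu> s" "AE x in \<mu>. x \<ge> 0" and y: "y > 0" and n: "n > 0"
  shows "- q n (- y) / p n (- y) \<le> (\<integral>x. 1 / (x + y) \<partial>\<mu>)"
proof -
  let ?w = "\<integral>x. 1 / (x + y) \<partial>\<mu>" and ?S = "synthetic_div (P n) (- y)"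
  have "0 \<le> L (synthetic_div (P n * P n) (- y)) + poly (P n * P n) (- y) * ?w"
    by (rule nonneg_poly_kernel_bound[OF \<mu> y]) simp
  also have "L (synthetic_div (P n * P n) (- y)) = L (?S * P n) + p n (- y) * q n (- y)"
    unfolding synthetic_div_mult moment_functional_add moment_functional_smult mult.commute[of "P n" ?S]
    by (simp add: p_real op_q_def)
  also have "L (?S * P n) = 0"
    using orthogonal_lower_degree[of ?S n] n by (simp add: degree_synthetic_div)
  finally have "0 \<le> p n (- y) * (q n (- y) + p n (- y) * ?w)" by (simp add: p_real algebra_simps)
  then have "0 \<le> (p n (- y) * (q n (- y) + p n (- y) * ?w)) / (p n (- y))\<^sup>2" by simp
  also have "\<dots> = q n (- y) / p n (- y) + ?w"
    using p_nonpos_nonzero[of "- y" n] y by (simp add: power2_eq_square add_divide_distrib)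
  finally show ?thesis by simp
qed

text \<open>Tested with x K_n^2, as for a quadrature with a prescribed node at 0. x K_n is the
  truncation of D, and the functional of its divided difference is that of C.\<close>

lemma stieltjes_upper_bound:
  assumes \<mu>: "has_moments \<mu> s" "AE x in \<mu>. x \<ge> 0" and y: "y > 0" and n: "n > 0"
  shows "(\<integral>x. 1 / (x + y) \<partial>\<mu>) \<le> - C_part n (- y) / D_part n (- y)"
proof -
  let ?w = "\<integral>x. 1 / (x + y) \<partial>\<mu>" and ?K = "kernel n" and ?S = "synthetic_div (kernel n) (- y)"
  have K: "poly ?K (- y) \<ge> 1" by (rule kernel_negative_ge[OF y n])
  have "0 \<le> L (synthetic_div (pCons 0 ?K * ?K) (- y)) + poly (pCons 0 ?K * ?K) (- y) * ?w"
    by (rule nonneg_poly_kernel_bound[OF \<mu> y]) (simp add: mult.assoc)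
  also have "L (synthetic_div (pCons 0 ?K * ?K) (- y))
      = L (pCons 0 ?K * ?S) + poly ?K (- y) * L (synthetic_div (pCons 0 ?K) (- y))"
    unfolding synthetic_div_mult by (simp only: moment_functional_add moment_functional_smult)
  \<comment> \<open>With the factor x moved to the divided difference, the kernel evaluates a
    polynomial that vanishes at 0.\<close>
  also have "L (pCons 0 ?K * ?S) = L (?K * pCons 0 ?S)" by simp
  also have "L (?K * pCons 0 ?S) = 0"
  proof -
    have "degree (pCons 0 ?S) < n"
    proof (cases "?S = 0")
      case False
      then have "degree ?K \<noteq> 0" by (simp add: synthetic_div_eq_0_iff)
      then show ?thesis using False degree_kernel[OF n] by (simp add: degree_synthetic_div)
    qed (use n in simp)
    from kernel_reproducing[OF this] show ?thesis by simp
  qed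
  also have "synthetic_div (pCons 0 ?K) (- y) = ?K + smult (- y) ?S"
    unfolding synthetic_div_pCons by (rule synthetic_div_correct[symmetric])
  also have "L (?K + smult (- y) ?S) = C_part n (- y)"
  proof -
    have "L ?K = 1" using kernel_reproducing[of 1 n] n by simp
    moreover have "L ?S = (\<Sum>k<n. p k 0 * q k (- y))"
      by (simp add: kernel_def moment_functional_synthetic_div_sum op_q_def)
    ultimately show ?thesis
      by (simp add: moment_functional_add moment_functional_smult C_part_def moment_functional_diff)
  qed
  also have "poly (pCons 0 ?K * ?K) (- y) = D_part n (- y) * poly ?K (- y)"
    by (simp add: D_part_kernel)
  finally have "0 \<le> poly ?K (- y) * (C_part n (- y) + D_part n (- y) * ?w)" by (simp add: algebra_simps)
  then have "0 \<le> C_part n (- y) + D_part n (- y) * ?w" using K by (simp add: zero_le_mult_iff)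
  moreover have "D_part n (- y) < 0" using K y by (simp add: D_part_kernel)
  ultimately show ?thesis by (simp add: neg_le_divide_eq field_simps)
qed

text \<open>Both bounds are Moebius images -(A + \<tau> C)/(B + \<tau> D), with \<tau> = \<infinity>
  and \<tau> = c_n, so the determinant identity makes their difference 1/(D (B + c_n D)). The two
  factors are negative, of modulus at least y and 1 + y c_n.\<close>

lemma stieltjes_gap:
  assumes \<mu>: "has_moments \<mu> s" "AE x in \<mu>. x \<ge> 0" and \<nu>: "has_moments \<nu> s" "AE x in \<nu>. x \<ge> 0"
    and y: "y > 0" and n: "n > 0"
  shows "(\<integral>x. 1 / (x + y) \<partial>\<mu>) - (\<integral>x. 1 / (x + y) \<partial>\<nu>) \<le> 1 / (y * (1 + y * c n))"
proof -
  define A B C D where "A = A_part n (- y)" and "B = B_part n (- y)" and "C = C_part n (- y)" and "D = D_part n (- y)"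
  have p0: "p n (0::real) \<noteq> 0" using p_nonpos_nonzero[of 0 n] by simp
  have D: "D \<le> - y"
    using kernel_negative_ge[OF y n] y mult_left_mono[of 1 "poly (kernel n) (- y)" y] by (simp add: D_def D_part_kernel)
  have BD: "B + c n * D \<le> - (1 + y * c n)"
  proof -
    \<comment> \<open>Since q_k(0) = - c_k p_k(0), every term carries the factor c_n - c_k \<ge> 0;
      the term k = 0 alone contributes y c_n.\<close>
    have "B + c n * D = - 1 - y * (\<Sum>k<n. (c n - c k) * (p k 0 * p k (- y)))"
      by (simp add: B_def D_def B_part_def D_part_def q_0_eq sum_distrib_left sum_negf algebra_simps sum_subtractf)
    moreover have "(c n - c 0) * (p 0 0 * p 0 (- y)) \<le> (\<Sum>k<n. (c n - c k) * (p k 0 * p k (- y)))"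
    proof (rule member_le_sum)
      show "0 \<le> (c n - c k) * (p k 0 * p k (- y))" if "k \<in> {..<n} - {0}" for k
        by (rule mult_nonneg_nonneg) (use that c_le[of k n] less_imp_le[OF p_same_sign[OF y, of k]] in auto)
    qed (use n in auto)
    then have "y * c n \<le> y * (\<Sum>k<n. (c n - c k) * (p k 0 * p k (- y)))"
      using y by (intro mult_left_mono) (auto simp: c_0)
    ultimately show ?thesis by simp
  qed
  have BDneg: "B + c n * D < 0"
    using BD y c_nonneg[of n] mult_nonneg_nonneg[of y "c n"] by linarith
  have pn: "p n (- y) = - p n 0 * (B + c n * D)"
    using p_eq_BD[of n "- y"] by (simp add: B_def D_def q_0_eq algebra_simps)
  have qn: "q n (- y) = - p n 0 * (A + c n * C)"
    using q_eq_AC[of n "- y"] by (simp add: A_def C_def q_0_eq algebra_simps)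
  have det: "A * D - B * C = 1" unfolding A_def B_def C_def D_def by (rule det_part)
  have "(\<integral>x. 1 / (x + y) \<partial>\<mu>) - (\<integral>x. 1 / (x + y) \<partial>\<nu>) \<le> - C / D + q n (- y) / p n (- y)"
    using stieltjes_upper_bound[OF \<mu> y n] stieltjes_lower_bound[OF \<nu> y n] by (simp add: C_def D_def)
  also have "q n (- y) / p n (- y) = (A + c n * C) / (B + c n * D)"
    unfolding pn qn using p0 by simp
  also have "- C / D + (A + c n * C) / (B + c n * D) = (A * D - B * C) / (D * (B + c n * D))"
    using BDneg D y by (simp add: divide_simps) (simp add: algebra_simps)
  also have "\<dots> = 1 / (D * (B + c n * D))" by (simp add: det)
  also have "\<dots> \<le> 1 / (y * (1 + y * c n))"
  proof (rule frac_le)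
    have "y * (1 + y * c n) \<le> (- D) * (- (B + c n * D))"
      using D BD y c_nonneg[of n] by (intro mult_mono) auto
    then show "y * (1 + y * c n) \<le> D * (B + c n * D)" by (simp only: minus_mult_minus)
    show "0 < y * (1 + y * c n)" using y c_nonneg[of n] by (simp add: add_pos_nonneg)
  qed simp_all
  finally show ?thesis .
qed

text \<open>With c unbounded the gap closes at every -y, in both orders of the two measures.\<close>

lemma stieltjes_unique_if_c_unbounded:
  assumes \<mu>: "has_moments \<mu> s" "AE x in \<mu>. x \<ge> 0" and \<nu>: "has_moments \<nu> s" "AE x in \<nu>. x \<ge> 0"
    and unb: "\<And>B. \<exists>n. c n > B"
  shows "\<mu> = \<nu>"
proof (rule stieltjes_transform_unique_negative)
  show "finite_borel_measure \<mu>" "finite_borel_measure \<nu>"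
    using \<mu>(1) \<nu>(1) by (auto intro: has_moments_finite_borel_measure)
  fix y :: real assume y: "y > 0"
  have le: "(\<integral>x. 1 / (x + y) \<partial>\<mu>) \<le> (\<integral>x. 1 / (x + y) \<partial>\<nu>)"
    if \<mu>: "has_moments \<mu> s" "AE x in \<mu>. x \<ge> 0" and \<nu>: "has_moments \<nu> s" "AE x in \<nu>. x \<ge> 0" for \<mu> \<nu>
  proof (rule field_le_epsilon)
    fix e :: real assume e: "e > 0"
    obtain n where n: "c n > 1 / (y * y * e)" using unb by blast
    moreover have "0 < 1 / (y * y * e)" using y e by simp
    ultimately have cn: "c n > 0" by linarith
    then have "n > 0" using c_0 by (cases n) auto
    have "1 < c n * (y * y * e)" using n y e by (simp add: pos_divide_less_eq)
    also have "\<dots> \<le> e * (y * (1 + y * c n))" using y e by (simp add: algebra_simps)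
    finally have "1 / (y * (1 + y * c n)) < e"
      using y cn by (simp add: pos_divide_less_eq add_pos_pos)
    with stieltjes_gap[OF \<mu> \<nu> y \<open>n > 0\<close>]
    show "(\<integral>x. 1 / (x + y) \<partial>\<mu>) \<le> (\<integral>x. 1 / (x + y) \<partial>\<nu>) + e" by simp
  qed
  have tr: "stieltjes_transform \<mu> (of_real (- y)) = of_real (\<integral>x. 1 / (x + y) \<partial>\<mu>)" for \<mu>
  proof -
    have "stieltjes_transform \<mu> (of_real (- y)) = (\<integral>x. complex_of_real (1 / (x + y)) \<partial>\<mu>)"
      by (simp add: stieltjes_transform_def)
    then show ?thesis by (simp only: integral_complex_of_real)
  qed
  show "stieltjes_transform \<mu> (of_real (- y)) = stieltjes_transform \<nu> (of_real (- y))"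
    unfolding tr using le[OF \<mu> \<nu>] le[OF \<nu> \<mu>] by simp
qed (use \<mu> \<nu> in auto)

end

text \<open>Two solutions on the half-line force c to be bounded, hence convergent;
  \<open>stieltjes_alpha\<close> is the limit of -1/c_n.\<close>

lemma indetS_c_limit:
  assumes "indetS s" "s 0 = 1"
  obtains F where "stieltjes_positive_definite s" "F > 0" "friedrichs_parameter s = ereal F"
    "stieltjes_positive_definite.c s \<longlonglongrightarrow> F" "\<And>n. stieltjes_positive_definite.c s n \<le> F"
proof -
  obtain \<mu> \<nu> where sol: "\<mu> \<in> stieltjes_solutions s" "\<nu> \<in> stieltjes_solutions s" "\<mu> \<noteq> \<nu>"
    using assms(1) by (auto simp: indetS_def)
  interpret stieltjes_positive_definite s by (rule stieltjes_solutions_positive_definite[OF sol(1) assms(2)])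
  have "\<exists>B. \<forall>n. c n \<le> B"
  proof (rule ccontr)
    assume "\<not> ?thesis"
    then have "\<exists>n. c n > B" for B by (simp add: not_le)
    then have "\<mu> = \<nu>"
      using sol(1,2) AE_nonneg_of_stieltjes_solution
      by (intro stieltjes_unique_if_c_unbounded) (auto simp: stieltjes_solutions_def intro: solutions_has_moments)
    with sol(3) show False by simp
  qed
  then obtain B where B: "\<forall>n. c n \<le> B" by blast
  have "incseq c" using c_le by (simp add: incseq_def)
  from incseq_convergent[OF this B] obtain F where F: "c \<longlonglongrightarrow> F" "\<forall>n. c n \<le> F" .
  have F0: "F > 0" using F(2)[rule_format, of 1] c_pos[of 1] by simp
  have "(\<lambda>n. - 1 / c n) \<longlonglongrightarrow> - 1 / F" using F(1) F0 by (intro tendsto_intros) auto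
  \<comment> \<open>For n = 0 both sides are 0, as quotients by 0.\<close>
  moreover have "- 1 / c n = p n 0 / q n (0::real)" for n by (simp add: c_def)
  ultimately have "stieltjes_alpha s = - 1 / F" unfolding stieltjes_alpha_def by (simp add: limI)
  then have "friedrichs_parameter s = ereal F" using F0 by (simp add: friedrichs_parameter_def)
  then show ?thesis using that[OF stieltjes_positive_definite_axioms F0] F by blast
qed

section \<open>Operations on measures\<close>

lemma sets_add_measure [simp]: "sets (add_measure M N) = sets M"
  by (simp add: add_measure_def)

lemma space_add_measure [simp]: "space (add_measure M N) = space M"
  by (simp add: add_measure_def)

lemma sets_add_atom0 [simp]: "sets (add_atom0 c \<mu>) = sets borel"
  by (simp add: add_atom0_def)

lemma nn_integral_add_measure:
  assumes sets: "sets M = sets N" and f: "f \<in> borel_measurable M"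
  shows "nn_integral (add_measure M N) f = nn_integral M f + nn_integral N f"
proof -
  have sa: "sets (add_measure M N) = sets M" and sp: "space (add_measure M N) = space M"
    by simp_all
  have sp': "space N = space M" using sets_eq_imp_space_eq[OF sets] by simp
  have m: "g \<in> borel_measurable (add_measure M N) \<longleftrightarrow> g \<in> borel_measurable M"
    "g \<in> borel_measurable N \<longleftrightarrow> g \<in> borel_measurable M" for g :: "'a \<Rightarrow> ennreal"
    using measurable_cong_sets[OF sa refl] measurable_cong_sets[OF sets refl] by auto
  show ?thesis
    using f
  proof (induction rule: borel_measurable_induct)
    case (cong f g)
    have "nn_integral K f = nn_integral K g" if "space K = space M" for K
      using cong(3) that by (intro nn_integral_cong) simp
    then show ?case using cong(4) sp sp' by simp
  next
    case (set A)
    then show ?case using sets by (simp add: emeasure_add_measure sa)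
  next
    case (mult u c)
    then show ?case by (simp add: nn_integral_cmult m distrib_left)
  next
    case (add u v)
    then show ?case by (simp add: nn_integral_add m add_ac)
  next
    case (seq U)
    have mono: "incseq (\<lambda>i. nn_integral K (U i))" for K
      using \<open>incseq U\<close> by (auto simp: incseq_def le_fun_def intro!: nn_integral_mono)
    have "(SUP i. nn_integral M (U i) + nn_integral N (U i)) = (SUP i. nn_integral M (U i)) + (SUP i. nn_integral N (U i))"
      by (rule ennreal_SUP_add[OF mono mono])
    then show ?case
      using seq unfolding SUP_apply[abs_def]
      by (simp add: nn_integral_monotone_convergence_SUP m)
  qed
qed

lemma
  fixes f :: "'a \<Rightarrow> real"
  assumes sets: "sets M = sets N" and M: "integrable M f" and N: "integrable N f"
  shows integrable_add_measure: "integrable (add_measure M N) f"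
    and integral_add_measure: "(\<integral>x. f x \<partial>add_measure M N) = (\<integral>x. f x \<partial>M) + (\<integral>x. f x \<partial>N)"
proof -
  have sa: "sets (add_measure M N) = sets M" by simp
  have fM: "f \<in> borel_measurable M" using M by simp
  have fA: "f \<in> borel_measurable (add_measure M N)"
    using fM measurable_cong_sets[OF sa refl] by auto
  have nn: "(\<integral>\<^sup>+x. ennreal (g x) \<partial>add_measure M N) = (\<integral>\<^sup>+x. ennreal (g x) \<partial>M) + (\<integral>\<^sup>+x. ennreal (g x) \<partial>N)"
    if "g \<in> borel_measurable M" for g :: "'a \<Rightarrow> real"
    using that by (intro nn_integral_add_measure sets) simp
  show I: "integrable (add_measure M N) f"
    using M N fM fA nn[of "\<lambda>x. norm (f x)"] by (simp add: integrable_iff_bounded ennreal_add_less_top)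
  have fin: "(\<integral>\<^sup>+x. ennreal (f x) \<partial>K) < \<infinity> \<and> (\<integral>\<^sup>+x. ennreal (- f x) \<partial>K) < \<infinity>" if "integrable K f" for K :: "'a measure"
    using that by (simp add: real_integrable_def less_top)
  show "(\<integral>x. f x \<partial>add_measure M N) = (\<integral>x. f x \<partial>M) + (\<integral>x. f x \<partial>N)"
    using fin[OF M] fin[OF N] nn[of f] nn[of "\<lambda>x. - f x"] fM
    by (simp add: real_lebesgue_integral_def[OF M] real_lebesgue_integral_def[OF N] real_lebesgue_integral_def[OF I] enn2real_plus)
qed

lemma scale_measure_eq_density: "scale_measure (ennreal c) M = density M (\<lambda>_. ennreal c)"
  by (rule measure_eqI) (simp_all add: emeasure_density_const)

lemma integrable_scale_measure:
  fixes f :: "'a \<Rightarrow> 'b::{banach, second_countable_topology}"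
  assumes "c \<ge> 0" "integrable M f"
  shows "integrable (scale_measure (ennreal c) M) f"
  unfolding scale_measure_eq_density using assms by (subst integrable_density) auto

lemma integral_scale_measure:
  fixes f :: "'a \<Rightarrow> 'b::{banach, second_countable_topology}"
  assumes "c \<ge> 0" "f \<in> borel_measurable M"
  shows "(\<integral>x. f x \<partial>scale_measure (ennreal c) M) = c *\<^sub>R (\<integral>x. f x \<partial>M)"
  unfolding scale_measure_eq_density using assms by (subst integral_density) auto

lemma has_moments_scale:
  assumes "has_moments \<mu> s" "c \<ge> 0"
  shows "has_moments (scale_measure (ennreal c) \<mu>) (\<lambda>n. c * s n)"
proof -
  have "(\<lambda>x::real. x ^ n) \<in> borel_measurable \<mu>" for n
    unfolding finite_borel_measure.borel_measurable_M[OF has_moments_finite_borel_measure[OF assms(1)]]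
    by measurable
  then show ?thesis
    using assms by (auto simp: has_moments_def integral_scale_measure intro!: integrable_scale_measure)
qed

lemma stieltjes_transform_scale:
  assumes "has_moments \<mu> s" "c \<ge> 0"
  shows "stieltjes_transform (scale_measure (ennreal c) \<mu>) z = of_real c * stieltjes_transform \<mu> z"
proof -
  have "(\<lambda>x. 1 / (complex_of_real x - z)) \<in> borel_measurable \<mu>"
    unfolding finite_borel_measure.borel_measurable_M[OF has_moments_finite_borel_measure[OF assms(1)]]
    by measurable
  then show ?thesis
    using assms(2) by (simp add: stieltjes_transform_def integral_scale_measure scaleR_conv_of_real)
qed

lemma has_moments_add_atom0:
  assumes "has_moments \<mu> s" "c \<ge> 0"
  shows "has_moments (add_atom0 c \<mu>) (\<lambda>n. (if n = 0 then c else 0) + s n)"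
proof -
  let ?\<delta> = "scale_measure (ennreal c) (return borel (0::real))"
  have sets: "sets ?\<delta> = sets \<mu>" using assms by (simp add: has_moments_def)
  have int\<delta>: "integrable ?\<delta> (\<lambda>x. x ^ n)" for n
  proof (rule integrable_scale_measure[OF assms(2)])
    interpret prob_space "return borel (0::real)" by (rule prob_space_return) simp
    show "integrable (return borel (0::real)) (\<lambda>x. x ^ n)"
      by (rule integrable_const_bound[where B = "\<bar>0 ^ n\<bar>"]) (simp_all add: AE_return)
  qed
  have I\<delta>: "(\<integral>x. x ^ n \<partial>?\<delta>) = (if n = 0 then c else 0)" for n
    using assms(2) by (subst integral_scale_measure) (auto simp: integral_return power_0_left)
  have "integrable \<mu> (\<lambda>x. x ^ n)" "(\<integral>x. x ^ n \<partial>\<mu>) = s n" for n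
    using assms by (auto simp: has_moments_def)
  then have "integrable (add_atom0 c \<mu>) (\<lambda>x. x ^ n)" "(\<integral>x. x ^ n \<partial>add_atom0 c \<mu>) = (if n = 0 then c else 0) + s n" for n
    unfolding add_atom0_def
    by (auto simp: integral_add_measure[OF sets int\<delta>] I\<delta> intro!: integrable_add_measure[OF sets int\<delta>])
  then show ?thesis by (simp add: has_moments_def)
qed

lemma emeasure_add_atom0:
  assumes "sets \<mu> = sets borel" "X \<in> sets borel"
  shows "emeasure (add_atom0 c \<mu>) X = ennreal c * indicator X 0 + emeasure \<mu> X"
  unfolding add_atom0_def using assms
  by (subst emeasure_add_measure) (auto simp: emeasure_return)

lemma AE_nonneg_iff:
  fixes \<mu> :: "real measure"
  assumes "sets \<mu> = sets borel"
  shows "(AE x in \<mu>. x \<ge> 0) \<longleftrightarrow> emeasure \<mu> {..<0} = 0"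
proof -
  have "{x \<in> space \<mu>. \<not> x \<ge> 0} = {..<0}" using sets_eq_imp_space_eq[OF assms] by auto
  moreover have "{..<0::real} \<in> sets \<mu>" using assms by simp
  ultimately show ?thesis using AE_iff_measurable[of "{..<0}" \<mu> "\<lambda>x. x \<ge> 0"] by simp
qed

lemma AE_nonneg_add_atom0:
  assumes "sets \<mu> = sets borel" "AE x in \<mu>. x \<ge> 0"
  shows "AE x in add_atom0 c \<mu>. x \<ge> 0"
  using assms AE_nonneg_iff[of \<mu>] by (simp add: AE_nonneg_iff emeasure_add_atom0)

lemma measure_add_atom0:
  assumes "has_moments \<mu> s" "c \<ge> 0"
  shows "measure (add_atom0 c \<mu>) {0} = c + measure \<mu> {0}"
proof -
  interpret finite_borel_measure \<mu> using has_moments_finite_borel_measure[OF assms(1)] .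
  have "emeasure (add_atom0 c \<mu>) {0} = ennreal c + ennreal (measure \<mu> {0})"
    using assms by (subst emeasure_add_atom0) (auto simp: M_is_borel emeasure_eq_measure)
  then show ?thesis using assms(2) by (simp add: measure_def flip: ennreal_plus)
qed

section \<open>Rescaling to total mass 1\<close>

lemma normalized_measure_eq:
  assumes "has_moments \<mu> s" "s 0 > 0"
  shows "normalized_measure \<mu> = scale_measure (ennreal (1 / s 0)) \<mu>"
proof -
  interpret finite_borel_measure \<mu> using has_moments_finite_borel_measure[OF assms(1)] .
  have "emeasure \<mu> (space \<mu>) = ennreal (s 0)"
    using has_moments_mass[OF assms(1)] by (simp add: emeasure_eq_measure)
  then show ?thesis
    using assms(2) by (simp add: normalized_measure_def inverse_ennreal inverse_eq_divide)
qed

lemma has_moments_normalized_measure: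
  assumes "has_moments \<mu> s" "s 0 > 0"
  shows "has_moments (normalized_measure \<mu>) (normalized_seq s)"
  using has_moments_scale[OF assms(1), of "1 / s 0"] assms(2)
  by (simp add: normalized_measure_eq[OF assms] normalized_seq_def[abs_def])

lemma scale_normalized_measure:
  assumes "has_moments \<mu> s" "s 0 > 0"
  shows "scale_measure (ennreal (s 0)) (normalized_measure \<mu>) = \<mu>"
  using assms(2) by (simp add: normalized_measure_eq[OF assms] flip: ennreal_mult)

lemma AE_scale_measure:
  assumes "c > 0"
  shows "(AE x in scale_measure (ennreal c) M. P x) \<longleftrightarrow> (AE x in M. P x)"
  unfolding scale_measure_eq_density using assms by (subst AE_density) auto

lemma positive_definite_normalized_seq:
  assumes "positive_definite s" "s 0 > 0"
  shows "positive_definite (normalized_seq s)"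
  using assms moment_functional_divide[of s "s 0", where ?'a = real]
  by (simp add: positive_definite_def normalized_seq_def[abs_def])

lemma solutions_mass_pos:
  assumes "\<mu> \<in> solutions s"
  shows "s 0 > 0"
  using solutions_positive_definite[OF assms, unfolded positive_definite_def, rule_format, of "[:1:]"]
  by simp

lemma normalized_measure_solution:
  assumes "\<mu> \<in> solutions s"
  shows "normalized_measure \<mu> \<in> solutions (normalized_seq s)"
  by (rule has_moments_solution[OF
        has_moments_normalized_measure[OF solutions_has_moments[OF assms] solutions_mass_pos[OF assms]]
        positive_definite_normalized_seq[OF solutions_positive_definite[OF assms] solutions_mass_pos[OF assms]]])

lemma normalized_measure_inj:
  assumes "\<mu> \<in> solutions s" "\<nu> \<in> solutions s" "normalized_measure \<mu> = normalized_measure \<nu>"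
  shows "\<mu> = \<nu>"
proof -
  have "\<mu> = scale_measure (ennreal (s 0)) (normalized_measure \<mu>)"
    by (rule scale_normalized_measure[OF solutions_has_moments[OF assms(1)] solutions_mass_pos[OF assms(1)], symmetric])
  also have "\<dots> = scale_measure (ennreal (s 0)) (normalized_measure \<nu>)" by (simp only: assms(3))
  also have "\<dots> = \<nu>"
    by (rule scale_normalized_measure[OF solutions_has_moments[OF assms(2)] solutions_mass_pos[OF assms(2)]])
  finally show ?thesis .
qed

lemma indeterminate_normalized_seq:
  assumes "indeterminate s"
  shows "indeterminate (normalized_seq s)"
proof -
  obtain \<mu> \<nu> where sol: "\<mu> \<in> solutions s" "\<nu> \<in> solutions s" "\<mu> \<noteq> \<nu>"
    using assms unfolding indeterminate_def determinate_def by blast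
  then have "normalized_measure \<mu> \<noteq> normalized_measure \<nu>" using normalized_measure_inj by blast
  then show ?thesis
    using normalized_measure_solution[OF sol(1)] normalized_measure_solution[OF sol(2)]
    unfolding indeterminate_def determinate_def by blast
qed

lemma indetS_normalized_seq:
  assumes "indetS s"
  shows "indetS (normalized_seq s)"
proof -
  obtain \<mu> \<nu> where sol: "\<mu> \<in> stieltjes_solutions s" "\<nu> \<in> stieltjes_solutions s" "\<mu> \<noteq> \<nu>"
    using assms by (auto simp: indetS_def)
  have St: "normalized_measure \<rho> \<in> stieltjes_solutions (normalized_seq s)" if "\<rho> \<in> stieltjes_solutions s" for \<rho>
  proof (rule has_moments_stieltjes_solution)
    have \<rho>: "\<rho> \<in> solutions s" using that by (simp add: stieltjes_solutions_def)
    note hm = solutions_has_moments[OF \<rho>] and m = solutions_mass_pos[OF \<rho>]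
    show "has_moments (normalized_measure \<rho>) (normalized_seq s)"
      by (rule has_moments_normalized_measure[OF hm m])
    show "positive_definite (normalized_seq s)"
      by (rule positive_definite_normalized_seq[OF solutions_positive_definite[OF \<rho>] m])
    show "AE x in normalized_measure \<rho>. 0 \<le> x"
      unfolding normalized_measure_eq[OF hm m] using AE_nonneg_of_stieltjes_solution[OF that] m
      by (simp add: AE_scale_measure)
  qed
  have "normalized_measure \<mu> \<noteq> normalized_measure \<nu>"
    using sol normalized_measure_inj by (auto simp: stieltjes_solutions_def)
  then show ?thesis
    using St[OF sol(1)] St[OF sol(2)] indeterminate_normalized_seq[of s] assms
    unfolding indetS_def indet_stieltjes_def by blast
qed

lemma indeterminateI:
  assumes "\<mu> \<in> solutions s" "\<nu> \<in> solutions s" "\<mu> \<noteq> \<nu>"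
  shows "indeterminate s"
  using assms unfolding indeterminate_def determinate_def by blast

lemma indetSI:
  assumes "\<mu> \<in> stieltjes_solutions s" "\<nu> \<in> stieltjes_solutions s" "\<mu> \<noteq> \<nu>"
  shows "indetS s"
  using assms indeterminateI[of \<mu> s \<nu>]
  unfolding indetS_def indet_stieltjes_def by (auto simp: stieltjes_solutions_def)

text \<open>In x/(x - z) = 1 + z/(x - z) the constant integrates to the total mass t. An atom of
  \<sigma> at 0 is lost in x d\<sigma>(x), hence the condition for recovering \<sigma>.\<close>

lemma
  assumes \<sigma>: "has_moments \<sigma> (shifted_seq s t)" "AE x in \<sigma>. x \<ge> 0"
  defines "\<mu> \<equiv> density \<sigma> (\<lambda>x. ennreal x)"
  shows has_moments_x_density: "has_moments \<mu> s"
    and stieltjes_transform_x_density: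
      "z \<notin> \<real> \<Longrightarrow> stieltjes_transform \<mu> z = of_real t + z * stieltjes_transform \<sigma> z"
    and inv_x_measure_x_density: "measure \<sigma> {0} = 0 \<Longrightarrow> inv_x_measure \<mu> = \<sigma>"
proof -
  interpret finite_borel_measure \<sigma> using has_moments_finite_borel_measure[OF \<sigma>(1)] .
  have id: "(\<lambda>x::real. x) \<in> borel_measurable \<sigma>" unfolding borel_measurable_M by measurable
  have pw: "(\<lambda>x::real. x ^ n) \<in> borel_measurable \<sigma>" for n unfolding borel_measurable_M by measurable
  have ck: "(\<lambda>x. 1 / (complex_of_real x - z)) \<in> borel_measurable \<sigma>" for z
    unfolding borel_measurable_M by measurable
  have int: "integrable \<sigma> (\<lambda>x. x ^ n)" and mom: "(\<integral>x. x ^ n \<partial>\<sigma>) = shifted_seq s t n" for n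
    using \<sigma>(1) by (auto simp: has_moments_def)
  show "has_moments \<mu> s"
    unfolding has_moments_def
  proof (intro conjI allI)
    show "sets \<mu> = sets borel" by (simp add: \<mu>_def M_is_borel)
    fix n
    show "integrable \<mu> (\<lambda>x. x ^ n)"
      unfolding \<mu>_def integrable_density[OF pw id \<sigma>(2)] using int[of "Suc n"] by simp
    have "(\<integral>x. x ^ n \<partial>\<mu>) = (\<integral>x. x ^ Suc n \<partial>\<sigma>)"
      unfolding \<mu>_def integral_density[OF pw id \<sigma>(2)] by simp
    then show "(\<integral>x. x ^ n \<partial>\<mu>) = s n" by (simp only: mom) (simp add: shifted_seq_def)
  qed
  show "stieltjes_transform \<mu> z = of_real t + z * stieltjes_transform \<sigma> z" if z: "z \<notin> \<real>"
  proof -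
    have "stieltjes_transform \<mu> z = (\<integral>x. x *\<^sub>R (1 / (complex_of_real x - z)) \<partial>\<sigma>)"
      unfolding stieltjes_transform_def \<mu>_def by (rule integral_density[OF ck id \<sigma>(2)])
    also have "\<dots> = (\<integral>x. 1 + z * (1 / (complex_of_real x - z)) \<partial>\<sigma>)"
    proof (intro Bochner_Integration.integral_cong refl)
      fix x
      have "complex_of_real x - z \<noteq> 0" using z by auto
      then show "x *\<^sub>R (1 / (complex_of_real x - z)) = 1 + z * (1 / (complex_of_real x - z))"
        by (simp add: scaleR_conv_of_real field_simps)
    qed
    also have "\<dots> = of_real (measure \<sigma> (space \<sigma>)) + z * stieltjes_transform \<sigma> z"
      unfolding stieltjes_transform_def using integrable_cauchy_kernel[OF z]
      by (subst Bochner_Integration.integral_add) (auto simp: scaleR_conv_of_real simp del: times_divide_eq_right intro: integrable_mult_right)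
    finally show ?thesis using has_moments_mass[OF \<sigma>(1)] by (simp add: shifted_seq_def)
  qed
  show "inv_x_measure \<mu> = \<sigma>" if "measure \<sigma> {0} = 0"
  proof -
    have "emeasure \<sigma> {0} = 0" using that by (simp add: emeasure_eq_measure)
    then have "{0} \<in> null_sets \<sigma>" by (simp add: null_sets_def M_is_borel)
    then have "AE x in \<sigma>. x \<notin> {0}" by (rule AE_not_in)
    with \<sigma>(2) have pos: "AE x in \<sigma>. x > 0" by eventually_elim auto
    have em: "(\<lambda>x::real. ennreal x) \<in> borel_measurable \<sigma>" using id by simp
    then have em': "(\<lambda>x::real. inverse (ennreal x)) \<in> borel_measurable \<sigma>" by simp
    have "inv_x_measure \<mu> = density \<sigma> (\<lambda>x. ennreal x * inverse (ennreal x))"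
      unfolding inv_x_measure_def \<mu>_def by (rule density_density_eq[OF em em'])
    also have "\<dots> = density \<sigma> (\<lambda>_. 1)"
    proof (rule density_cong)
      show "AE x in \<sigma>. ennreal x * inverse (ennreal x) = 1"
        using pos by eventually_elim (simp add: inverse_ennreal flip: ennreal_mult)
    qed (use em em' in auto)
    finally show ?thesis by (simp add: density_1)
  qed
qed

section \<open>Shifting the moment sequence\<close>

context stieltjes_positive_definite
begin

text \<open>The truncation of B + t D to n summands. If t bounds all c_n, it is up to a factor the
  orthonormal polynomial of degree n of the shifted sequence.\<close>

definition shifted_poly :: "real \<Rightarrow> nat \<Rightarrow> real poly" where
  "shifted_poly t n = pCons (- 1) (\<Sum>k<n. smult (q k 0 + t * p k 0) (P k))"

lemma degree_shifted_poly: "degree (shifted_poly t n) < Suc n"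
proof (cases "n = 0")
  case False
  then have "degree (\<Sum>k<n. smult (q k 0 + t * p k 0) (P k)) < n"
    by (intro degree_sum_less) (auto intro: le_less_trans[OF degree_smult_le])
  then show ?thesis unfolding shifted_poly_def by (intro le_less_trans[OF degree_pCons_le]) simp
qed (simp add: shifted_poly_def)

text \<open>The sum G represents the shifted functional: L(G g) is its value at g for every g of
  degree below n. The shifted functional of x G g is L(G g) as well, and the constant term -1 makes
  the two cancel.\<close>

lemma shifted_poly_orthogonal:
  assumes g: "degree g < n"
  shows "moment_functional (shifted_seq s t) (shifted_poly t n * g) = 0"
proof -
  define G where "G = (\<Sum>k<n. smult (q k 0 + t * p k 0) (P k))"
  obtain b h where bh: "g = pCons b h" by (cases g)
  have exp: "g = (\<Sum>k<n. smult (L (g * P k)) (P k))" using expansion[OF g] by simp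
  have "h = synthetic_div g 0"
    using synthetic_div_correct[of h 0] by (simp add: bh)
  then have Lh: "L h = (\<Sum>k<n. q k 0 * L (P k * g))"
    using moment_functional_synthetic_div_sum[of s "\<lambda>k. L (g * P k)" P "{..<n}" 0] exp
    by (simp add: op_q_def mult.commute)
  have "poly g 0 = (\<Sum>k<n. p k 0 * L (P k * g))"
    using kernel_reproducing[OF g]
    by (simp add: kernel_def sum_distrib_right moment_functional_sum moment_functional_smult)
  then have "b = (\<Sum>k<n. p k 0 * L (P k * g))" by (simp add: bh)
  with Lh have LG: "L (G * g) = L h + t * b"
    by (simp add: G_def sum_distrib_right sum_distrib_left moment_functional_sum moment_functional_smult
        distrib_right sum.distrib mult.assoc)
  have "shifted_poly t n * g = pCons 0 (G * g) - g"
    by (simp add: shifted_poly_def G_def)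
  then have "moment_functional (shifted_seq s t) (shifted_poly t n * g) = L (G * g) - (b * t + L h)"
    by (simp only: moment_functional_diff moment_functional_shifted_seq bh) simp
  then show ?thesis unfolding LG by simp
qed

text \<open>The truncation of t (B + t D) + (A + t C) is z times the polynomial of the second kind;
  keeping z as a factor makes the identity valid at z = 0.\<close>

lemma
  shows poly_shifted_poly: "poly (of_real_poly (shifted_poly t n)) z = B_part n z + of_real t * D_part n z"
    and second_kind_shifted_poly:
      "z * moment_functional (shifted_seq s t) (synthetic_div (of_real_poly (shifted_poly t n)) z)
        = of_real t * (B_part n z + of_real t * D_part n z) + (A_part n z + of_real t * C_part n z)"
proof -
  define G :: "'a poly" where "G = (\<Sum>k<n. smult (q k 0 + of_real t * p k 0) (of_real_poly (P k)))"
  have G: "of_real_poly (shifted_poly t n) = pCons (- 1) G"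
    by (simp add: shifted_poly_def G_def of_real_poly_pCons of_real_poly_sum of_real_poly_smult
        q_at_0[where 'a = 'a] p_at_0[where 'a = 'a])
  have Gz: "poly G z = (\<Sum>k<n. q k 0 * p k z) + of_real t * (\<Sum>k<n. p k 0 * p k z)"
    by (simp add: G_def poly_sum op_p_def[of _ _ z] distrib_right sum.distrib sum_distrib_left mult.assoc)
  have LG: "L (synthetic_div G z) = (\<Sum>k<n. q k 0 * q k z) + of_real t * (\<Sum>k<n. p k 0 * q k z)"
    by (simp add: G_def moment_functional_synthetic_div_sum op_q_def[of _ _ z] distrib_right sum.distrib sum_distrib_left mult.assoc)
  show 1: "poly (of_real_poly (shifted_poly t n)) z = B_part n z + of_real t * D_part n z"
    by (simp add: G Gz B_part_def D_part_def algebra_simps)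
  have "moment_functional (shifted_seq s t) (synthetic_div (pCons (- 1) G) z) = poly G z * of_real t + L (synthetic_div G z)"
    by (simp add: moment_functional_shifted_seq)
  then show "z * moment_functional (shifted_seq s t) (synthetic_div (of_real_poly (shifted_poly t n)) z)
        = of_real t * (B_part n z + of_real t * D_part n z) + (A_part n z + of_real t * C_part n z)"
    by (simp add: G Gz LG A_part_def B_part_def C_part_def D_part_def algebra_simps)
qed

lemma moment_functional_normalized_shifted:
  "moment_functional (normalized_seq (shifted_seq s t)) f = moment_functional (shifted_seq s t) f / of_real t"
  using moment_functional_divide[of "shifted_seq s t" t f]
  by (simp add: normalized_seq_def[abs_def] shifted_seq_def)

text \<open>Orthogonality leaves one term of the expansion, and the constant coefficient -1 excludes
  the factor 0.\<close>

lemma shifted_poly_proportional: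
  assumes t: "\<And>n. c n \<le> t"
  shows "\<exists>\<kappa>. \<kappa> \<noteq> 0 \<and> shifted_poly t n = smult \<kappa> (orthonormal_poly (normalized_seq (shifted_seq s t)) n)"
proof -
  interpret N: stieltjes_positive_definite "normalized_seq (shifted_seq s t)"
    by (rule shifted_positive_definite[OF t])
  define \<kappa> where "\<kappa> = N.L (shifted_poly t n * N.P n)"
  have "N.L (shifted_poly t n * N.P k) = 0" if "k < n" for k
    using shifted_poly_orthogonal[of "N.P k" n t] that by (simp add: moment_functional_normalized_shifted)
  then have "shifted_poly t n = smult \<kappa> (N.P n)"
    using N.expansion[OF degree_shifted_poly[of t n]] by (simp add: \<kappa>_def)
  moreover have "shifted_poly t n \<noteq> 0" by (simp add: shifted_poly_def)
  ultimately show ?thesis by (metis smult_0_left)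
qed

text \<open>If \<sigma> is a Gauss quadrature of the shifted problem, the transform of x
  d\<sigma>(x) is the truncated Nevanlinna quotient. The product form postpones the question of a
  zero denominator to the limit.\<close>

lemma shifted_quotient:
  fixes z :: complex
  assumes t: "\<And>n. c n \<le> t" and z: "z \<notin> \<real>"
  defines "s2 \<equiv> normalized_seq (shifted_seq s t)"
  shows "- (A_part n z + of_real t * C_part n z)
      = (of_real t + z * (of_real t * (- op_q s2 n z / op_p s2 n z))) * (B_part n z + of_real t * D_part n z)"
proof -
  interpret N: stieltjes_positive_definite s2
    unfolding s2_def by (rule shifted_positive_definite[OF t])
  obtain \<kappa> where \<kappa>: "\<kappa> \<noteq> 0" "shifted_poly t n = smult \<kappa> (N.P n)"
    using shifted_poly_proportional[OF t] unfolding s2_def by blast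
  have t0: "t > 0" by (rule shifted_positive_definite[OF t])
  have pz: "N.p n z \<noteq> 0"
    using N.root_P_positive[of n z] z unfolding op_p_def by (metis Reals_of_real)
  have E: "of_real \<kappa> * N.p n z = B_part n z + of_real t * D_part n z"
    using poly_shifted_poly[of t n z] unfolding \<kappa>(2) by (simp add: of_real_poly_smult op_p_def)
  have "moment_functional (shifted_seq s t) (synthetic_div (of_real_poly (shifted_poly t n)) z)
      = of_real t * (of_real \<kappa> * N.q n z)"
    unfolding \<kappa>(2) using t0
    by (simp add: of_real_poly_smult synthetic_div_smult moment_functional_smult op_q_def s2_def moment_functional_normalized_shifted)
  then have "z * (of_real t * (of_real \<kappa> * N.q n z))
      = of_real t * (of_real \<kappa> * N.p n z) + (A_part n z + of_real t * C_part n z)"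
    using second_kind_shifted_poly[of z t n] unfolding E by simp
  then have "- (A_part n z + of_real t * C_part n z)
      = (of_real t + z * (of_real t * (- N.q n z / N.p n z))) * (of_real \<kappa> * N.p n z)"
    using pz by (simp add: algebra_simps)
  then show ?thesis unfolding E .
qed

text \<open>The sum is the reciprocal of the least square norm with value 1 at 0, here (t - c_n)/t.
  The minimizer gives one inequality by \<open>evaluation_bound\<close>; the kernel of the shifted
  sequence, put into \<open>shifted_square_ge\<close>, gives the other. The minimizer has degree n,
  hence \<open>Suc n\<close> terms.\<close>

lemma shifted_kernel_sum:
  assumes t: "\<And>n. c n \<le> t" and n: "n > 0"
  shows "(\<Sum>k<Suc n. (op_p (normalized_seq (shifted_seq s t)) k (0::real))\<^sup>2) = t / (t - c n)"
proof -
  let ?s = "normalized_seq (shifted_seq s t)"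
  interpret N: stieltjes_positive_definite ?s
    by (rule shifted_positive_definite[OF t])
  have t0: "t > 0" by (rule shifted_positive_definite[OF t])
  have ct: "c n < t" using t[of "Suc n"] c_less[of n "Suc n"] by simp
  let ?S = "\<Sum>k<Suc n. (N.p k (0::real))\<^sup>2"
  let ?f = "smult (1 / p n 0) (P n)"
  have "(poly ?f 0)\<^sup>2 \<le> N.L (?f * ?f) * ?S"
    by (rule N.evaluation_bound) (use p_nonpos_nonzero[of 0 n] in simp)
  also have "N.L (?f * ?f) = (t - c n) / t"
    unfolding moment_functional_normalized_shifted shifted_min[OF n] by simp
  also have "poly ?f 0 = 1" using p_nonpos_nonzero[of 0 n] by (simp add: p_real)
  finally have lower: "1 \<le> (t - c n) / t * ?S" by simp
  have S0: "?S > 0"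
    using lower t0 ct by (smt (verit) divide_pos_pos mult_nonneg_nonpos)
  let ?K = "N.kernel (Suc n)"
  obtain a g where ag: "?K = pCons a g" by (cases ?K)
  have a: "a = ?S"
    using N.poly_kernel[of "Suc n" 0] by (simp add: ag power2_eq_square)
  have "degree g < n"
    using N.degree_kernel[of "Suc n"] n by (cases "g = 0") (auto simp: ag)
  from shifted_square_ge[OF this, of a t]
  have "a\<^sup>2 * (t - c n) \<le> moment_functional (shifted_seq s t) (?K * ?K)" by (simp only: ag)
  also have "\<dots> = t * N.L (?K * ?K)"
    using t0 unfolding moment_functional_normalized_shifted by simp
  also have "N.L (?K * ?K) = ?S" by (rule N.kernel_norm) simp
  finally have "?S * (?S * (t - c n)) \<le> ?S * t" by (simp add: a power2_eq_square mult_ac)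
  then have "?S * (t - c n) \<le> t" using S0 by simp
  moreover have "t \<le> (t - c n) * ?S" using lower t0 by (simp add: field_simps)
  ultimately show ?thesis using ct by (simp add: eq_divide_eq mult.commute)
qed

end

section \<open>Extremal solutions\<close>

lemma is_N_extremal_solution_unique:
  assumes "is_N_extremal_solution s t \<mu>" "is_N_extremal_solution s t \<nu>"
  shows "\<mu> = \<nu>"
proof (rule solutions_eqI)
  show "has_moments \<mu> s" "has_moments \<nu> s"
    using assms by (auto simp: is_N_extremal_solution_def intro: solutions_has_moments)
  show "stieltjes_transform \<mu> z = stieltjes_transform \<nu> z" if "z \<notin> \<real>" for z
    using assms that by (simp add: is_N_extremal_solution_def stieltjes_transform_def)
qed

lemma N_extremal_solution_eq:
  assumes "is_N_extremal_solution s t \<mu>"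
  shows "N_extremal_solution s t = \<mu>"
  unfolding N_extremal_solution_def
  using assms is_N_extremal_solution_unique by (metis the_equality)

context indeterminate_moments
begin

text \<open>The parameter may vary with k, as the parameter c_n does for the Friedrichs solution.
  The limiting denominator is nonzero: otherwise the numerator would vanish too, against
  \<open>nev_det\<close>.\<close>

lemma nev_quotient_limit:
  assumes r: "strict_mono r" and \<tau>: "\<tau> \<longlonglongrightarrow> t" and w: "w \<longlonglongrightarrow> l"
    and eq: "\<And>k. - (A_part (r k) z + of_real (\<tau> k) * C_part (r k) z)
         = w k * (B_part (r k) z + of_real (\<tau> k) * D_part (r k) z)"
  shows "l = nev_quotient s (ereal t) z"
proof -
  let ?A = "nev_A s z" and ?B = "nev_B s z" and ?C = "nev_C s z" and ?D = "nev_D s z"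
  note lim = A_part_tendsto[THEN LIMSEQ_subseq_LIMSEQ, OF r, unfolded comp_def]
    B_part_tendsto[THEN LIMSEQ_subseq_LIMSEQ, OF r, unfolded comp_def]
    C_part_tendsto[THEN LIMSEQ_subseq_LIMSEQ, OF r, unfolded comp_def]
    D_part_tendsto[THEN LIMSEQ_subseq_LIMSEQ, OF r, unfolded comp_def]
  have "(\<lambda>k. - (A_part (r k) z + of_real (\<tau> k) * C_part (r k) z)) \<longlonglongrightarrow> - (?A + of_real t * ?C)"
    by (intro tendsto_intros lim \<tau>)
  moreover have "(\<lambda>k. w k * (B_part (r k) z + of_real (\<tau> k) * D_part (r k) z)) \<longlonglongrightarrow> l * (?B + of_real t * ?D)"
    by (intro tendsto_intros lim \<tau> w)
  ultimately have l: "- (?A + of_real t * ?C) = l * (?B + of_real t * ?D)"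
    unfolding eq by (rule LIMSEQ_unique)
  have "?B + of_real t * ?D \<noteq> 0"
  proof
    assume 0: "?B + of_real t * ?D = 0"
    then have "- (?A + of_real t * ?C) = 0" using l by (simp only: mult_zero_right)
    then have "?A + of_real t * ?C = 0" by (simp only: neg_equal_0_iff_equal)
    moreover have "(?A + of_real t * ?C) * ?D - (?B + of_real t * ?D) * ?C = 1"
      using nev_det[of z] by (simp add: algebra_simps)
    ultimately show False using 0 by simp
  qed
  with l show ?thesis
    by (simp add: nev_quotient_def field_simps)
qed

text \<open>The transform has a finite limit at 0 along the imaginary axis, where an atom would
  produce a pole-like growth.\<close>

lemma atom_at_0_of_finite_parameter:
  assumes \<mu>: "is_N_extremal_solution s t \<mu>" and t: "t \<noteq> \<infinity>"
  shows "measure \<mu> {0} = 0"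
proof -
  have \<mu>': "\<mu> \<in> solutions s" "t \<noteq> -\<infinity>" and tr: "\<And>z. z \<notin> \<real> \<Longrightarrow> stieltjes_transform \<mu> z = nev_quotient s t z"
    using \<mu> by (auto simp: is_N_extremal_solution_def stieltjes_transform_def)
  interpret finite_borel_measure \<mu>
    using has_moments_finite_borel_measure[OF solutions_has_moments[OF \<mu>'(1)]] .
  define y where "y n = 1 / real (Suc n)" for n
  have "(\<lambda>n. nev_quotient s t (\<i> * of_real (y n))) \<longlonglongrightarrow> of_real (real_of_ereal t)"
    unfolding y_def by (rule nev_quotient_at_0[OF t \<mu>'(2)])
  moreover have "y \<longlonglongrightarrow> 0" unfolding y_def by real_asymp
  then have "(\<lambda>n. - (\<i> * complex_of_real (y n))) \<longlonglongrightarrow> - (\<i> * of_real 0)"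
    by (intro tendsto_intros)
  ultimately have "(\<lambda>n. - (\<i> * of_real (y n)) * nev_quotient s t (\<i> * of_real (y n))) \<longlonglongrightarrow> - (\<i> * of_real 0) * of_real (real_of_ereal t)"
    by (intro tendsto_mult)
  moreover have "\<i> * complex_of_real (y n) \<notin> \<real>" for n by (simp add: y_def Im_nonzero_iff)
  ultimately have "(\<lambda>n. - (\<i> * of_real (y n)) * stieltjes_transform \<mu> (\<i> * of_real (y n))) \<longlonglongrightarrow> 0"
    by (simp add: tr)
  with atom_at_0_eq_limit have "complex_of_real (measure \<mu> {0}) = 0"
    unfolding y_def by (rule LIMSEQ_unique)
  then show ?thesis by simp
qed

text \<open>When the atom at \<open>0\<close> has the maximal mass \<open>1 / \<Sum>p\<^sub>n(0)\<^sup>2\<close>, the reproducing kernels at \<open>0\<close> converge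
  in the mean to the multiple of the indicator of \<open>{0}\<close> with the same value at \<open>0\<close>.\<close>

lemma krein_of_maximal_atom:
  assumes ind: "indeterminate s" and \<mu>: "\<mu> \<in> solutions s" and m: "measure \<mu> {0} > 0"
    and lim: "(\<lambda>n. \<Sum>k<n. (p k (0::real))\<^sup>2) \<longlonglongrightarrow> 1 / measure \<mu> {0}"
  shows "is_N_extremal_solution s \<infinity> \<mu>"
proof -
  have hm: "has_moments \<mu> s" by (rule solutions_has_moments[OF \<mu>])
  interpret finite_borel_measure \<mu> by (rule has_moments_finite_borel_measure[OF hm])
  have one: "measure \<mu> (space \<mu>) = 1" using has_moments_mass[OF hm] s0 by simp
  define m where "m = measure \<mu> {0}"
  have m: "m > 0" using m by (simp add: m_def)
  \<comment> \<open>The height 1/m is the limit of the kernels at 0, and it makes the integral of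
    \<open>e\<close> equal to 1.\<close>
  define e where "e x = indicator {0} x / m" for x :: real
  define S where "S n = (\<Sum>k<n. (p k (0::real))\<^sup>2)" for n
  have em: "e \<in> borel_measurable borel" unfolding e_def[abs_def] by measurable
  have ie: "integrable \<mu> e"
    by (rule integrable_bounded_borel[OF em, where K = "1 / m"]) (use m in \<open>auto simp: e_def indicator_def\<close>)
  have iK: "integrable \<mu> (poly f)" and IK: "(\<integral>x. poly f x \<partial>\<mu>) = L f" for f :: "real poly"
    using integrable_poly[OF hm, of f] integral_poly[OF hm, of f] by simp_all
  define d where "d n x = poly (kernel n) x - e x" for n x
  have id: "integrable \<mu> (d n)" for n unfolding d_def by (intro Bochner_Integration.integrable_diff iK ie)
  \<comment> \<open>As \<open>e\<close> lives at 0, its product with the kernel is S_n e, and e^2 =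
    e/m.\<close>
  have d2: "(d n x)\<^sup>2 = poly (kernel n * kernel n) x + (1 / m - 2 * S n) * e x" for n x
  proof (cases "x = 0")
    case True
    then show ?thesis using m
      by (simp add: d_def e_def S_def poly_kernel power2_eq_square algebra_simps)
  qed (simp add: d_def e_def power2_eq_square)
  have id2: "integrable \<mu> (\<lambda>x. (d n x)\<^sup>2)" for n
    unfolding d2 by (intro Bochner_Integration.integrable_add integrable_mult_right iK ie)
  have Ie: "(\<integral>x. e x \<partial>\<mu>) = 1"
    using m by (simp add: e_def M_is_borel m_def)
  have Id2: "(\<integral>x. (d n x)\<^sup>2 \<partial>\<mu>) = 1 / m - S n" if "n > 0" for n
    unfolding d2 using iK ie IK Ie kernel_norm[OF that]
    by (subst Bochner_Integration.integral_add) (auto simp: S_def intro!: integrable_mult_right)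
  have small: "(\<integral>x. \<bar>d n x\<bar> \<partial>\<mu>)\<^sup>2 \<le> 1 / m - S n" if "n > 0" for n
  proof -
    define E where "E = (\<integral>x. \<bar>d n x\<bar> \<partial>\<mu>)"
    have ia: "integrable \<mu> (\<lambda>x. \<bar>d n x\<bar>)" using id by (rule integrable_abs)
    \<comment> \<open>Nonnegativity of a variance: with total mass 1 the mean square dominates the
      square of the mean.\<close>
    have "0 \<le> (\<integral>x. (\<bar>d n x\<bar> - E)\<^sup>2 \<partial>\<mu>)" by (rule Bochner_Integration.integral_nonneg) simp
    also have "\<dots> = (\<integral>x. (d n x)\<^sup>2 - 2 * E * \<bar>d n x\<bar> + E\<^sup>2 \<partial>\<mu>)"
      by (simp add: power2_diff algebra_simps)
    also have "\<dots> = (1 / m - S n) - 2 * E * E + E\<^sup>2"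
      using id2[of n] ia one Id2[OF that]
      by (subst Bochner_Integration.integral_add, simp, simp, subst Bochner_Integration.integral_diff) (auto simp: E_def)
    finally show ?thesis by (simp add: E_def power2_eq_square)
  qed
  have d0: "(\<lambda>n. \<integral>x. \<bar>d n x\<bar> \<partial>\<mu>) \<longlonglongrightarrow> 0"
  proof -
    have "(\<lambda>n. 1 / m - S n) \<longlonglongrightarrow> 1 / m - 1 / m"
      unfolding S_def by (intro tendsto_intros) (use lim in \<open>simp add: m_def\<close>)
    then have S: "(\<lambda>n. 1 / m - S n) \<longlonglongrightarrow> 0" by simp
    have "(\<lambda>n. (\<integral>x. \<bar>d n x\<bar> \<partial>\<mu>)\<^sup>2) \<longlonglongrightarrow> 0"
    proof (rule tendsto_sandwich[OF _ _ tendsto_const S])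
      show "\<forall>\<^sub>F n in sequentially. (\<integral>x. \<bar>d n x\<bar> \<partial>\<mu>)\<^sup>2 \<le> 1 / m - S n"
        using small by (intro eventually_sequentiallyI[of 1]) auto
    qed auto
    from tendsto_real_sqrt[OF this] show ?thesis by simp
  qed
  have tr: "stieltjes_transform \<mu> z = nev_quotient s \<infinity> z" if z: "z \<notin> \<real>" for z
  proof -
    let ?w = "stieltjes_transform \<mu> z" and ?f = "\<lambda>x. 1 / (complex_of_real x - z)"
    have z0: "z \<noteq> 0" using z by auto
    have ief: "integrable \<mu> (\<lambda>x. complex_of_real (e x) * ?f x)"
    proof (rule integrable_bounded_borel[where K = "1 / m * (1 / \<bar>Im z\<bar>)"])
      show "norm (complex_of_real (e x) * ?f x) \<le> 1 / m * (1 / \<bar>Im z\<bar>)" for x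
        unfolding norm_mult norm_of_real using m by (intro mult_mono norm_cauchy_kernel_le z) (auto simp: e_def indicator_def)
      show "(\<lambda>x. complex_of_real (e x) * ?f x) \<in> borel_measurable borel" using em by measurable
    qed
    have "(\<integral>x. complex_of_real (e x) * ?f x \<partial>\<mu>) = (\<integral>x. - (1 / z) * complex_of_real (e x) \<partial>\<mu>)"
      by (intro Bochner_Integration.integral_cong refl) (simp add: e_def indicator_def)
    also have "\<dots> = - (1 / z) * (\<integral>x. complex_of_real (e x) \<partial>\<mu>)" by (rule integral_mult_right_zero)
    also have "\<dots> = - (1 / z)" by (subst integral_of_real[OF ie]) (simp add: Ie)
    finally have Ief: "(\<integral>x. complex_of_real (e x) * ?f x \<partial>\<mu>) = - (1 / z)" .
    define J where "J n = (\<integral>x. complex_of_real (poly (kernel n) x) * ?f x \<partial>\<mu>)" for n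
    have Kf: "integrable \<mu> (\<lambda>x. complex_of_real (poly (kernel n) x) * ?f x)" for n
      using integral_poly_times_cauchy_kernel(1)[OF hm z, of "of_real_poly (kernel n)"]
      by (simp add: poly_of_real_poly_of_real)
    \<comment> \<open>z K_n(z) is the truncation of D, and the divided difference contributes that
      of C - 1. In the limit K_n is replaced by \<open>e\<close>, whose Cauchy integral is -1/z, and
      C + D w = 0 results.\<close>
    have J: "z * J n = (C_part n z - 1) + D_part n z * ?w" for n
    proof -
      have ck: "of_real_poly (kernel n) = (\<Sum>k<n. smult (p k 0) (of_real_poly (P k) :: complex poly))"
        by (simp add: kernel_def of_real_poly_sum of_real_poly_smult p_at_0[where 'a = complex])
      have "J n = L (synthetic_div (of_real_poly (kernel n)) z) + poly (of_real_poly (kernel n)) z * ?w"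
        using integral_poly_times_cauchy_kernel(2)[OF hm z, of "of_real_poly (kernel n)"]
        by (simp add: J_def poly_of_real_poly_of_real)
      also have "\<dots> = (\<Sum>k<n. p k 0 * q k z) + (\<Sum>k<n. p k 0 * p k z) * ?w"
        unfolding ck by (simp add: moment_functional_synthetic_div_sum poly_sum op_q_def[of _ _ z] op_p_def[of _ _ z])
      finally show ?thesis by (simp add: C_part_def D_part_def algebra_simps)
    qed
    have "J \<longlonglongrightarrow> - (1 / z)"
    proof -
      have "(\<lambda>n. J n - - (1 / z)) \<longlonglongrightarrow> 0"
      proof (rule Lim_null_comparison[OF always_eventually, rule_format])
        fix n
        have "J n - - (1 / z) = (\<integral>x. complex_of_real (d n x) * ?f x \<partial>\<mu>)"
          unfolding J_def Ief[symmetric] using Kf[of n] ief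
          by (subst Bochner_Integration.integral_diff[symmetric]) (auto simp: d_def algebra_simps diff_divide_distrib)
        also have "norm \<dots> \<le> (\<integral>x. norm (complex_of_real (d n x) * ?f x) \<partial>\<mu>)" by (rule integral_norm_bound)
        also have "\<dots> \<le> (\<integral>x. \<bar>d n x\<bar> * (1 / \<bar>Im z\<bar>) \<partial>\<mu>)"
        proof (rule integral_mono')
          show "integrable \<mu> (\<lambda>x. \<bar>d n x\<bar> * (1 / \<bar>Im z\<bar>))" using id by (intro integrable_mult_left integrable_abs)
          show "norm (complex_of_real (d n x) * ?f x) \<le> \<bar>d n x\<bar> * (1 / \<bar>Im z\<bar>)" for x
            unfolding norm_mult norm_of_real by (intro mult_left_mono norm_cauchy_kernel_le z) simp
        qed simp
        also have "\<dots> = (\<integral>x. \<bar>d n x\<bar> \<partial>\<mu>) * (1 / \<bar>Im z\<bar>)" by (rule integral_mult_left_zero)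
        finally show "norm (J n - - (1 / z)) \<le> (\<integral>x. \<bar>d n x\<bar> \<partial>\<mu>) * (1 / \<bar>Im z\<bar>)" .
      next
        show "(\<lambda>n. (\<integral>x. \<bar>d n x\<bar> \<partial>\<mu>) * (1 / \<bar>Im z\<bar>)) \<longlonglongrightarrow> 0"
          by (rule tendsto_mult_left_zero[OF d0])
      qed
      then show ?thesis by (rule LIM_zero_cancel)
    qed
    then have "(\<lambda>n. z * J n) \<longlonglongrightarrow> z * - (1 / z)" by (intro tendsto_intros)
    moreover have "(\<lambda>n. z * J n) \<longlonglongrightarrow> (nev_C s z - 1) + nev_D s z * ?w"
      unfolding J by (intro tendsto_intros C_part_tendsto D_part_tendsto)
    ultimately have "z * - (1 / z) = (nev_C s z - 1) + nev_D s z * ?w" by (rule LIMSEQ_unique)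
    then have CD: "nev_C s z = - nev_D s z * ?w" using z0 by (simp add: eq_neg_iff_add_eq_0)
    moreover have "nev_D s z \<noteq> 0" using nev_det[of z] CD by auto
    ultimately show ?thesis by (simp add: nev_quotient_def)
  qed
  show ?thesis
    unfolding is_N_extremal_solution_def using s0 ind \<mu> tr by (auto simp: stieltjes_transform_def)
qed

end

locale friedrichs_moments = stieltjes_positive_definite + indeterminate_moments +
  fixes F :: real
  assumes indet: "indeterminate s" and F_pos: "F > 0" and F: "friedrichs_parameter s = ereal F"
    and c_limit: "c \<longlonglongrightarrow> F" and c_le_F: "c n \<le> F"

lemma indetS_friedrichs_moments:
  assumes "indetS s" "s 0 = 1"
  obtains F where "friedrichs_moments s F"
proof -
  obtain F where F: "stieltjes_positive_definite s" "F > 0" "friedrichs_parameter s = ereal F"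
    "stieltjes_positive_definite.c s \<longlonglongrightarrow> F" "\<And>n. stieltjes_positive_definite.c s n \<le> F"
    using indetS_c_limit[OF assms] by blast
  have ind: "indeterminate s" using assms(1) by (simp add: indetS_def indet_stieltjes_def)
  then show ?thesis
    using that[of F] F indeterminate_imp_indeterminate_moments[OF ind assms(2)]
    by (simp add: friedrichs_moments_def friedrichs_moments_axioms_def)
qed

context friedrichs_moments
begin

text \<open>Inserting q_n(0) = - c_n p_n(0) into \<open>p_eq_BD\<close> and \<open>q_eq_AC\<close>
  shows that -q_n/p_n is the truncated quotient with parameter c_n.\<close>

lemma friedrichs_solution_of_gauss_limit:
  assumes \<gamma>: "has_moments \<gamma> s" and j: "strict_mono j"
    and lim: "\<And>z. z \<notin> \<real> \<Longrightarrow> (\<lambda>k. - q (j k) z / p (j k) z) \<longlonglongrightarrow> stieltjes_transform \<gamma> z"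
  shows "is_N_extremal_solution s (friedrichs_parameter s) \<gamma>"
proof -
  have "stieltjes_transform \<gamma> z = nev_quotient s (ereal F) z" if z: "z \<notin> \<real>" for z
  proof (rule nev_quotient_limit[OF j LIMSEQ_subseq_LIMSEQ[OF c_limit j] lim[OF z]])
    fix k
    have pz: "p (j k) z \<noteq> 0"
      using root_P_positive[of "j k" z] z unfolding op_p_def by (metis Reals_of_real)
    have p0: "p (j k) (0::complex) \<noteq> 0"
      using p_nonpos_nonzero[of 0 "j k"] by (simp add: p_at_0[where 'a = complex])
    have q0: "q (j k) (0::complex) = - of_real (c (j k)) * p (j k) 0"
      by (simp add: p_at_0[where 'a = complex] q_at_0[where 'a = complex] q_0_eq)
    have pn: "p (j k) z = - p (j k) 0 * (B_part (j k) z + of_real (c (j k)) * D_part (j k) z)"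
      by (subst p_eq_BD) (simp add: q0 algebra_simps)
    have qn: "q (j k) z = - p (j k) 0 * (A_part (j k) z + of_real (c (j k)) * C_part (j k) z)"
      by (subst q_eq_AC) (simp add: q0 algebra_simps)
    have "B_part (j k) z + of_real (c (j k)) * D_part (j k) z \<noteq> 0" using pz pn by auto
    then show "- (A_part (j k) z + of_real ((c \<circ> j) k) * C_part (j k) z)
      = - q (j k) z / p (j k) z * (B_part (j k) z + of_real ((c \<circ> j) k) * D_part (j k) z)"
      unfolding pn qn using p0 by simp
  qed
  then show ?thesis
    unfolding is_N_extremal_solution_def
    using s0 indet F has_moments_solution[OF \<gamma> pd] by (auto simp: stieltjes_transform_def)
qed

text \<open>The limit \<gamma> of normalized quadratures, rescaled to \<rho>, has a density \<mu> =
  x \<rho> with the quotient of parameter t; this resolves the definite description, and dividing by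
  x returns \<rho>. The last clause keeps the origin of \<sigma>, by which a Friedrichs solution is
  recognised.\<close>

lemma shifted_solution:
  assumes t: "F \<le> t"
  defines "s2 \<equiv> normalized_seq (shifted_seq s t)" and "\<sigma> \<equiv> inv_x_measure (N_extremal_solution s (ereal t))"
  shows "has_moments \<sigma> (shifted_seq s t)" and "AE x in \<sigma>. x \<ge> 0" and "measure \<sigma> {0} = 0"
    and "\<exists>r. strict_mono r \<and>
      (\<forall>z. z \<notin> \<real> \<longrightarrow> (\<lambda>k. - op_q s2 (r k) z / op_p s2 (r k) z) \<longlonglongrightarrow> stieltjes_transform (normalized_measure \<sigma>) z)"
proof -
  have ct: "c n \<le> t" for n using c_le_F[of n] t by simp
  interpret N: stieltjes_positive_definite s2
    unfolding s2_def by (rule shifted_positive_definite[OF ct])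
  have t0: "t > 0" using t F_pos by simp
  obtain \<gamma> r where \<gamma>: "has_moments \<gamma> s2" "AE x in \<gamma>. x \<ge> 0" and r: "strict_mono r"
    and lim: "\<And>z. z \<notin> \<real> \<Longrightarrow> (\<lambda>k. - N.q (r k) z / N.p (r k) z) \<longlonglongrightarrow> stieltjes_transform \<gamma> z"
    using N.gauss_limit by blast
  define \<rho> where "\<rho> = scale_measure (ennreal t) \<gamma>"
  have "(\<lambda>n. t * s2 n) = shifted_seq s t"
    using t0 by (simp add: s2_def normalized_seq_def shifted_seq_def fun_eq_iff)
  then have \<rho>1: "has_moments \<rho> (shifted_seq s t)"
    using has_moments_scale[OF \<gamma>(1), of t] t0 by (simp add: \<rho>_def)
  have \<rho>2: "AE x in \<rho>. x \<ge> 0"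
    unfolding \<rho>_def AE_scale_measure[OF t0] by (rule \<gamma>(2))
  note \<rho> = \<rho>1 \<rho>2
  define \<mu> where "\<mu> = density \<rho> (\<lambda>x. ennreal x)"
  have \<mu>: "has_moments \<mu> s" unfolding \<mu>_def by (rule has_moments_x_density[OF \<rho>])
  have tr\<mu>: "stieltjes_transform \<mu> z = of_real t + z * (of_real t * stieltjes_transform \<gamma> z)" if "z \<notin> \<real>" for z
    unfolding \<mu>_def stieltjes_transform_x_density[OF \<rho> that]
    using t0 by (simp add: \<rho>_def stieltjes_transform_scale[OF \<gamma>(1)])
  have tr: "stieltjes_transform \<mu> z = nev_quotient s (ereal t) z" if z: "z \<notin> \<real>" for z
  proof (rule nev_quotient_limit[OF r tendsto_const])
    show "(\<lambda>k. of_real t + z * (of_real t * (- N.q (r k) z / N.p (r k) z))) \<longlonglongrightarrow> stieltjes_transform \<mu> z"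
      unfolding tr\<mu>[OF z] by (intro tendsto_intros lim[OF z])
  qed (use shifted_quotient[OF ct z] in \<open>simp add: s2_def\<close>)
  have ext: "is_N_extremal_solution s (ereal t) \<mu>"
    unfolding is_N_extremal_solution_def
    using s0 indet has_moments_solution[OF \<mu> pd] tr by (auto simp: stieltjes_transform_def)
  interpret \<rho>: finite_borel_measure \<rho> by (rule has_moments_finite_borel_measure[OF \<rho>(1)])
  \<comment> \<open>The mass of \<rho> at 0 is the limit of -z times its transform, that is, of t
    minus the transform of \<mu>, and the latter tends to the parameter t.\<close>
  have atom: "measure \<rho> {0} = 0"
  proof -
    define y where "y n = 1 / real (Suc n)" for n
    have "(\<lambda>n. nev_quotient s (ereal t) (\<i> * of_real (y n))) \<longlonglongrightarrow> of_real (real_of_ereal (ereal t))"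
      unfolding y_def by (rule nev_quotient_at_0) simp_all
    then have "(\<lambda>n. of_real t - nev_quotient s (ereal t) (\<i> * of_real (y n))) \<longlonglongrightarrow> of_real t - of_real t"
      by (intro tendsto_intros) simp
    moreover have "of_real t - nev_quotient s (ereal t) (\<i> * of_real (y n))
        = - (\<i> * of_real (y n)) * stieltjes_transform \<rho> (\<i> * of_real (y n))" for n
    proof -
      have nr: "\<i> * complex_of_real (y n) \<notin> \<real>" by (simp add: y_def Im_nonzero_iff)
      show ?thesis
        unfolding tr[OF nr, symmetric] \<mu>_def stieltjes_transform_x_density[OF \<rho> nr] by simp
    qed
    ultimately have "(\<lambda>n. - (\<i> * of_real (y n)) * stieltjes_transform \<rho> (\<i> * of_real (y n))) \<longlonglongrightarrow> 0"
      by simp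
    with \<rho>.atom_at_0_eq_limit have "complex_of_real (measure \<rho> {0}) = 0"
      unfolding y_def by (rule LIMSEQ_unique)
    then show ?thesis by simp
  qed
  have \<sigma>: "\<sigma> = \<rho>"
    unfolding \<sigma>_def N_extremal_solution_eq[OF ext] \<mu>_def by (rule inv_x_measure_x_density[OF \<rho> atom])
  show "has_moments \<sigma> (shifted_seq s t)" "AE x in \<sigma>. x \<ge> 0" "measure \<sigma> {0} = 0"
    unfolding \<sigma> by (fact \<rho>1 \<rho>2 atom)+
  have "normalized_measure \<rho> = \<gamma>"
    using normalized_measure_eq[OF \<rho>(1)] t0 by (simp add: shifted_seq_def \<rho>_def flip: ennreal_mult)
  then show "\<exists>r. strict_mono r \<and>
      (\<forall>z. z \<notin> \<real> \<longrightarrow> (\<lambda>k. - op_q s2 (r k) z / op_p s2 (r k) z) \<longlonglongrightarrow> stieltjes_transform (normalized_measure \<sigma>) z)"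
    using r lim by (auto simp: \<sigma>)
qed

end

lemma solutionsD: "\<mu> \<in> solutions s \<Longrightarrow> \<mu> \<in> Mstar \<and> moments \<mu> = s"
  by (simp add: solutions_def)

section \<open>Solutions of the shifted problem with and without an atom at 0\<close>

context friedrichs_moments
begin

definition inv_sol :: "real \<Rightarrow> real measure" where
  "inv_sol t = inv_x_measure (N_extremal_solution s (ereal t))"

lemma shifted_seq_positive_definite:
  assumes "F \<le> t"
  shows "positive_definite (shifted_seq s t)"
proof -
  have ct: "c n \<le> t" for n using c_le_F[of n] assms by simp
  interpret N: stieltjes_positive_definite "normalized_seq (shifted_seq s t)"
    by (rule shifted_positive_definite[OF ct])
  show ?thesis
    unfolding positive_definite_def
  proof (intro allI impI)
    fix f :: "real poly" assume "f \<noteq> 0"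
    from N.pos[OF this] show "moment_functional (shifted_seq s t) (f * f) > 0"
      unfolding moment_functional_normalized_shifted using assms F_pos by (simp add: zero_less_divide_iff)
  qed
qed

lemma inv_sol:
  assumes "F \<le> t"
  shows "has_moments (inv_sol t) (shifted_seq s t)" "AE x in inv_sol t. x \<ge> 0" "measure (inv_sol t) {0} = 0"
  unfolding inv_sol_def by (rule shifted_solution[OF assms])+

text \<open>The atom fills the gap between the masses t' and t and leaves the higher moments alone.
  The case t' = F is the Krein solution, larger t' < t are the intermediate ones.\<close>

lemma inv_sol_with_atom:
  assumes "F \<le> t'" "t' \<le> t"
  shows "has_moments (add_atom0 (t - t') (inv_sol t')) (shifted_seq s t)"
    and "add_atom0 (t - t') (inv_sol t') \<in> stieltjes_solutions (shifted_seq s t)"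
    and "measure (add_atom0 (t - t') (inv_sol t')) {0} = t - t'"
proof -
  note i = inv_sol[OF assms(1)]
  have "(\<lambda>n. (if n = 0 then t - t' else 0) + shifted_seq s t' n) = shifted_seq s t"
    by (simp add: shifted_seq_def fun_eq_iff)
  then show hm: "has_moments (add_atom0 (t - t') (inv_sol t')) (shifted_seq s t)"
    using has_moments_add_atom0[OF i(1), of "t - t'"] assms by simp
  show "add_atom0 (t - t') (inv_sol t') \<in> stieltjes_solutions (shifted_seq s t)"
  proof (rule has_moments_stieltjes_solution[OF hm])
    show "positive_definite (shifted_seq s t)" using assms by (intro shifted_seq_positive_definite) simp
    show "AE x in add_atom0 (t - t') (inv_sol t'). 0 \<le> x"
      using i by (intro AE_nonneg_add_atom0) (auto simp: has_moments_def)
  qed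
  show "measure (add_atom0 (t - t') (inv_sol t')) {0} = t - t'"
    using measure_add_atom0[OF i(1), of "t - t'"] assms i(3) by simp
qed

lemma inv_sol_stieltjes_solution:
  assumes "F \<le> t"
  shows "inv_sol t \<in> stieltjes_solutions (shifted_seq s t)"
  using inv_sol[OF assms] shifted_seq_positive_definite[OF assms] by (intro has_moments_stieltjes_solution)

text \<open>The two solutions are told apart by their masses 0 and t - F at the origin.\<close>

lemma indetS_shifted_seq:
  assumes "F < t"
  shows "indetS (shifted_seq s t)"
proof (rule indetSI)
  show "inv_sol t \<in> stieltjes_solutions (shifted_seq s t)" using assms by (intro inv_sol_stieltjes_solution) simp
  show "add_atom0 (t - F) (inv_sol F) \<in> stieltjes_solutions (shifted_seq s t)"
    using assms by (intro inv_sol_with_atom) auto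
  show "inv_sol t \<noteq> add_atom0 (t - F) (inv_sol F)"
    using inv_sol(3)[of t] inv_sol_with_atom(3)[of F t] assms by auto
qed

lemma normalized_shifted_seq_0:
  assumes "F \<le> t"
  shows "normalized_seq (shifted_seq s t) 0 = 1"
  using assms F_pos by (simp add: normalized_seq_def shifted_seq_def)

text \<open>After rescaling, the shifted sequence is itself a normalized indet(S) sequence with a
  Friedrichs parameter F2 of its own, so the recognition of Gauss limits applies to it.\<close>

lemma friedrichs_solution_shifted:
  assumes t: "F < t"
  shows "is_friedrichs_solution (shifted_seq s t) (inv_sol t)"
proof -
  let ?s = "normalized_seq (shifted_seq s t)"
  have le: "F \<le> t" using t by simp
  have iS: "indetS (shifted_seq s t)" by (rule indetS_shifted_seq[OF t])
  obtain F2 where "friedrichs_moments ?s F2"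
    using indetS_friedrichs_moments[OF indetS_normalized_seq[OF iS] normalized_shifted_seq_0[OF le]] by blast
  then interpret N: friedrichs_moments ?s F2 .
  obtain j where j: "strict_mono j" "\<And>z. z \<notin> \<real> \<Longrightarrow>
      (\<lambda>k. - N.q (j k) z / N.p (j k) z) \<longlonglongrightarrow> stieltjes_transform (normalized_measure (inv_sol t)) z"
    using shifted_solution(4)[OF le] unfolding inv_sol_def by blast
  have "has_moments (normalized_measure (inv_sol t)) ?s"
    using inv_sol(1)[OF le] le F_pos by (intro has_moments_normalized_measure) (auto simp: shifted_seq_def)
  from N.friedrichs_solution_of_gauss_limit[OF this j]
  show ?thesis
    unfolding is_friedrichs_solution_def
    using iS inv_sol_stieltjes_solution[OF le] by (auto simp: indetS_def stieltjes_solutions_def)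
qed

lemma measure_normalized_measure_0:
  assumes "has_moments \<mu> (shifted_seq s t)" "F \<le> t"
  shows "measure (normalized_measure \<mu>) {0} = measure \<mu> {0} / t"
proof -
  have "shifted_seq s t 0 = t" "t > 0" using assms(2) F_pos by (auto simp: shifted_seq_def)
  then show ?thesis using normalized_measure_eq[OF assms(1)] by simp
qed

text \<open>The kernel sums t/(t - c_n) tend to the reciprocal of the normalized atom (t - F)/t,
  which is the hypothesis of \<open>krein_of_maximal_atom\<close>.\<close>

lemma krein_solution_shifted:
  assumes t: "F < t"
  shows "is_krein_solution (shifted_seq s t) (add_atom0 (t - F) (inv_sol F))"
proof -
  let ?s = "normalized_seq (shifted_seq s t)" and ?\<tau> = "add_atom0 (t - F) (inv_sol F)"
  have le: "F \<le> t" and t0: "t > 0" using t F_pos by auto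
  have ct: "c n \<le> t" for n using c_le_F[of n] le by simp
  have iS: "indetS (shifted_seq s t)" by (rule indetS_shifted_seq[OF t])
  then have ind: "indeterminate ?s" by (intro indeterminate_normalized_seq) (simp add: indetS_def indet_stieltjes_def)
  interpret N: indeterminate_moments ?s
    by (rule indeterminate_imp_indeterminate_moments[OF ind normalized_shifted_seq_0[OF le]])
  note \<tau> = inv_sol_with_atom[OF order_refl le]
  have \<tau>s: "?\<tau> \<in> solutions (shifted_seq s t)" using \<tau>(2) by (simp add: stieltjes_solutions_def)
  have mass: "measure (normalized_measure ?\<tau>) {0} = (t - F) / t"
    using measure_normalized_measure_0[OF \<tau>(1) le] \<tau>(3) by simp
  have "is_N_extremal_solution ?s \<infinity> (normalized_measure ?\<tau>)"
  proof (rule N.krein_of_maximal_atom[OF ind normalized_measure_solution[OF \<tau>s]])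
    show "0 < measure (normalized_measure ?\<tau>) {0}" using mass t t0 by simp
    have "(\<lambda>n. t / (t - c n)) \<longlonglongrightarrow> t / (t - F)"
      using t by (intro tendsto_intros c_limit) auto
    moreover have "\<forall>\<^sub>F n in sequentially. t / (t - c n) = (\<Sum>k<Suc n. (N.p k (0::real))\<^sup>2)"
      by (intro eventually_sequentiallyI[of 1]) (simp only: shifted_kernel_sum[OF ct])
    ultimately have "(\<lambda>n. \<Sum>k<Suc n. (N.p k (0::real))\<^sup>2) \<longlonglongrightarrow> t / (t - F)"
      by (rule Lim_transform_eventually)
    then show "(\<lambda>n. \<Sum>k<n. (N.p k (0::real))\<^sup>2) \<longlonglongrightarrow> 1 / measure (normalized_measure ?\<tau>) {0}"
      unfolding mass by (subst filterlim_sequentially_Suc[symmetric]) simp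
  qed
  then show ?thesis
    unfolding is_krein_solution_def using iS \<tau>s by (simp add: indetS_def)
qed

lemma determinate_inv_sol_F: "determinate_measure (inv_sol F)"
proof -
  let ?s = "normalized_seq (shifted_seq s F)"
  have sol: "inv_sol F \<in> solutions (shifted_seq s F)"
    using inv_sol_stieltjes_solution[of F] by (simp add: stieltjes_solutions_def)
  have "determinate (shifted_seq s F)"
  proof (rule ccontr)
    assume "\<not> ?thesis"
    with sol have "indeterminate (shifted_seq s F)" by (auto simp: indeterminate_def)
    then have ind: "indeterminate ?s" by (rule indeterminate_normalized_seq)
    interpret N: indeterminate_moments ?s
      by (rule indeterminate_imp_indeterminate_moments[OF ind normalized_shifted_seq_0[OF order_refl]])
    obtain \<beta> where "N.l2_bounded_by \<beta> 0" using N.l2_bounded by blast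
    then have \<beta>: "(\<Sum>k<n. (N.p k (0::real))\<^sup>2) \<le> \<beta>" for n
      by (simp add: N.l2_bounded_by_def N.p_at_0[where 'a = complex])
    \<comment> \<open>Multiplied out, the bound on F/(F - c_n) has a limit on both sides, namely F
      \<le> 0.\<close>
    have bound: "F \<le> \<beta> * (F - c n)" if n: "n > 0" for n
    proof -
      have "c n < F" using c_le_F[of "Suc n"] c_less[of n "Suc n"] by simp
      moreover have "F / (F - c n) \<le> \<beta>"
        using shifted_kernel_sum[OF c_le_F n] \<beta>[of "Suc n"] by simp
      ultimately show ?thesis by (simp add: pos_divide_le_eq)
    qed
    have "(\<lambda>n. \<beta> * (F - c n)) \<longlonglongrightarrow> \<beta> * (F - F)" by (intro tendsto_intros c_limit)
    then have "F \<le> \<beta> * (F - F)"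
      by (rule LIMSEQ_le_const) (use bound in \<open>auto intro!: exI[of _ 1]\<close>)
    with F_pos show False by simp
  qed
  then show ?thesis using solutionsD[OF sol] by (simp add: determinate_measure_def)
qed

text \<open>A finite parameter admits no atom at 0. The infinite one belongs to the Krein solution
  alone, whose mass t - F at 0 exceeds t - t'.\<close>

lemma not_N_extremal_intermediate:
  assumes "F < t'" "t' < t"
  shows "\<not> N_extremal (add_atom0 (t - t') (inv_sol t'))"
proof
  let ?\<kappa> = "add_atom0 (t - t') (inv_sol t')" and ?s = "normalized_seq (shifted_seq s t)"
  have le: "F \<le> t'" "t' \<le> t" "F \<le> t" and t: "F < t" and t0: "t > 0" using assms F_pos by auto
  note \<kappa> = inv_sol_with_atom[OF le(1,2)]
  have sol: "?\<kappa> \<in> solutions (shifted_seq s t)" using \<kappa>(2) by (simp add: stieltjes_solutions_def)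
  have mass: "measure (normalized_measure ?\<kappa>) {0} = (t - t') / t"
    using measure_normalized_measure_0[OF \<kappa>(1) le(3)] \<kappa>(3) by simp
  assume "N_extremal ?\<kappa>"
  then obtain u where u: "is_N_extremal_solution ?s u (normalized_measure ?\<kappa>)"
    unfolding N_extremal_def using solutionsD[OF sol] by auto
  then have ind: "indeterminate ?s" by (simp add: is_N_extremal_solution_def)
  interpret N: indeterminate_moments ?s
    by (rule indeterminate_imp_indeterminate_moments[OF ind normalized_shifted_seq_0[OF le(3)]])
  show False
  proof (cases "u = \<infinity>")
    case False
    then show False using N.atom_at_0_of_finite_parameter[OF u] mass assms t0 by simp
  next
    case True
    have "is_N_extremal_solution ?s u (normalized_measure (add_atom0 (t - F) (inv_sol F)))"
      using krein_solution_shifted[OF t] unfolding True is_krein_solution_def by blast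
    from is_N_extremal_solution_unique[OF u this]
    have "measure (normalized_measure ?\<kappa>) {0} = (t - F) / t"
      using measure_normalized_measure_0[OF inv_sol_with_atom(1)[OF order_refl le(3)] le(3)]
        inv_sol_with_atom(3)[OF order_refl le(3)] by simp
    then show False using mass assms t0 by simp
  qed
qed

end

theorem theorem3p3:
  fixes s :: "nat \<Rightarrow> real"
  assumes "s 0 = 1" and "indetS s"
  shows
    "(\<forall>t::real. friedrichs_parameter s < ereal t \<longrightarrow>
         indetS_measure (inv_x_measure (N_extremal_solution s (ereal t)))) \<and>
     determinate_measure (inv_x_measure (N_extremal_solution s (friedrichs_parameter s))) \<and>
     (\<forall>t::real. friedrichs_parameter s < ereal t \<longrightarrow>
         is_friedrichs_solution (shifted_seq s t)
           (inv_x_measure (N_extremal_solution s (ereal t))) \<and>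
         is_krein_solution (shifted_seq s t)
           (add_atom0 (t - real_of_ereal (friedrichs_parameter s))
             (inv_x_measure (N_extremal_solution s (friedrichs_parameter s))))) \<and>
     (\<forall>t' t :: real. friedrichs_parameter s < ereal t' \<and> t' < t \<longrightarrow>
         add_atom0 (t - t') (inv_x_measure (N_extremal_solution s (ereal t')))
           \<in> solutions (shifted_seq s t) \<and>
         \<not> N_extremal
             (add_atom0 (t - t') (inv_x_measure (N_extremal_solution s (ereal t')))))"
proof -
  obtain F where "friedrichs_moments s F" using indetS_friedrichs_moments[OF assms(2,1)] by blast
  then interpret friedrichs_moments s F .
  have indetS: "indetS_measure (inv_sol t)" if "F < t" for t
  proof -
    have "inv_sol t \<in> stieltjes_solutions (shifted_seq s t)"
      using that by (intro inv_sol_stieltjes_solution) simp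
    then show ?thesis
      using indetS_shifted_seq[OF that] solutionsD[of "inv_sol t" "shifted_seq s t"]
      by (auto simp: stieltjes_solutions_def indetS_measure_def)
  qed
  have sol: "add_atom0 (t - t') (inv_sol t') \<in> solutions (shifted_seq s t)" if "F < t'" "t' < t" for t t'
    using inv_sol_with_atom(2)[of t' t] that by (simp add: stieltjes_solutions_def)
  show ?thesis
    \<comment> \<open>The Friedrichs parameter is the real number F, so the comparisons become real
      and the boundary measure becomes \<open>inv_sol F\<close>.\<close>
    unfolding F real_of_ereal.simps less_ereal.simps inv_sol_def[symmetric]
    using indetS determinate_inv_sol_F friedrichs_solution_shifted krein_solution_shifted sol
      not_N_extremal_intermediate by blast
qed

end
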